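(* Fix $\mu\in\mathcal P_2(E)$. Assume there exists a curve of maximal slope $\eta\in AC^2_{\mathrm{loc}}([0,\infty);\mathcal P_2(E))$ for $v_0$ with respect to $G$ such that $\eta_0=\mu$. Then for every $T>0$, $$v_0(\mu)=\inf_{\nu\in\mathcal T_T(\mu)}\big\{\mathcal E_G^T(\mu,\nu)+v_0(\nu)\big\},$$ and the infimum is attained at $\nu=\eta_T$.
   Context: $E\subseteq\mathbb R^d$; $\mathcal P_2(E)$ is the set of probability measures on $E$ with finite second moment, with the Wasserstein-2 metric $\mathcal W_2$. $\mathcal A_0(\mu)$ is the set of pairs $(\boldsymbol\mu,\alpha)$ where $\boldsymbol\mu=(\mu_t)_{t\ge0}$ is a continuous curve in $\mathcal P_2(E)$ with $\mu_0=\mu$, $\alpha:[0,\infty)\times E\to\mathbb R^d$ is Borel with $\int_0^\infty e^{-t}\|\alpha_t\|^2_{L^2(\mu_t)}\mathrm dt<\infty$, and $\partial_t\mu_t+\nabla\cdot(\alpha_t\mu_t)=0$ in the sense of distributions. With a running cost $\ell:\mathcal P_2(E)\to\mathbb R$, continuous and bounded from below, $v_0(\mu)=\inf_{(\boldsymbol\mu,\alpha)\in\mathcal A_0(\mu)}\int_0^\infty e^{-t}\big(\frac12\int_E\|\alpha_t\|^2\mathrm d\mu_t+\ell(\mu_t)\big)\mathrm dt$. $G(\mu):=\sqrt{2(\ell(\mu)-v_0(\mu))}\ge0$; it is a standing assumption of this setting that $G$ is well defined and is a strong upper gradient of $v_0$. $\mathcal T_T(\mu)$ is the set of $\nu\in\mathcal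 P_2(E)$ for which there is a pair $(\boldsymbol\mu,\alpha)$ solving the continuity equation $\partial_t\mu_t+\nabla\cdot(\alpha_t\mu_t)=0$ with $\mu_0=\mu$, $\mu_T=\nu$. $AC^2(I)$: curves with $\mathcal W_2(\mu_s,\mu_t)\le\int_s^tm_u\mathrm du$ for some $m\in L^2(I)$; $AC^2_{loc}$: this holds on each compact subinterval. Metric derivative: $|\mu'|(t)=\lim_{s\to t}\mathcal W_2(\mu_s,\mu_t)/|s-t|$. Strong upper gradient of $\phi$: $g:\mathcal P_2(E)\to[0,\infty]$ such that for every absolutely continuous curve $\boldsymbol\mu$, $g\circ\boldsymbol\mu$ is Borel and $|\phi(\mu_t)-\phi(\mu_s)|\le\int_s^tg(\mu_r)|\mu'|(r)\mathrm dr$ for $s\le t$. Curve of maximal slope for $\phi$ with respect to $g$: $\boldsymbol\mu\in AC^2_{loc}([0,\infty);\mathcal P_2(E))$ with $-(\phi\circ\boldsymbol\mu)'(t)=|\mu'|^2(t)=g^2(\mu_t)$ for a.e. $t>0$. Energy: $\mathcal E_G^T(\mu,\nu)=\inf\big\{\int_0^T\big(\frac12|\eta'|^2(t)+\frac12G(\eta_t)^2\big)\mathrm dt:\ \eta\in AC^2([0,T];\mathcal P_2(E)),\ \eta_0=\mu,\ \eta_T=\nu\big\}$. *)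

theory Defs
  imports "HOL-Analysis.Analysis"
begin

section \<open>Wasserstein space\<close>

text \<open>Elements of \<open>P2 E\<close> live on the Borel (trace) sigma-algebra of the subspace \<open>E\<close>, so
  that \<open>space \<mu> = E\<close> and every integral against \<open>\<mu>\<close> is an integral over \<open>E\<close>.\<close>

definition P2 :: "'a::euclidean_space set \<Rightarrow> 'a measure set" where
  "P2 E = {\<mu>. sets \<mu> = sets (restrict_space borel E) \<and> emeasure \<mu> (space \<mu>) = 1 \<and>
              integrable \<mu> (\<lambda>x. (norm x)\<^sup>2)}"

definition couplings :: "'a measure \<Rightarrow> 'a measure \<Rightarrow> ('a \<times> 'a) measure set" where
  "couplings \<mu> \<nu> =
     {\<gamma>. sets \<gamma> = sets (\<mu> \<Otimes>\<^sub>M \<nu>) \<and> distr \<gamma> \<mu> fst = \<mu> \<and> distr \<gamma> \<nu> snd = \<nu>}"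

text \<open>On \<open>P2 E\<close> the infimum is finite (take the product coupling), so \<open>enn2real\<close> is harmless.\<close>

definition W2 :: "'a::euclidean_space measure \<Rightarrow> 'a measure \<Rightarrow> real" where
  "W2 \<mu> \<nu> =
     sqrt (enn2real (INF \<gamma>\<in>couplings \<mu> \<nu>. \<integral>\<^sup>+z. ennreal ((norm (fst z - snd z))\<^sup>2) \<partial>\<gamma>))"

definition P2_continuous :: "'a::euclidean_space set \<Rightarrow> ('a measure \<Rightarrow> real) \<Rightarrow> bool" where
  "P2_continuous E f \<longleftrightarrow>
     (\<forall>\<mu>\<in>P2 E. \<forall>\<epsilon>>0. \<exists>\<delta>>0. \<forall>\<nu>\<in>P2 E. W2 \<nu> \<mu> < \<delta> \<longrightarrow> \<bar>f \<nu> - f \<mu>\<bar> < \<epsilon>)"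

section \<open>Curves in Wasserstein space\<close>

text \<open>A curve on an interval \<open>I\<close> is a total function on the reals of which only the values on
  \<open>I\<close> are constrained or used.\<close>

definition continuous_curve ::
    "'a::euclidean_space set \<Rightarrow> real set \<Rightarrow> (real \<Rightarrow> 'a measure) \<Rightarrow> bool" where
  "continuous_curve E I \<mu> \<longleftrightarrow>
     (\<forall>t\<in>I. \<mu> t \<in> P2 E \<and> ((\<lambda>s. W2 (\<mu> s) (\<mu> t)) \<longlongrightarrow> 0) (at t within I))"

text \<open>\<open>AC_curve p\<close> is the class \<open>AC\<^sup>p\<close>; \<open>p = 1\<close> gives the absolutely continuous curves.\<close>

definition AC_curve ::
    "nat \<Rightarrow> 'a::euclidean_space set \<Rightarrow> real set \<Rightarrow> (real \<Rightarrow> 'a measure) \<Rightarrow> bool" where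
  "AC_curve p E I \<mu> \<longleftrightarrow>
     (\<forall>t\<in>I. \<mu> t \<in> P2 E) \<and>
     (\<exists>m::real \<Rightarrow> real. set_borel_measurable lborel I m \<and>
        set_integrable lborel I (\<lambda>u. \<bar>m u\<bar> ^ p) \<and>
        (\<forall>s\<in>I. \<forall>t\<in>I. s \<le> t \<longrightarrow> W2 (\<mu> s) (\<mu> t) \<le> (LINT u:{s..t}|lborel. m u)))"

definition AC2_loc_curve ::
    "'a::euclidean_space set \<Rightarrow> real set \<Rightarrow> (real \<Rightarrow> 'a measure) \<Rightarrow> bool" where
  "AC2_loc_curve E I \<mu> \<longleftrightarrow> (\<forall>a b. {a..b} \<subseteq> I \<longrightarrow> AC_curve 2 E {a..b} \<mu>)"

text \<open>The limit is taken within \<open>I\<close>, which only matters at the endpoints of \<open>I\<close>.\<close>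

definition metric_derivative ::
    "real set \<Rightarrow> (real \<Rightarrow> 'a::euclidean_space measure) \<Rightarrow> real \<Rightarrow> real" where
  "metric_derivative I \<mu> t = Lim (at t within I) (\<lambda>s. W2 (\<mu> s) (\<mu> t) / \<bar>s - t\<bar>)"

definition strong_upper_gradient ::
    "'a::euclidean_space set \<Rightarrow> ('a measure \<Rightarrow> real) \<Rightarrow> ('a measure \<Rightarrow> ennreal) \<Rightarrow> bool" where
  "strong_upper_gradient E \<phi> g \<longleftrightarrow>
     (\<forall>I \<mu>. is_interval I \<and> AC_curve 1 E I \<mu> \<longrightarrow>
        (\<lambda>t. g (\<mu> t)) \<in> borel_measurable (restrict_space borel I) \<and>
        (\<forall>s\<in>I. \<forall>t\<in>I. s \<le> t \<longrightarrow>
           ennreal \<bar>\<phi> (\<mu> t) - \<phi> (\<mu> s)\<bar>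
             \<le> (\<integral>\<^sup>+r\<in>{s..t}. (g (\<mu> r) * ennreal (metric_derivative I \<mu> r)) \<partial>lborel)))"

definition maximal_slope_curve ::
    "'a::euclidean_space set \<Rightarrow> ('a measure \<Rightarrow> real) \<Rightarrow> ('a measure \<Rightarrow> ennreal) \<Rightarrow>
     (real \<Rightarrow> 'a measure) \<Rightarrow> bool" where
  "maximal_slope_curve E \<phi> g \<mu> \<longleftrightarrow>
     AC2_loc_curve E {0..} \<mu> \<and>
     (AE t in lborel. t > 0 \<longrightarrow>
        ((\<lambda>s. \<phi> (\<mu> s)) has_real_derivative - (metric_derivative {0..} \<mu> t)\<^sup>2) (at t) \<and>
        ennreal ((metric_derivative {0..} \<mu> t)\<^sup>2) = (g (\<mu> t))\<^sup>2)"

section \<open>Continuity equation\<close>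

primrec Ck :: "nat \<Rightarrow> ('b::euclidean_space \<Rightarrow> real) \<Rightarrow> bool" where
  "Ck 0 f \<longleftrightarrow> continuous_on UNIV f"
| "Ck (Suc k) f \<longleftrightarrow>
     (\<forall>x. f differentiable (at x)) \<and> (\<forall>v. Ck k (\<lambda>x. frechet_derivative f (at x) v))"

definition test_functions :: "'b::euclidean_space set \<Rightarrow> ('b \<Rightarrow> real) set" where
  "test_functions U =
     {\<phi>. (\<forall>k. Ck k \<phi>) \<and> compact (closure {z. \<phi> z \<noteq> 0}) \<and> closure {z. \<phi> z \<noteq> 0} \<subseteq> U}"

text \<open>The measures \<open>\<mu> t\<close> are regarded as measures on the whole space, i.e. the spatial test
  functions are not required to vanish near the boundary of \<open>E\<close>. The integrand is
  \<open>\<partial>\<^sub>t \<phi> + \<nabla>\<phi> \<bullet> \<alpha>\<close>, written as the derivative of \<open>\<phi>\<close> in the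
  space-time direction \<open>(1, \<alpha> t x)\<close>. The integrability condition is what makes the weak
  formulation meaningful; it is implied by square integrability of \<open>\<alpha>\<close>.\<close>

definition continuity_equation ::
    "'a::euclidean_space set \<Rightarrow> real set \<Rightarrow> (real \<Rightarrow> 'a measure) \<Rightarrow> (real \<Rightarrow> 'a \<Rightarrow> 'a) \<Rightarrow> bool" where
  "continuity_equation E I \<mu> \<alpha> \<longleftrightarrow>
     continuous_curve E I \<mu> \<and>
     (\<lambda>(t, x). \<alpha> t x) \<in> borel_measurable (restrict_space borel (I \<times> E)) \<and>
     (\<forall>a b. {a..b} \<subseteq> I \<longrightarrow>
        (\<integral>\<^sup>+t\<in>{a..b}. (\<integral>\<^sup>+x. ennreal (norm (\<alpha> t x)) \<partial>\<mu> t) \<partial>lborel) < \<infinity>) \<and>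
     (\<forall>\<phi>\<in>test_functions (interior I \<times> UNIV).
        (LINT t:I|lborel. (\<integral>x. frechet_derivative \<phi> (at (t, x)) (1, \<alpha> t x) \<partial>\<mu> t)) = 0)"

definition reachable :: "'a::euclidean_space set \<Rightarrow> real \<Rightarrow> 'a measure \<Rightarrow> 'a measure set" where
  "reachable E T \<mu>\<^sub>0 =
     {\<nu>\<in>P2 E. \<exists>\<mu> \<alpha>. continuity_equation E {0..T} \<mu> \<alpha> \<and> \<mu> 0 = \<mu>\<^sub>0 \<and> \<mu> T = \<nu>}"

section \<open>Control problem\<close>

definition admissible ::
    "'a::euclidean_space set \<Rightarrow> 'a measure \<Rightarrow> ((real \<Rightarrow> 'a measure) \<times> (real \<Rightarrow> 'a \<Rightarrow> 'a)) set" where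
  "admissible E \<mu>\<^sub>0 =
     {(\<mu>, \<alpha>). continuity_equation E {0..} \<mu> \<alpha> \<and> \<mu> 0 = \<mu>\<^sub>0 \<and>
        (\<integral>\<^sup>+t\<in>{0..}. (ennreal (exp (- t)) *
           (\<integral>\<^sup>+x. ennreal ((norm (\<alpha> t x))\<^sup>2) \<partial>\<mu> t)) \<partial>lborel) < \<infinity>}"

text \<open>Extended-real Lebesgue integral: positive part minus negative part.\<close>

definition extended_integral :: "real set \<Rightarrow> (real \<Rightarrow> real) \<Rightarrow> ereal" where
  "extended_integral I f =
     enn2ereal (\<integral>\<^sup>+t\<in>I. ennreal (f t) \<partial>lborel) - enn2ereal (\<integral>\<^sup>+t\<in>I. ennreal (- f t) \<partial>lborel)"

text \<open>For admissible pairs and \<open>ell\<close> bounded below the negative part of the integrand is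
  integrable, so the cost is a well-defined element of \<open>(-\<infinity>, \<infinity>]\<close>.\<close>

definition cost ::
    "('a::euclidean_space measure \<Rightarrow> real) \<Rightarrow> (real \<Rightarrow> 'a measure) \<Rightarrow> (real \<Rightarrow> 'a \<Rightarrow> 'a) \<Rightarrow> ereal" where
  "cost ell \<mu> \<alpha> = extended_integral {0..}
     (\<lambda>t. exp (- t) * (1 / 2 * (\<integral>x. (norm (\<alpha> t x))\<^sup>2 \<partial>\<mu> t) + ell (\<mu> t)))"

definition v0 :: "'a::euclidean_space set \<Rightarrow> ('a measure \<Rightarrow> real) \<Rightarrow> 'a measure \<Rightarrow> ereal" where
  "v0 E ell \<mu>\<^sub>0 = (INF (\<mu>, \<alpha>)\<in>admissible E \<mu>\<^sub>0. cost ell \<mu> \<alpha>)"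

text \<open>On \<open>P2 E\<close> the value function is finite when \<open>ell\<close> is bounded below: the cost is bounded
  below by the same constant, and the constant curve with zero control costs \<open>ell \<mu>\<close>.\<close>

abbreviation v0_real :: "'a::euclidean_space set \<Rightarrow> ('a measure \<Rightarrow> real) \<Rightarrow> 'a measure \<Rightarrow> real" where
  "v0_real E ell \<mu> \<equiv> real_of_ereal (v0 E ell \<mu>)"

definition G :: "'a::euclidean_space set \<Rightarrow> ('a measure \<Rightarrow> real) \<Rightarrow> 'a measure \<Rightarrow> real" where
  "G E ell \<mu> = sqrt (2 * (ell \<mu> - v0_real E ell \<mu>))"

definition energy ::
    "'a::euclidean_space set \<Rightarrow> ('a measure \<Rightarrow> real) \<Rightarrow> real \<Rightarrow> 'a measure \<Rightarrow> 'a measure \<Rightarrow> ennreal" where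
  "energy E g T \<mu> \<nu> =
     (INF \<eta>\<in>{\<eta>. AC_curve 2 E {0..T} \<eta> \<and> \<eta> 0 = \<mu> \<and> \<eta> T = \<nu>}.
        \<integral>\<^sup>+t\<in>{0..T}. ennreal (1 / 2 * (metric_derivative {0..T} \<eta> t)\<^sup>2 + 1 / 2 * (g (\<eta> t))\<^sup>2) \<partial>lborel)"

end

theory Submission
  imports Defs "HOL-Probability.Giry_Monad"
begin

text \<open>
  Two inequalities give the theorem, and a third fact, that \<open>\<eta> T\<close> is reachable, carries most of
  the work.

  \<^emph>\<open>Lower bound.\<close> Along every competitor in the energy the strong upper gradient property gives
  \<open>\<bar>v\<^sub>0(\<nu>) - v\<^sub>0(\<mu>)\<bar> \<le> \<integral> G |\<eta>'|\<close>, and Young's inequality bounds this by the energy. Hence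
  \<open>v\<^sub>0(\<mu>) \<le> \<E>(\<mu>, \<nu>) + v\<^sub>0(\<nu>)\<close> for all \<open>\<nu>\<close> in \<open>P2 E\<close> (\<open>upper_gradient_energy_bound\<close>); this may be rearranged
  because \<open>v\<^sub>0\<close> is finite (\<open>value_function_finite\<close>).

  \<^emph>\<open>Upper bound.\<close> On the curve of maximal slope \<open>|\<eta>'|\<^sup>2 = G\<^sup>2 = -(v\<^sub>0 \<circ> \<eta>)'\<close> almost everywhere, so its
  energy is \<open>\<integral> G(\<eta>)\<^sup>2\<close>, and equality holds in Young's inequality. It remains to integrate
  \<open>(v\<^sub>0 \<circ> \<eta>)'\<close>. The upper gradient property bounds the increments of \<open>v\<^sub>0 \<circ> \<eta>\<close> by those of the
  indefinite integral of \<open>G(\<eta>)\<^sup>2\<close>, which is integrable since the metric derivative of an \<open>AC\<^sup>2\<close> curve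
  is square integrable (\<open>metric_derivative_square_integrable\<close>). Fatou's lemma for difference quotients
  then yields \<open>\<integral>\<^sub>0\<^sup>T G(\<eta>)\<^sup>2 \<le> v\<^sub>0(\<eta>\<^sub>0) - v\<^sub>0(\<eta>\<^sub>T)\<close> (\<open>dissipation_integral_le\<close>,
  \<open>maximal_slope_energy_le\<close>).

  \<^emph>\<open>Reachability.\<close> An \<open>AC\<^sup>2\<close> curve of measures solves the continuity equation for some velocity field
  (\<open>AC2_curve_reachable\<close>). The field is found by Riesz representation in \<open>L\<^sup>2\<close> of the space-time
  measure \<open>\<mu>\<^sub>t(dx) dt\<close>: the functional \<open>\<phi> \<mapsto> -\<integral>\<integral> \<partial>\<^sub>t\<phi> d\<mu>\<^sub>t dt\<close> is controlled by
  \<open>\<integral>\<integral> |\<nabla>\<phi>|\<^sup>2 d\<mu>\<^sub>t dt\<close> (\<open>time_derivative_bound\<close>), because moving mass from \<open>\<mu>\<^sub>t\<close> to \<open>\<mu>\<^sub>t\<^sub>+\<^sub>h\<close> along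
  an almost optimal coupling changes the integral of \<open>\<phi>\<close> by at most \<open>|\<nabla>\<phi>|\<close> times the distance moved,
  up to second order. Hence the functional is \<open>\<phi> \<mapsto> \<integral>\<integral> \<nabla>\<phi> \<bullet> \<alpha> d\<mu>\<^sub>t dt\<close> for some square
  integrable \<open>\<alpha>\<close> (\<open>L2_representation\<close>), which is the weak continuity equation.
\<close>

section \<open>Riesz representation by energy minimisation\<close>

lemma square_integrable_inner:
  fixes u v :: "'x \<Rightarrow> 'a::euclidean_space"
  assumes [measurable]: "u \<in> borel_measurable M" "v \<in> borel_measurable M"
    and "integrable M (\<lambda>x. (norm (u x))\<^sup>2)" "integrable M (\<lambda>x. (norm (v x))\<^sup>2)"
  shows "integrable M (\<lambda>x. u x \<bullet> v x)"
proof (rule Bochner_Integration.integrable_bound)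
  show "integrable M (\<lambda>x. (norm (u x))\<^sup>2 + (norm (v x))\<^sup>2)"
    using assms by simp
  have "\<bar>u x \<bullet> v x\<bar> \<le> (norm (u x))\<^sup>2 + (norm (v x))\<^sup>2" for x
  proof -
    have "\<bar>u x \<bullet> v x\<bar> \<le> norm (u x) * norm (v x)" by (rule Cauchy_Schwarz_ineq2)
    also have "\<dots> \<le> (norm (u x))\<^sup>2 + (norm (v x))\<^sup>2"
      using sum_squares_bound[of "norm (u x)" "norm (v x)"]
        mult_nonneg_nonneg[OF norm_ge_zero[of "u x"] norm_ge_zero[of "v x"]] by linarith
    finally show ?thesis .
  qed
  then show "AE x in M. norm (u x \<bullet> v x) \<le> norm ((norm (u x))\<^sup>2 + (norm (v x))\<^sup>2)" by simp
qed measurable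

lemma norm_square_add_scaleR:
  fixes u v :: "'a::real_inner"
  shows "(norm (u + a *\<^sub>R v))\<^sup>2 = (norm u)\<^sup>2 + 2 * a * (u \<bullet> v) + a\<^sup>2 * (norm v)\<^sup>2"
  unfolding power2_norm_eq_inner
  by (simp add: inner_add_left inner_add_right inner_commute power2_eq_square algebra_simps)

lemma square_integral_add_scaleR:
  fixes u v :: "'x \<Rightarrow> 'a::euclidean_space"
  assumes m: "u \<in> borel_measurable M" "v \<in> borel_measurable M"
    and i: "integrable M (\<lambda>x. (norm (u x))\<^sup>2)" "integrable M (\<lambda>x. (norm (v x))\<^sup>2)"
  shows "(\<integral>x. (norm (u x + a *\<^sub>R v x))\<^sup>2 \<partial>M)
           = (\<integral>x. (norm (u x))\<^sup>2 \<partial>M) + 2 * a * (\<integral>x. u x \<bullet> v x \<partial>M) + a\<^sup>2 * (\<integral>x. (norm (v x))\<^sup>2 \<partial>M)"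
  unfolding norm_square_add_scaleR using square_integrable_inner[OF m i] i by simp

text \<open>Completeness of \<open>L\<^sup>2\<close> for sequences that are Cauchy at a geometric rate. By Young,
  \<open>2 |d\<^sub>n| \<le> 2\<^sup>-\<^sup>n + 2\<^sup>n |d\<^sub>n|\<^sup>2\<close> for the increments \<open>d\<^sub>n\<close>, and the rate makes \<open>\<Sum> 2\<^sup>n |d\<^sub>n|\<^sup>2\<close> integrable, so
  the sequence converges almost everywhere; Fatou's lemma transfers the bounds to the limit. Since the
  squares themselves are summed, the measure may be infinite.\<close>
lemma rapid_Cauchy_L2_limit:
  fixes u :: "nat \<Rightarrow> 'x \<Rightarrow> 'a::euclidean_space"
  assumes [measurable]: "\<And>n. u n \<in> borel_measurable M"
    and cauchy: "\<And>n m. n \<le> m \<Longrightarrow>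
      (\<integral>\<^sup>+x. ennreal ((norm (u m x - u n x))\<^sup>2) \<partial>M) \<le> ennreal ((1/4)^n)"
  obtains v where "v \<in> borel_measurable M"
    "\<And>n. (\<integral>\<^sup>+x. ennreal ((norm (v x - u n x))\<^sup>2) \<partial>M) \<le> ennreal ((1/4)^n)"
proof -
  define d where "d n x = u (Suc n) x - u n x" for n x
  have [measurable]: "d n \<in> borel_measurable M" for n unfolding d_def by measurable
  have "(\<integral>\<^sup>+x. (\<Sum>n. ennreal (2^n * (norm (d n x))\<^sup>2)) \<partial>M)
      = (\<Sum>n. \<integral>\<^sup>+x. ennreal (2^n * (norm (d n x))\<^sup>2) \<partial>M)"
    by (rule nn_integral_suminf) measurable
  also have "\<dots> \<le> (\<Sum>n. ennreal ((1/2)^n))"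
  proof (rule suminf_le)
    fix n
    have "(\<integral>\<^sup>+x. ennreal (2^n * (norm (d n x))\<^sup>2) \<partial>M) = ennreal (2^n) * (\<integral>\<^sup>+x. ennreal ((norm (d n x))\<^sup>2) \<partial>M)"
      by (subst nn_integral_cmult[symmetric]) (auto simp: ennreal_mult)
    also have "\<dots> \<le> ennreal (2^n) * ennreal ((1/4)^n)"
      unfolding d_def by (intro mult_left_mono cauchy) auto
    also have "\<dots> = ennreal ((1/2)^n)"
      by (simp add: ennreal_mult[symmetric] power_mult_distrib[symmetric])
    finally show "(\<integral>\<^sup>+x. ennreal (2^n * (norm (d n x))\<^sup>2) \<partial>M) \<le> ennreal ((1/2)^n)" .
  qed auto
  also have "\<dots> < \<infinity>"
    by (subst suminf_ennreal2) (auto simp: summable_geometric)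
  finally have fin: "(\<integral>\<^sup>+x. (\<Sum>n. ennreal (2^n * (norm (d n x))\<^sup>2)) \<partial>M) \<noteq> \<infinity>" by simp
  have "AE x in M. (\<Sum>n. ennreal (2^n * (norm (d n x))\<^sup>2)) \<noteq> \<infinity>"
    by (rule nn_integral_PInf_AE[OF _ fin]) measurable
  then have conv: "AE x in M. convergent (\<lambda>n. u n x)"
  proof eventually_elim
    case (elim x)
    then have s: "summable (\<lambda>n. 2^n * (norm (d n x))\<^sup>2)"
      by (intro summable_suminf_not_top) (auto simp: top_ennreal_def[symmetric])
    have "summable (\<lambda>n. (1/2)^n + 2^n * (norm (d n x))\<^sup>2)"
      by (intro summable_add s summable_geometric) auto
    then have "summable (\<lambda>n. norm (d n x))"
    proof (rule summable_comparison_test[rotated], intro exI[of _ 0] allI impI)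
      fix n
      define p :: real where "p = 2^n"
      have p: "p > 0" "(1/2)^n = 1/p" by (auto simp: p_def power_divide)
      have "2 * norm (d n x) \<le> 1/p + p * (norm (d n x))\<^sup>2"
      proof -
        have "0 \<le> (1 - p * norm (d n x))\<^sup>2 / p" using p by simp
        also have "\<dots> = 1/p + p * (norm (d n x))\<^sup>2 - 2 * norm (d n x)"
          using p by (simp add: power2_eq_square field_simps)
        finally show ?thesis by simp
      qed
      then show "norm (norm (d n x)) \<le> (1/2)^n + 2^n * (norm (d n x))\<^sup>2"
        unfolding p(2) p_def[symmetric] using norm_ge_zero[of "d n x"] abs_norm_cancel[of "d n x"]
        unfolding real_norm_def by linarith
    qed
    then have "summable (\<lambda>n. d n x)" by (rule summable_norm_cancel)
    then have "(\<lambda>n. \<Sum>k<n. d k x) \<longlonglongrightarrow> (\<Sum>k. d k x)" by (rule summable_LIMSEQ)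
    moreover have "(\<Sum>k<n. d k x) = u n x - u 0 x" for n
      unfolding d_def by (rule sum_lessThan_telescope)
    ultimately have "(\<lambda>n. u n x - u 0 x) \<longlonglongrightarrow> (\<Sum>k. d k x)" by simp
    then have "(\<lambda>n. (u n x - u 0 x) + u 0 x) \<longlonglongrightarrow> (\<Sum>k. d k x) + u 0 x"
      by (intro tendsto_add tendsto_const)
    then show ?case by (auto simp: convergent_def)
  qed
  define v where "v x = lim (\<lambda>n. u n x)" for x
  have [measurable]: "v \<in> borel_measurable M" unfolding v_def by measurable
  have "(\<integral>\<^sup>+x. ennreal ((norm (v x - u n x))\<^sup>2) \<partial>M) \<le> ennreal ((1/4)^n)" for n
  proof -
    have "(\<integral>\<^sup>+x. ennreal ((norm (v x - u n x))\<^sup>2) \<partial>M)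
        = (\<integral>\<^sup>+x. liminf (\<lambda>m. ennreal ((norm (u m x - u n x))\<^sup>2)) \<partial>M)"
    proof (rule nn_integral_cong_AE)
      show "AE x in M. ennreal ((norm (v x - u n x))\<^sup>2) = liminf (\<lambda>m. ennreal ((norm (u m x - u n x))\<^sup>2))"
        using conv
      proof eventually_elim
        case (elim x)
        then have "(\<lambda>m. u m x) \<longlonglongrightarrow> v x" unfolding v_def by (simp add: convergent_LIMSEQ_iff)
        then have "(\<lambda>m. ennreal ((norm (u m x - u n x))\<^sup>2)) \<longlonglongrightarrow> ennreal ((norm (v x - u n x))\<^sup>2)"
          by (intro tendsto_intros)
        from lim_imp_Liminf[OF _ this] show ?case by simp
      qed
    qed
    also have "\<dots> \<le> liminf (\<lambda>m. \<integral>\<^sup>+x. ennreal ((norm (u m x - u n x))\<^sup>2) \<partial>M)"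
      by (rule nn_integral_liminf) measurable
    also have "\<dots> \<le> liminf (\<lambda>m::nat. ennreal ((1/4)^n))"
      by (intro Liminf_mono eventually_sequentiallyI[of n] cauchy)
    also have "\<dots> = ennreal ((1/4)^n)" by (simp add: Liminf_const)
    finally show ?thesis .
  qed
  with that[of v] show ?thesis by simp
qed

lemma integrable_square_iff_nn_integral:
  fixes u :: "'x \<Rightarrow> 'a::euclidean_space"
  assumes [measurable]: "u \<in> borel_measurable M"
  shows "integrable M (\<lambda>x. (norm (u x))\<^sup>2) \<longleftrightarrow> (\<integral>\<^sup>+x. ennreal ((norm (u x))\<^sup>2) \<partial>M) < \<infinity>"
  by (subst integrable_iff_bounded) auto

lemma quadratic_nonneg_linear_zero:
  fixes b q :: real
  assumes q: "q \<ge> 0" and nn: "\<And>s. 0 \<le> s * b + s\<^sup>2 / 2 * q"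
  shows "b = 0"
proof (rule ccontr)
  assume "b \<noteq> 0"
  have "0 \<le> (- b / (q+1)) * b + (- b / (q+1))\<^sup>2 / 2 * q" by (rule nn)
  also have "\<dots> = - (b\<^sup>2 * (q + 2)) / (2 * (q+1)\<^sup>2)"
    using q by (simp add: power2_eq_square divide_simps) (simp add: algebra_simps)
  also have "\<dots> < 0" using q \<open>b \<noteq> 0\<close> by (simp add: divide_neg_pos)
  finally show False by simp
qed

text \<open>The Riesz representation theorem, obtained by minimising \<open>\<integral> |u|\<^sup>2 / 2 - l\<close>. The functional is given
  by its graph \<open>R\<close>, a linear set of pairs of a vector field and a value; applied to all multiples of a
  pair, the bound makes it vanish on null fields. The bound also says that the minimised functional is
  bounded below; the parallelogram law makes minimising sequences Cauchy, and the Euler-Lagrange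
  equation of their limit \<open>\<alpha>\<close> is \<open>\<integral> u \<bullet> \<alpha> = l\<close>.\<close>
proposition L2_representation:
  fixes R :: "(('x \<Rightarrow> 'a::euclidean_space) \<times> real) set"
  assumes zero: "((\<lambda>_. 0), 0) \<in> R"
    and lin: "\<And>u l v k a. (u, l) \<in> R \<Longrightarrow> (v, k) \<in> R \<Longrightarrow> ((\<lambda>x. u x + a *\<^sub>R v x), l + a * k) \<in> R"
    and meas: "\<And>u l. (u, l) \<in> R \<Longrightarrow> u \<in> borel_measurable M"
    and sq: "\<And>u l. (u, l) \<in> R \<Longrightarrow> integrable M (\<lambda>x. (norm (u x))\<^sup>2)"
    and bound: "\<And>u l. (u, l) \<in> R \<Longrightarrow> l \<le> (\<integral>x. (norm (u x))\<^sup>2 \<partial>M) / 2 + B"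
  obtains \<alpha> where "\<alpha> \<in> borel_measurable M" "integrable M (\<lambda>x. (norm (\<alpha> x))\<^sup>2)"
    "\<And>u l. (u, l) \<in> R \<Longrightarrow> (\<integral>x. u x \<bullet> \<alpha> x \<partial>M) = l"
proof -
  define n2 where "n2 u = (\<integral>x. (norm (u x))\<^sup>2 \<partial>M)" for u :: "'x \<Rightarrow> 'a"
  define J where "J p = n2 (fst p) / 2 - snd p" for p :: "('x \<Rightarrow> 'a) \<times> real"
  define I where "I = Inf (J ` R)"
  have bdd: "bdd_below (J ` R)"
  proof (rule bdd_belowI2)
    fix p assume "p \<in> R"
    then have "snd p \<le> n2 (fst p) / 2 + B" using bound[of "fst p" "snd p"] by (simp add: n2_def)
    then show "- B \<le> J p" by (simp add: J_def)
  qed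
  have I: "I \<le> J p" if "p \<in> R" for p
    unfolding I_def by (rule cINF_lower[OF bdd that])
  \<comment> \<open>This tolerance turns into \<open>4\<^sup>-\<^sup>n\<close>, since the parallelogram law costs a factor \<open>8\<close>.\<close>
  define \<epsilon> where "\<epsilon> n = (1/4::real)^n / 8" for n :: nat
  have "\<exists>p\<in>R. J p < I + \<epsilon> n" for n
  proof -
    have "Inf (J ` R) < I + \<epsilon> n" by (simp add: I_def \<epsilon>_def)
    then show ?thesis using zero bdd by (subst (asm) cInf_less_iff) auto
  qed
  then obtain p where p: "\<And>n. p n \<in> R" and Jp: "\<And>n. J (p n) < I + \<epsilon> n" by metis
  define u where "u n = fst (p n)" for n
  define l where "l n = snd (p n)" for n
  have ul: "(u n, l n) \<in> R" for n using p by (simp add: u_def l_def)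
  note mu[measurable] = meas[OF ul]
  have Jexp: "J ((\<lambda>x. u n x + s *\<^sub>R v x), l n + s * k)
      = J (p n) + s * ((\<integral>x. u n x \<bullet> v x \<partial>M) - k) + s\<^sup>2 / 2 * n2 v" if "(v, k) \<in> R" for n s v k
    unfolding J_def n2_def fst_conv snd_conv u_def[symmetric] l_def[symmetric]
      square_integral_add_scaleR[OF mu meas[OF that] sq[OF ul] sq[OF that]]
    by (simp add: algebra_simps)
  have near: "n2 (\<lambda>x. u m x - u n x) \<le> (1/4)^n \<and> integrable M (\<lambda>x. (norm (u m x - u n x))\<^sup>2)" if "n \<le> m" for n m
  proof -
    define v where "v = (\<lambda>x. u m x + (-1) *\<^sub>R u n x)"
    define k where "k = l m + (-1) * l n"
    have vk: "(v, k) \<in> R" unfolding v_def k_def by (rule lin[OF ul ul])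
    have e1: "J (p m) = J (p n) + ((\<integral>x. u n x \<bullet> v x \<partial>M) - k) + n2 v / 2"
      using Jexp[OF vk, of n 1] by (simp add: v_def k_def u_def l_def)
    have "I \<le> J (p n) + 1/2 * ((\<integral>x. u n x \<bullet> v x \<partial>M) - k) + (1/2)\<^sup>2 / 2 * n2 v"
      unfolding Jexp[OF vk, symmetric] by (intro I lin ul vk)
    then have "I \<le> J (p n) + ((\<integral>x. u n x \<bullet> v x \<partial>M) - k) / 2 + n2 v / 8"
      by (simp add: power2_eq_square)
    moreover have "n2 v \<le> 4 * (e + f)"
      if "y = x + b + n2 v / 2" "x < I + e" "y < I + f" "I \<le> x + b / 2 + n2 v / 8" for x y b e f :: real
      using that by (simp add: field_simps)
    ultimately have "n2 v \<le> 4 * (\<epsilon> n + \<epsilon> m)" using e1 Jp[of n] Jp[of m] by blast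
    also have "\<epsilon> m \<le> \<epsilon> n" unfolding \<epsilon>_def using that by (simp add: power_decreasing)
    finally have "n2 v \<le> (1/4)^n" by (simp add: \<epsilon>_def)
    then show ?thesis using sq[OF vk] by (simp add: v_def)
  qed
  have "(\<integral>\<^sup>+x. ennreal ((norm (u m x - u n x))\<^sup>2) \<partial>M) \<le> ennreal ((1/4)^n)" if "n \<le> m" for n m
    using near[OF that] by (simp add: nn_integral_eq_integral n2_def ennreal_leI)
  from rapid_Cauchy_L2_limit[of u, OF mu this]
  obtain \<alpha> where [measurable]: "\<alpha> \<in> borel_measurable M"
    and lim: "\<And>n. (\<integral>\<^sup>+x. ennreal ((norm (\<alpha> x - u n x))\<^sup>2) \<partial>M) \<le> ennreal ((1/4)^n)" by blast
  have dsq: "integrable M (\<lambda>x. (norm (\<alpha> x - u n x))\<^sup>2)" for n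
    by (subst integrable_square_iff_nn_integral) (auto intro: le_less_trans[OF lim])
  have dn2: "n2 (\<lambda>x. \<alpha> x - u n x) \<le> (1/4)^n" for n
    using lim[of n] unfolding n2_def nn_integral_eq_integral[OF dsq, of n, simplified]
    by (simp add: ennreal_le_iff)
  have "integrable M (\<lambda>x. (norm (\<alpha> x))\<^sup>2)"
  proof (rule Bochner_Integration.integrable_bound)
    show "integrable M (\<lambda>x. 2 * (norm (\<alpha> x - u 0 x))\<^sup>2 + 2 * (norm (u 0 x))\<^sup>2)"
      using dsq[of 0] sq[OF ul[of 0]] by simp
    have "(norm (\<alpha> x))\<^sup>2 \<le> 2 * (norm (\<alpha> x - u 0 x))\<^sup>2 + 2 * (norm (u 0 x))\<^sup>2" for x
    proof -
      have "norm (\<alpha> x) \<le> norm (\<alpha> x - u 0 x) + norm (u 0 x)"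
        using norm_triangle_ineq[of "\<alpha> x - u 0 x" "u 0 x"] by simp
      then have "(norm (\<alpha> x))\<^sup>2 \<le> (norm (\<alpha> x - u 0 x) + norm (u 0 x))\<^sup>2" by (simp add: power_mono)
      also have "\<dots> \<le> 2 * (norm (\<alpha> x - u 0 x))\<^sup>2 + 2 * (norm (u 0 x))\<^sup>2"
        using sum_squares_bound[of "norm (\<alpha> x - u 0 x)" "norm (u 0 x)"] by (simp add: power2_sum)
      finally show ?thesis .
    qed
    then show "AE x in M. norm ((norm (\<alpha> x))\<^sup>2) \<le> norm (2 * (norm (\<alpha> x - u 0 x))\<^sup>2 + 2 * (norm (u 0 x))\<^sup>2)"
      by simp
  qed measurable
  moreover have "(\<integral>x. v x \<bullet> \<alpha> x \<partial>M) = k" if vk: "(v, k) \<in> R" for v k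
  proof -
    have [measurable]: "v \<in> borel_measurable M" by (rule meas[OF vk])
    define b where "b n = (\<integral>x. u n x \<bullet> v x \<partial>M) - k" for n
    \<comment> \<open>Perturb the almost minimiser in the direction \<open>v\<close>.\<close>
    have bq: "s * b n + s\<^sup>2 / 2 * n2 v \<ge> - \<epsilon> n" for s n
    proof -
      have "I \<le> J (p n) + s * b n + s\<^sup>2 / 2 * n2 v"
        unfolding b_def Jexp[OF vk, symmetric] by (intro I lin ul vk)
      with Jp[of n] show ?thesis by simp
    qed
    have blim: "b \<longlonglongrightarrow> (\<integral>x. \<alpha> x \<bullet> v x \<partial>M) - k"
    proof -
      have "\<bar>(\<integral>x. (\<alpha> x - u n x) \<bullet> v x \<partial>M)\<bar> \<le> (1/2)^n * (1 + n2 v)" for n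
      proof -
        define q :: real where "q = 2^n"
        have q: "q > 0" "(1/2)^n = 1/q" "(1/4)^n = 1/(q*q)"
          by (auto simp: q_def power_divide power_mult_distrib[symmetric])
        have "\<bar>(\<integral>x. (\<alpha> x - u n x) \<bullet> v x \<partial>M)\<bar> \<le> (\<integral>x. q * (norm (\<alpha> x - u n x))\<^sup>2 + (norm (v x))\<^sup>2 / q \<partial>M)"
          unfolding real_norm_def[symmetric]
        proof (rule order_trans[OF integral_norm_bound integral_mono])
          show "integrable M (\<lambda>x. norm ((\<alpha> x - u n x) \<bullet> v x))"
            by (intro integrable_norm square_integrable_inner dsq sq[OF vk]) measurable
          show "integrable M (\<lambda>x. q * (norm (\<alpha> x - u n x))\<^sup>2 + (norm (v x))\<^sup>2 / q)"
            using dsq[of n] sq[OF vk] by simp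
          fix x
          define y z where "y = norm (\<alpha> x - u n x)" and "z = norm (v x)"
          have yz: "y \<ge> 0" "z \<ge> 0" by (auto simp: y_def z_def)
          have "0 \<le> (q * y - z)\<^sup>2 / q" using q by simp
          also have "\<dots> = q * y\<^sup>2 + z\<^sup>2 / q - 2 * (y * z)"
            using q by (simp add: power2_eq_square field_simps)
          finally have "y * z \<le> q * y\<^sup>2 + z\<^sup>2 / q" using yz mult_nonneg_nonneg[OF yz] by linarith
          with Cauchy_Schwarz_ineq2[of "\<alpha> x - u n x" "v x"]
          show "norm ((\<alpha> x - u n x) \<bullet> v x) \<le> q * (norm (\<alpha> x - u n x))\<^sup>2 + (norm (v x))\<^sup>2 / q"
            by (simp add: y_def z_def)
        qed
        also have "\<dots> = q * n2 (\<lambda>x. \<alpha> x - u n x) + n2 v / q"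
          using dsq[of n] sq[OF vk] by (simp add: n2_def)
        also have "\<dots> \<le> q * (1/4)^n + n2 v / q"
          using dn2[of n] q by (intro add_mono mult_left_mono) auto
        also have "\<dots> = (1/2)^n * (1 + n2 v)" unfolding q(2,3) using q(1) by (simp add: field_simps)
        finally show ?thesis .
      qed
      moreover have "(\<integral>x. (\<alpha> x - u n x) \<bullet> v x \<partial>M) = (\<integral>x. \<alpha> x \<bullet> v x \<partial>M) - k - b n" for n
      proof -
        have "integrable M (\<lambda>x. u n x \<bullet> v x)" by (intro square_integrable_inner sq[OF vk] sq[OF ul]) measurable
        moreover have "integrable M (\<lambda>x. \<alpha> x \<bullet> v x)"
          by (intro square_integrable_inner sq[OF vk] \<open>integrable M (\<lambda>x. (norm (\<alpha> x))\<^sup>2)\<close>) measurable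
        ultimately show ?thesis by (simp add: b_def inner_diff_left)
      qed
      ultimately have le: "\<bar>(\<integral>x. \<alpha> x \<bullet> v x \<partial>M) - k - b n\<bar> \<le> (1/2)^n * (1 + n2 v)" for n by simp
      have "(\<lambda>n. (1/2::real)^n * (1 + n2 v)) \<longlonglongrightarrow> 0"
        by (rule tendsto_mult_left_zero, rule LIMSEQ_power_zero) simp
      then have "(\<lambda>n. (\<integral>x. \<alpha> x \<bullet> v x \<partial>M) - k - b n) \<longlonglongrightarrow> 0"
        by (rule Lim_null_comparison[rotated]) (simp add: le eventually_sequentially)
      from tendsto_diff[OF tendsto_const this, of "(\<integral>x. \<alpha> x \<bullet> v x \<partial>M) - k"] show ?thesis by simp
    qed
    have elim: "\<epsilon> \<longlonglongrightarrow> 0"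
      unfolding \<epsilon>_def using tendsto_divide[OF LIMSEQ_power_zero[of "1/4::real"] tendsto_const[of 8]] by simp
    have "0 \<le> s * ((\<integral>x. \<alpha> x \<bullet> v x \<partial>M) - k) + s\<^sup>2 / 2 * n2 v" for s
    proof -
      have "- 0 \<le> s * ((\<integral>x. \<alpha> x \<bullet> v x \<partial>M) - k) + s\<^sup>2 / 2 * n2 v"
        by (rule LIMSEQ_le[OF tendsto_minus[OF elim] tendsto_add[OF tendsto_mult[OF tendsto_const blim] tendsto_const]])
          (use bq in auto)
      then show ?thesis by simp
    qed
    moreover have "n2 v \<ge> 0" by (simp add: n2_def)
    ultimately have "(\<integral>x. \<alpha> x \<bullet> v x \<partial>M) - k = 0" by (intro quadratic_nonneg_linear_zero) auto
    then show ?thesis by (simp add: inner_commute)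
  qed
  ultimately show ?thesis using that[of \<alpha>] by simp
qed

section \<open>Test functions\<close>

lemma test_functionsI:
  assumes "\<And>k. Ck k \<phi>" "compact (closure {z. \<phi> z \<noteq> 0})" "closure {z. \<phi> z \<noteq> 0} \<subseteq> U"
  shows "\<phi> \<in> test_functions U"
  using assms unfolding test_functions_def by blast

lemma test_functionsD:
  assumes "\<phi> \<in> test_functions U"
  shows "Ck k \<phi>" "compact (closure {z. \<phi> z \<noteq> 0})" "closure {z. \<phi> z \<noteq> 0} \<subseteq> U"
  using assms unfolding test_functions_def by blast+

lemma test_function_has_derivative:
  assumes "\<phi> \<in> test_functions U"
  shows "(\<phi> has_derivative frechet_derivative \<phi> (at z)) (at z)"
proof -
  have "Ck (Suc 0) \<phi>" by (rule test_functionsD(1)[OF assms])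
  then show ?thesis by (simp add: frechet_derivative_works[symmetric])
qed

lemma continuous_on_test_function:
  "\<phi> \<in> test_functions U \<Longrightarrow> continuous_on UNIV \<phi>"
  using test_functionsD(1)[of \<phi> U 0] by simp

lemma frechet_derivative_zero_off_support:
  assumes "\<phi> \<in> test_functions U" "z \<notin> closure {z. \<phi> z \<noteq> 0}"
  shows "frechet_derivative \<phi> (at z) v = 0"
proof -
  have "(\<phi> has_derivative (\<lambda>_. 0)) (at z)"
  proof (rule has_derivative_transform_within_open)
    show "((\<lambda>_. 0) has_derivative (\<lambda>_. 0)) (at z)" by (rule has_derivative_const)
    show "open (- closure {z. \<phi> z \<noteq> 0})" by (rule open_Compl) (rule closed_closure)
    show "z \<in> - closure {z. \<phi> z \<noteq> 0}" using assms(2) by simp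
    show "0 = \<phi> w" if "w \<in> - closure {z. \<phi> z \<noteq> 0}" for w
      using that closure_subset[of "{z. \<phi> z \<noteq> 0}"] by auto
  qed
  then have "frechet_derivative \<phi> (at z) = (\<lambda>_. 0)" by (rule frechet_derivative_at[symmetric])
  then show ?thesis by simp
qed

lemma test_function_partial_derivative:
  assumes "\<phi> \<in> test_functions U"
  shows "(\<lambda>z. frechet_derivative \<phi> (at z) v) \<in> test_functions U"
proof -
  have sub: "closure {z. frechet_derivative \<phi> (at z) v \<noteq> 0} \<subseteq> closure {z. \<phi> z \<noteq> 0}"
    using frechet_derivative_zero_off_support[OF assms] by (intro closure_minimal) auto
  show ?thesis
  proof (rule test_functionsI)
    show "Ck k (\<lambda>z. frechet_derivative \<phi> (at z) v)" for k
      using test_functionsD(1)[OF assms, of "Suc k"] by simp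
    show "compact (closure {z. frechet_derivative \<phi> (at z) v \<noteq> 0})"
      using compact_Int_closed[OF test_functionsD(2)[OF assms] closed_closure] sub
      by (metis Int_absorb1)
    show "closure {z. frechet_derivative \<phi> (at z) v \<noteq> 0} \<subseteq> U"
      using sub test_functionsD(3)[OF assms] by (rule order_trans)
  qed
qed

lemma test_function_zero_outside:
  "\<phi> \<in> test_functions U \<Longrightarrow> z \<notin> U \<Longrightarrow> \<phi> z = 0"
  using closure_subset[of "{z. \<phi> z \<noteq> 0}"] test_functionsD(3)[of \<phi> U] by blast

lemma test_function_bounded:
  assumes "\<phi> \<in> test_functions U"
  obtains C where "C \<ge> 0" "\<And>z. \<bar>\<phi> z\<bar> \<le> C"
proof -
  let ?K = "closure {z. \<phi> z \<noteq> 0}"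
  have "compact (\<phi> ` ?K)"
    using continuous_on_subset[OF continuous_on_test_function[OF assms] subset_UNIV]
      test_functionsD(2)[OF assms] by (rule compact_continuous_image)
  then obtain C where C: "\<And>z. z \<in> ?K \<Longrightarrow> \<bar>\<phi> z\<bar> \<le> C"
    using compact_imp_bounded by (force simp: bounded_iff)
  have "\<bar>\<phi> z\<bar> \<le> max C 0" for z
    using C[of z] closure_subset[of "{z. \<phi> z \<noteq> 0}"] by (cases "\<phi> z = 0") auto
  then show ?thesis using that[of "max C 0"] by auto
qed

lemma test_function_lipschitz:
  fixes \<phi> :: "'b::euclidean_space \<Rightarrow> real"
  assumes "\<phi> \<in> test_functions U"
  obtains C where "C \<ge> 0" "\<And>z w. \<bar>\<phi> (z + w) - \<phi> z\<bar> \<le> C * norm w"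
proof -
  have "\<forall>b. \<exists>C\<ge>0. \<forall>z. \<bar>frechet_derivative \<phi> (at z) b\<bar> \<le> C"
    using test_function_bounded[OF test_function_partial_derivative[OF assms]] by metis
  then obtain c where c: "\<And>b. c b \<ge> 0" "\<And>b z. \<bar>frechet_derivative \<phi> (at z) b\<bar> \<le> c b" by metis
  define C where "C = (\<Sum>b\<in>Basis. c b)"
  have C: "C \<ge> 0" unfolding C_def using c by (simp add: sum_nonneg)
  have bd: "\<bar>frechet_derivative \<phi> (at z) w\<bar> \<le> C * norm w" for z w
  proof -
    interpret linear "frechet_derivative \<phi> (at z)"
      using test_function_has_derivative[OF assms] by (rule has_derivative_linear)
    have "frechet_derivative \<phi> (at z) w = frechet_derivative \<phi> (at z) (\<Sum>b\<in>Basis. (w \<bullet> b) *\<^sub>R b)"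
      by (simp add: euclidean_representation)
    also have "\<dots> = (\<Sum>b\<in>Basis. (w \<bullet> b) * frechet_derivative \<phi> (at z) b)"
      by (simp add: sum scaleR)
    also have "\<bar>\<dots>\<bar> \<le> (\<Sum>b\<in>Basis. norm w * c b)"
      using c by (intro order_trans[OF sum_abs] sum_mono)
        (auto simp: abs_mult intro!: mult_mono Basis_le_norm)
    finally show ?thesis by (simp add: C_def sum_distrib_left mult.commute)
  qed
  have "\<bar>\<phi> (z + w) - \<phi> z\<bar> \<le> C * norm w" for z w
  proof -
    have "norm (\<phi> (z + w) - \<phi> z) \<le> C * norm (z + w - z)"
    proof (rule differentiable_bound[of UNIV])
      show "(\<phi> has_derivative frechet_derivative \<phi> (at x)) (at x within UNIV)" for x
        using test_function_has_derivative[OF assms] by simp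
      show "onorm (frechet_derivative \<phi> (at x)) \<le> C" for x
        using bd C by (intro onorm_bound) auto
    qed auto
    then show ?thesis by simp
  qed
  with C that show ?thesis by blast
qed

text \<open>The partial derivatives are test functions again, hence Lipschitz, so the derivative at an
  intermediate point of the segment differs from that at \<open>z\<close> by at most a constant times \<open>norm w\<close>.\<close>
lemma test_function_taylor:
  fixes \<phi> :: "'b::euclidean_space \<Rightarrow> real"
  assumes "\<phi> \<in> test_functions U"
  obtains C where "C \<ge> 0"
    "\<And>z w. \<bar>\<phi> (z + w) - \<phi> z - frechet_derivative \<phi> (at z) w\<bar> \<le> C * (norm w)\<^sup>2"
proof -
  let ?D = "\<lambda>z. frechet_derivative \<phi> (at z)"
  have "\<forall>b. \<exists>C\<ge>0. \<forall>z w. \<bar>?D (z + w) b - ?D z b\<bar> \<le> C * norm w"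
    using test_function_lipschitz[OF test_function_partial_derivative[OF assms]] by metis
  then obtain c where c: "\<And>b. c b \<ge> 0" "\<And>b z w. \<bar>?D (z + w) b - ?D z b\<bar> \<le> c b * norm w" by metis
  define C where "C = (\<Sum>b\<in>Basis. c b)"
  have C: "C \<ge> 0" unfolding C_def using c by (simp add: sum_nonneg)
  have "\<bar>\<phi> (z + w) - \<phi> z - ?D z w\<bar> \<le> C * (norm w)\<^sup>2" for z w
  proof -
    define f where "f t = \<phi> (z + t *\<^sub>R w)" for t
    have f': "(f has_real_derivative ?D (z + t *\<^sub>R w) w) (at t)" for t
    proof -
      have lin: "linear (?D (z + t *\<^sub>R w))"
        using test_function_has_derivative[OF assms] by (rule has_derivative_linear)
      have "((\<lambda>t. z + t *\<^sub>R w) has_derivative (\<lambda>h. h *\<^sub>R w)) (at t)"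
        by (auto intro!: derivative_eq_intros)
      from diff_chain_at[OF this test_function_has_derivative[OF assms]]
      have "(f has_derivative (\<lambda>h. ?D (z + t *\<^sub>R w) (h *\<^sub>R w))) (at t)"
        unfolding o_def f_def[abs_def] .
      then show ?thesis
        unfolding has_field_derivative_def linear_cmul[OF lin]
        by (simp add: mult.commute[of _ "?D (z + t *\<^sub>R w) w"])
    qed
    obtain \<theta> where \<theta>: "0 < \<theta>" "\<theta> < 1" "f 1 - f 0 = (1 - 0) * ?D (z + \<theta> *\<^sub>R w) w"
      using MVT2[of 0 1 f "\<lambda>t. ?D (z + t *\<^sub>R w) w"] f' by auto
    have "\<phi> (z + w) - \<phi> z - ?D z w = ?D (z + \<theta> *\<^sub>R w) w - ?D z w"
      using \<theta>(3) by (simp add: f_def)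
    also have "\<dots> = (\<Sum>b\<in>Basis. (w \<bullet> b) * (?D (z + \<theta> *\<^sub>R w) b - ?D z b))"
    proof -
      have "?D y w = (\<Sum>b\<in>Basis. (w \<bullet> b) * ?D y b)" for y
      proof -
        interpret linear "?D y"
          using test_function_has_derivative[OF assms] by (rule has_derivative_linear)
        have "?D y w = ?D y (\<Sum>b\<in>Basis. (w \<bullet> b) *\<^sub>R b)" by (simp add: euclidean_representation)
        then show ?thesis by (simp add: sum scaleR)
      qed
      from this[of z] this[of "z + \<theta> *\<^sub>R w"] show ?thesis
        by (simp add: sum_subtractf right_diff_distrib)
    qed
    also have "\<bar>\<dots>\<bar> \<le> (\<Sum>b\<in>Basis. norm w * (c b * norm w))"
    proof (rule order_trans[OF sum_abs], rule sum_mono)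
      fix b :: 'b assume b: "b \<in> Basis"
      have "\<bar>?D (z + \<theta> *\<^sub>R w) b - ?D z b\<bar> \<le> c b * norm (\<theta> *\<^sub>R w)" by (rule c)
      also have "\<dots> \<le> c b * norm w" using \<theta> c(1) by (intro mult_left_mono) (auto simp: mult_left_le_one_le)
      finally show "\<bar>(w \<bullet> b) * (?D (z + \<theta> *\<^sub>R w) b - ?D z b)\<bar> \<le> norm w * (c b * norm w)"
        using b by (auto simp: abs_mult intro!: mult_mono Basis_le_norm)
    qed
    also have "\<dots> = C * (norm w)\<^sup>2"
      by (simp add: C_def sum_distrib_right sum_distrib_left power2_eq_square mult_ac)
    finally show ?thesis .
  qed
  with C that show ?thesis by blast
qed

lemma frechet_derivative_add_cmult:
  fixes f g :: "'b::euclidean_space \<Rightarrow> real"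
  assumes "f differentiable (at x)" "g differentiable (at x)"
  shows "frechet_derivative (\<lambda>z. f z + a * g z) (at x) v
           = frechet_derivative f (at x) v + a * frechet_derivative g (at x) v"
proof -
  have "((\<lambda>z. f z + a * g z) has_derivative
      (\<lambda>v. frechet_derivative f (at x) v + a * frechet_derivative g (at x) v)) (at x)"
    using assms by (intro has_derivative_add has_derivative_mult_right)
      (simp_all add: frechet_derivative_works[symmetric])
  from frechet_derivative_at[OF this, symmetric] show ?thesis by simp
qed

lemma Ck_add_cmult:
  fixes f g :: "'b::euclidean_space \<Rightarrow> real"
  shows "Ck k f \<Longrightarrow> Ck k g \<Longrightarrow> Ck k (\<lambda>z. f z + a * g z)"
proof (induction k arbitrary: f g)
  case 0
  then show ?case by (auto intro!: continuous_intros)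
next
  case (Suc k)
  then have "Ck k (\<lambda>x. frechet_derivative f (at x) v + a * frechet_derivative g (at x) v)" for v
    by simp
  moreover have "(\<lambda>z. f z + a * g z) differentiable (at x)" for x
    using Suc.prems by (intro differentiable_add differentiable_mult) auto
  ultimately show ?case using Suc.prems by (simp add: frechet_derivative_add_cmult)
qed

lemma test_function_add_cmult:
  fixes f g :: "'b::euclidean_space \<Rightarrow> real"
  assumes f: "f \<in> test_functions U" and g: "g \<in> test_functions U"
  shows "(\<lambda>z. f z + a * g z) \<in> test_functions U"
proof -
  let ?S = "\<lambda>f. closure {z. f z \<noteq> (0::real)}"
  have "{z. f z + a * g z \<noteq> 0} \<subseteq> {z. f z \<noteq> 0} \<union> {z. g z \<noteq> 0}" by auto
  then have sub: "?S (\<lambda>z. f z + a * g z) \<subseteq> ?S f \<union> ?S g"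
    unfolding closure_Un[symmetric] by (rule closure_mono)
  show ?thesis
  proof (rule test_functionsI)
    show "Ck k (\<lambda>z. f z + a * g z)" for k
      by (rule Ck_add_cmult) (rule test_functionsD(1)[OF f] test_functionsD(1)[OF g])+
    have "compact (?S f \<union> ?S g)"
      using test_functionsD(2)[OF f] test_functionsD(2)[OF g] by (rule compact_Un)
    from compact_Int_closed[OF this closed_closure, of "{z. f z + a * g z \<noteq> 0}"]
    show "compact (?S (\<lambda>z. f z + a * g z))" unfolding Int_absorb1[OF sub] .
    show "?S (\<lambda>z. f z + a * g z) \<subseteq> U"
      using sub test_functionsD(3)[OF f] test_functionsD(3)[OF g] by blast
  qed
qed

lemma test_function_zero: "(\<lambda>_. 0) \<in> test_functions (U :: 'b::euclidean_space set)"
proof -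
  have "Ck k (\<lambda>_::'b. 0::real)" for k
    by (induction k) (auto simp: frechet_derivative_const)
  then show ?thesis by (simp add: test_functions_def)
qed

definition time_derivative :: "(real \<times> 'a::euclidean_space \<Rightarrow> real) \<Rightarrow> real \<times> 'a \<Rightarrow> real" where
  "time_derivative \<phi> z = frechet_derivative \<phi> (at z) (1, 0)"

definition space_gradient :: "(real \<times> 'a::euclidean_space \<Rightarrow> real) \<Rightarrow> real \<times> 'a \<Rightarrow> 'a" where
  "space_gradient \<phi> z = (\<Sum>b\<in>Basis. frechet_derivative \<phi> (at z) (0, b) *\<^sub>R b)"

lemma test_function_differentiable: "\<phi> \<in> test_functions U \<Longrightarrow> \<phi> differentiable (at z)"
  using test_function_has_derivative by (auto simp: differentiable_def)

lemma time_derivative_test_function: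
  "\<phi> \<in> test_functions U \<Longrightarrow> time_derivative \<phi> \<in> test_functions U"
  unfolding time_derivative_def[abs_def] by (rule test_function_partial_derivative)

lemma frechet_derivative_spacetime:
  assumes "\<phi> \<in> test_functions U"
  shows "frechet_derivative \<phi> (at z) (h, v) = h * time_derivative \<phi> z + space_gradient \<phi> z \<bullet> v"
proof -
  let ?D = "frechet_derivative \<phi> (at z)"
  have lin: "linear ?D" using test_function_has_derivative[OF assms] by (rule has_derivative_linear)
  have "?D (h, v) = ?D (h *\<^sub>R (1, 0) + (\<Sum>b\<in>Basis. (v \<bullet> b) *\<^sub>R (0, b)))"
  proof -
    have "(\<Sum>b\<in>Basis. (v \<bullet> b) *\<^sub>R (0, b)) = (0::real, \<Sum>b\<in>Basis. (v \<bullet> b) *\<^sub>R b)"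
      by (rule prod_eqI) (simp_all add: fst_sum snd_sum)
    then show ?thesis by (simp add: euclidean_representation)
  qed
  also have "\<dots> = h * ?D (1, 0) + (\<Sum>b\<in>Basis. (v \<bullet> b) * ?D (0, b))"
    unfolding linear_add[OF lin] linear_sum[OF lin] linear_cmul[OF lin] by simp
  also have "(\<Sum>b\<in>Basis. (v \<bullet> b) * ?D (0, b)) = space_gradient \<phi> z \<bullet> v"
    unfolding space_gradient_def inner_sum_left
    by (intro sum.cong) (simp_all add: inner_commute)
  finally show ?thesis by (simp add: time_derivative_def)
qed

lemma borel_measurable_test_function: "\<phi> \<in> test_functions U \<Longrightarrow> \<phi> \<in> borel_measurable borel"
  by (intro borel_measurable_continuous_onI continuous_on_test_function)

lemma borel_measurable_space_gradient:
  assumes "\<phi> \<in> test_functions U"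
  shows "space_gradient \<phi> \<in> borel_measurable borel"
  unfolding space_gradient_def[abs_def]
  by (intro borel_measurable_sum borel_measurable_scaleR borel_measurable_const
      borel_measurable_test_function[OF test_function_partial_derivative[OF assms]])

lemma space_gradient_bounded:
  assumes "\<phi> \<in> test_functions U"
  obtains C where "\<And>z. norm (space_gradient \<phi> z) \<le> C"
proof -
  have "\<forall>b. \<exists>C. \<forall>z. \<bar>frechet_derivative \<phi> (at z) (0, b)\<bar> \<le> C"
    using test_function_bounded[OF test_function_partial_derivative[OF assms]] by metis
  then obtain c where c: "\<And>b z. \<bar>frechet_derivative \<phi> (at z) (0, b)\<bar> \<le> c b" by metis
  have "norm (space_gradient \<phi> z) \<le> (\<Sum>b\<in>Basis. c b)" for z
    unfolding space_gradient_def by (rule sum_norm_le) (use c in simp)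
  then show ?thesis by (rule that)
qed

lemma space_gradient_zero_outside:
  assumes "\<phi> \<in> test_functions U" "z \<notin> U"
  shows "space_gradient \<phi> z = 0"
  unfolding space_gradient_def
  using test_function_zero_outside[OF test_function_partial_derivative[OF assms(1)] assms(2)] by simp

lemma space_gradient_add_cmult:
  assumes "\<phi> \<in> test_functions U" "\<psi> \<in> test_functions U"
  shows "space_gradient (\<lambda>z. \<phi> z + a * \<psi> z) z = space_gradient \<phi> z + a *\<^sub>R space_gradient \<psi> z"
  unfolding space_gradient_def
  by (simp add: frechet_derivative_add_cmult[OF assms[THEN test_function_differentiable]]
      scaleR_add_left sum.distrib scaleR_sum_right)

lemma time_derivative_add_cmult:
  assumes "\<phi> \<in> test_functions U" "\<psi> \<in> test_functions U"
  shows "time_derivative (\<lambda>z. \<phi> z + a * \<psi> z) z = time_derivative \<phi> z + a * time_derivative \<psi> z"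
  unfolding time_derivative_def
  by (rule frechet_derivative_add_cmult[OF assms[THEN test_function_differentiable]])

section \<open>Integration against kernels and over sliding windows\<close>

text \<open>Fubini's theorem for a kernel and an integrable function, from the nonnegative case applied to the
  positive and the negative part.\<close>
lemma
  fixes f :: "'b \<Rightarrow> real"
  assumes N[measurable]: "N \<in> measurable M (subprob_algebra B)"
    and f[measurable]: "f \<in> borel_measurable B" and int: "integrable (M \<bind> N) f"
  shows integrable_integral_kernel: "integrable M (\<lambda>x. \<integral>y. f y \<partial>N x)"
    and integral_bind_kernel: "(\<integral>y. f y \<partial>(M \<bind> N)) = (\<integral>x. \<integral>y. f y \<partial>N x \<partial>M)"
proof -
  define P where "P g x = (\<integral>\<^sup>+y. ennreal (g y) \<partial>N x)" for g :: "'b \<Rightarrow> real" and x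
  have total: "(\<integral>\<^sup>+x. P g x \<partial>M) = (\<integral>\<^sup>+y. ennreal (g y) \<partial>(M \<bind> N))"
    if "g \<in> borel_measurable B" for g
    unfolding P_def using that by (intro nn_integral_bind[OF _ N, symmetric]) measurable
  have Pmeas: "P g \<in> borel_measurable M" if [measurable]: "g \<in> borel_measurable B" for g
    unfolding P_def by (rule measurable_compose[OF N nn_integral_measurable_subprob_algebra]) measurable
  have fm: "f \<in> borel_measurable (N x)" if "x \<in> space M" for x
    using subprob_measurableD(2)[OF N that] f by (simp cong: measurable_cong_sets)
  have fin: "(\<integral>\<^sup>+x. P g x \<partial>M) < \<infinity>"
    if [measurable]: "g \<in> borel_measurable B" and "\<And>y. g y \<le> \<bar>f y\<bar>" for g
  proof -
    have "(\<integral>\<^sup>+y. ennreal (g y) \<partial>(M \<bind> N)) \<le> (\<integral>\<^sup>+y. ennreal (norm (f y)) \<partial>(M \<bind> N))"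
      using that by (intro nn_integral_mono ennreal_leI) simp
    then show ?thesis using int unfolding total[OF that(1)] integrable_iff_bounded by (rule order.strict_trans1[OF _ conjunct2])
  qed
  have fins: "AE x in M. P g x \<noteq> \<infinity>"
    if "g \<in> borel_measurable B" "\<And>y. g y \<le> \<bar>f y\<bar>" for g
    using fin[OF that] by (intro nn_integral_PInf_AE Pmeas that) auto
  have ae: "AE x in M. integrable (N x) f"
  proof -
    have m: "(\<lambda>y. \<bar>f y\<bar>) \<in> borel_measurable B" by measurable
    from fins[OF m order_refl] AE_space show ?thesis
      by eventually_elim (simp add: integrable_iff_bounded fm P_def top.not_eq_extremum)
  qed
  have split: "AE x in M. (\<integral>y. f y \<partial>N x) = enn2real (P f x) - enn2real (P (\<lambda>y. - f y) x)"
    using ae by eventually_elim (simp add: real_lebesgue_integral_def P_def)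
  have real_part: "integrable M (\<lambda>x. enn2real (P g x)) \<and>
      (\<integral>x. enn2real (P g x) \<partial>M) = enn2real (\<integral>\<^sup>+y. ennreal (g y) \<partial>(M \<bind> N))"
    if g[measurable]: "g \<in> borel_measurable B" and le: "\<And>y. g y \<le> \<bar>f y\<bar>" for g
  proof -
    note Pmeas[OF g, measurable]
    have eq: "(\<integral>\<^sup>+x. ennreal (enn2real (P g x)) \<partial>M) = (\<integral>\<^sup>+x. P g x \<partial>M)"
      by (rule nn_integral_cong_AE)
        (use fins[OF g le] in eventually_elim, simp add: top.not_eq_extremum)
    have "integrable M (\<lambda>x. enn2real (P g x))"
      using fin[OF g le] by (subst integrable_iff_bounded) (simp add: eq)
    moreover have "(\<integral>x. enn2real (P g x) \<partial>M) = enn2real (\<integral>\<^sup>+x. ennreal (enn2real (P g x)) \<partial>M)"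
      by (rule integral_eq_nn_integral) auto
    ultimately show ?thesis unfolding eq total[OF g] by simp
  qed
  have fm': "(\<lambda>y. - f y) \<in> borel_measurable B" by measurable
  note r1 = real_part[OF f] and r2 = real_part[OF fm']
  have meas: "(\<lambda>x. \<integral>y. f y \<partial>N x) \<in> borel_measurable M"
    by (rule measurable_compose[OF N integral_measurable_subprob_algebra]) measurable
  show "integrable M (\<lambda>x. \<integral>y. f y \<partial>N x)"
    using r1 r2 Pmeas[OF f] Pmeas[OF fm'] by (subst integrable_cong_AE[OF meas _ split]) auto
  have "(\<integral>x. \<integral>y. f y \<partial>N x \<partial>M) = (\<integral>x. enn2real (P f x) - enn2real (P (\<lambda>y. - f y) x) \<partial>M)"
  proof (rule integral_cong_AE[OF meas _ split])
    note [measurable] = Pmeas[OF f] Pmeas[OF fm']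
    show "(\<lambda>x. enn2real (P f x) - enn2real (P (\<lambda>y. - f y) x)) \<in> borel_measurable M" by measurable
  qed
  also have "\<dots> = (\<integral>y. f y \<partial>(M \<bind> N))"
    using r1 r2 int by (simp add: real_lebesgue_integral_def[OF int])
  finally show "(\<integral>y. f y \<partial>(M \<bind> N)) = (\<integral>x. \<integral>y. f y \<partial>N x \<partial>M)" by simp
qed

text \<open>Averaging over sliding windows preserves the total mass (Tonelli). Via this identity, bounds on
  \<open>W\<^sub>2(\<mu>\<^sub>t, \<mu>\<^sub>t\<^sub>+\<^sub>h)\<^sup>2 / h\<^sup>2\<close> by window averages of an integrable function become bounds on its integral
  that are uniform in \<open>h\<close>.\<close>
lemma nn_integral_window:
  fixes q :: "real \<Rightarrow> ennreal"
  assumes [measurable]: "q \<in> borel_measurable borel" and "a \<le> b"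
  shows "(\<integral>\<^sup>+t. (\<integral>\<^sup>+u. q u * indicator {t + a..t + b} u \<partial>lborel) \<partial>lborel)
           = ennreal (b - a) * (\<integral>\<^sup>+u. q u \<partial>lborel)"
proof -
  have ind: "(indicator {t + a..t + b} u :: ennreal) = (if t + a \<le> u \<and> u \<le> t + b then 1 else 0)" for t u
    by (auto simp: indicator_def)
  have "(\<integral>\<^sup>+t. (\<integral>\<^sup>+u. q u * indicator {t + a..t + b} u \<partial>lborel) \<partial>lborel)
      = (\<integral>\<^sup>+u. (\<integral>\<^sup>+t. q u * indicator {t + a..t + b} u \<partial>lborel) \<partial>lborel)"
    unfolding ind by (rule lborel_pair.Fubini') measurable
  also have "\<dots> = (\<integral>\<^sup>+u. q u * ennreal (b - a) \<partial>lborel)"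
  proof (rule nn_integral_cong)
    fix u
    have "(\<integral>\<^sup>+t. q u * indicator {t + a..t + b} u \<partial>lborel) = (\<integral>\<^sup>+t. q u * indicator {u - b..u - a} t \<partial>lborel)"
      by (intro nn_integral_cong) (auto simp: indicator_def)
    also have "\<dots> = q u * ennreal (b - a)"
      using assms(2) by (subst nn_integral_cmult_indicator) auto
    finally show "(\<integral>\<^sup>+t. q u * indicator {t + a..t + b} u \<partial>lborel) = q u * ennreal (b - a)" .
  qed
  also have "\<dots> = ennreal (b - a) * (\<integral>\<^sup>+u. q u \<partial>lborel)"
    by (simp add: nn_integral_multc mult.commute)
  finally show ?thesis .
qed

section \<open>The velocity field of a curve of finite action\<close>

text \<open>A curve of Borel probability measures whose squared transport cost over \<open>[s, t]\<close> is at most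
  \<open>(t - s) \<integral>\<^sub>s\<^sup>t q\<close>; for an \<open>AC\<^sup>2\<close> curve with modulus \<open>m\<close> one takes \<open>q = m\<^sup>2\<close>. The time parameter ranges
  over the whole line, so that time shifts need no boundary terms, and the slack \<open>e\<close> allows
  for an infimum over couplings that is only approached.\<close>
locale finite_action_curve =
  fixes \<nu> :: "real \<Rightarrow> 'a::euclidean_space measure" and q :: "real \<Rightarrow> real"
  assumes prob: "prob_space (\<nu> t)" and sets_\<nu>: "sets (\<nu> t) = sets borel"
    and q_nonneg: "0 \<le> q t" and q_int: "integrable lborel q"
    and transport: "s \<le> t \<Longrightarrow> 0 < e \<Longrightarrow>
      \<exists>\<gamma>. sets \<gamma> = sets (borel :: ('a \<times> 'a) measure) \<and> distr \<gamma> borel fst = \<nu> s \<and> distr \<gamma> borel snd = \<nu> t \<and>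
        integrable \<gamma> (\<lambda>z. (norm (fst z - snd z))\<^sup>2) \<and>
        (\<integral>z. (norm (fst z - snd z))\<^sup>2 \<partial>\<gamma>) \<le> (t - s) * (LINT u:{s..t}|lborel. q u) + e"
begin

lemma space_\<nu>: "space (\<nu> t) = UNIV"
  using sets_eq_imp_space_eq[OF sets_\<nu>] by simp

lemma measurable_\<nu>: "measurable (\<nu> t) N = measurable borel N"
  by (rule measurable_cong_sets) (simp_all add: sets_\<nu>)

lemma integrable_bounded_\<nu>:
  fixes f :: "'a \<Rightarrow> real"
  assumes "f \<in> borel_measurable borel" "\<And>x. \<bar>f x\<bar> \<le> C"
  shows "integrable (\<nu> t) f"
proof -
  interpret prob_space "\<nu> t" by (rule prob)
  show ?thesis using assms by (intro integrable_const_bound[where B=C]) (auto simp: measurable_\<nu>)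
qed

lemma window_integrable: "set_integrable lborel {s..t} q"
  using q_int unfolding set_integrable_def by (intro integrable_mult_indicator) auto

lemma window_nonneg: "0 \<le> (LINT u:{s..t}|lborel. q u)"
  unfolding set_lebesgue_integral_def using q_nonneg by (intro integral_nonneg_AE) auto

lemma window_le: "(LINT u:{s..t}|lborel. q u) \<le> (\<integral>u. q u \<partial>lborel)"
  unfolding set_lebesgue_integral_def
  using window_integrable[of s t] q_int q_nonneg
  by (intro integral_mono) (auto simp: set_integrable_def indicator_def)

text \<open>Integrate the pointwise inequality along an almost optimal coupling of \<open>\<nu> s\<close> and \<open>\<nu> t\<close>. This is the
  only place where the couplings are used.\<close>
lemma transport_estimate:
  fixes f g k :: "'a \<Rightarrow> real"
  assumes st: "s \<le> t"
    and f: "f \<in> borel_measurable borel" "\<And>x. \<bar>f x\<bar> \<le> C"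
    and k: "k \<in> borel_measurable borel" "\<And>x. \<bar>k x\<bar> \<le> D"
    and c: "c \<ge> 0"
    and le: "\<And>x y. f y - f x \<le> k x + c * (norm (x - y))\<^sup>2"
  shows "(\<integral>x. f x \<partial>\<nu> t) - (\<integral>x. f x \<partial>\<nu> s) \<le> (\<integral>x. k x \<partial>\<nu> s) + c * ((t - s) * (LINT u:{s..t}|lborel. q u))"
proof (rule field_le_epsilon)
  fix e' :: real assume e': "0 < e'"
  define e where "e = e' / (c + 1)"
  have e: "e > 0" "c * e \<le> e'" using e' c by (auto simp: e_def field_simps)
  obtain \<gamma> where g: "sets \<gamma> = sets (borel :: ('a \<times> 'a) measure)" "distr \<gamma> borel fst = \<nu> s"
      "distr \<gamma> borel snd = \<nu> t" "integrable \<gamma> (\<lambda>z. (norm (fst z - snd z))\<^sup>2)"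
      "(\<integral>z. (norm (fst z - snd z))\<^sup>2 \<partial>\<gamma>) \<le> (t - s) * (LINT u:{s..t}|lborel. q u) + e"
    using transport[OF st e(1)] by blast
  have m: "fst \<in> borel_measurable \<gamma>" "snd \<in> borel_measurable \<gamma>"
    unfolding measurable_cong_sets[OF g(1) refl]
    by (intro borel_measurable_continuous_onI continuous_intros)+
  have [measurable]: "f \<in> borel_measurable borel" "k \<in> borel_measurable borel" by fact+
  note m[measurable]
  interpret prob_space \<gamma>
    using prob[of s] m(1) unfolding g(2)[symmetric] by (rule prob_space_distrD[rotated])
  have i: "integrable \<gamma> (\<lambda>z. f (fst z))" "integrable \<gamma> (\<lambda>z. f (snd z))"
    using f(2) by (auto intro!: integrable_const_bound[where B=C])
  have i': "integrable \<gamma> (\<lambda>z. k (fst z))"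
    using k(2) by (auto intro!: integrable_const_bound[where B=D])
  have "(\<integral>x. f x \<partial>\<nu> t) - (\<integral>x. f x \<partial>\<nu> s) = (\<integral>z. f (snd z) - f (fst z) \<partial>\<gamma>)"
    unfolding g(2,3)[symmetric] using i by (simp add: integral_distr)
  also have "\<dots> \<le> (\<integral>z. k (fst z) + c * (norm (fst z - snd z))\<^sup>2 \<partial>\<gamma>)"
    using i i' g(4) le by (intro integral_mono) auto
  also have "\<dots> = (\<integral>x. k x \<partial>\<nu> s) + c * (\<integral>z. (norm (fst z - snd z))\<^sup>2 \<partial>\<gamma>)"
    unfolding g(2)[symmetric] using i' g(4) by (simp add: integral_distr)
  also have "\<dots> \<le> (\<integral>x. k x \<partial>\<nu> s) + c * ((t - s) * (LINT u:{s..t}|lborel. q u) + e)"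
    using c g(5) by (intro add_mono mult_left_mono) auto
  also have "\<dots> \<le> (\<integral>x. k x \<partial>\<nu> s) + c * ((t - s) * (LINT u:{s..t}|lborel. q u)) + e'"
    using e(2) by (simp add: distrib_left)
  finally show "(\<integral>x. f x \<partial>\<nu> t) - (\<integral>x. f x \<partial>\<nu> s)
      \<le> (\<integral>x. k x \<partial>\<nu> s) + c * ((t - s) * (LINT u:{s..t}|lborel. q u)) + e'" .
qed

text \<open>By Young, \<open>L r \<le> L \<delta> / 2 + L r\<^sup>2 / (2 \<delta>)\<close>, which turns a Lipschitz bound into the quadratic bound
  that the transport estimate asks for.\<close>
lemma lipschitz_integral_diff:
  fixes f :: "'a \<Rightarrow> real"
  assumes st: "s \<le> t" and \<delta>: "\<delta> > 0" and ts: "t - s \<le> \<delta>\<^sup>2"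
    and b: "\<And>x. \<bar>f x\<bar> \<le> C" and L: "L \<ge> 0" "\<And>x y. \<bar>f y - f x\<bar> \<le> L * norm (x - y)"
  shows "\<bar>(\<integral>x. f x \<partial>\<nu> t) - (\<integral>x. f x \<partial>\<nu> s)\<bar> \<le> L * \<delta> * (1 + (\<integral>u. q u \<partial>lborel))"
proof -
  have fm: "f \<in> borel_measurable borel"
  proof (rule borel_measurable_continuous_onI, rule lipschitz_on_continuous_on, rule lipschitz_onI)
    show "dist (f x) (f y) \<le> L * dist x y" for x y
      using L(2)[of y x] by (simp add: dist_norm norm_minus_commute)
  qed (rule L(1))
  have young: "L * r \<le> L * \<delta> / 2 + L / (2 * \<delta>) * r\<^sup>2" for r
  proof -
    have "0 \<le> L * (r - \<delta>)\<^sup>2 / (2 * \<delta>)" using L(1) \<delta> by simp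
    also have "\<dots> = L * \<delta> / 2 + L / (2 * \<delta>) * r\<^sup>2 - L * r"
      using \<delta> by (simp add: power2_eq_square field_simps)
    finally show ?thesis by simp
  qed
  have main: "(\<integral>x. g x \<partial>\<nu> t) - (\<integral>x. g x \<partial>\<nu> s) \<le> L * \<delta> * (1 + (\<integral>u. q u \<partial>lborel))"
    if g: "g \<in> borel_measurable borel" "\<And>x. \<bar>g x\<bar> \<le> C" "\<And>x y. g y - g x \<le> L * norm (x - y)" for g
  proof -
    interpret prob_space "\<nu> s" by (rule prob)
    have "(\<integral>x. g x \<partial>\<nu> t) - (\<integral>x. g x \<partial>\<nu> s)
        \<le> (\<integral>x. L * \<delta> / 2 \<partial>\<nu> s) + L / (2 * \<delta>) * ((t - s) * (LINT u:{s..t}|lborel. q u))"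
      using st g L(1) \<delta> by (intro transport_estimate[where C=C and D="L * \<delta> / 2"])
        (auto intro!: order_trans[OF g(3)] order_trans[OF young])
    also have "\<dots> \<le> L * \<delta> / 2 + L / (2 * \<delta>) * (\<delta>\<^sup>2 * (\<integral>u. q u \<partial>lborel))"
      using L(1) \<delta> ts st window_nonneg window_le prob_space
      by (intro add_mono mult_left_mono mult_mono) auto
    also have "\<dots> = (L * \<delta> * (1 + (\<integral>u. q u \<partial>lborel))) / 2"
      using \<delta> by (simp add: power2_eq_square field_simps)
    also have "\<dots> \<le> L * \<delta> * (1 + (\<integral>u. q u \<partial>lborel))"
    proof -
      have "0 \<le> (\<integral>u. q u \<partial>lborel)" using q_nonneg by (intro integral_nonneg_AE) auto
      then have "0 \<le> L * \<delta> * (1 + (\<integral>u. q u \<partial>lborel))" using L(1) \<delta> by simp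
      then show ?thesis by linarith
    qed
    finally show ?thesis .
  qed
  have 1: "(\<integral>x. f x \<partial>\<nu> t) - (\<integral>x. f x \<partial>\<nu> s) \<le> L * \<delta> * (1 + (\<integral>u. q u \<partial>lborel))"
    using L(2) by (intro main fm b) (auto intro: order_trans[OF abs_ge_self])
  have "(\<integral>x. - f x \<partial>\<nu> t) - (\<integral>x. - f x \<partial>\<nu> s) \<le> L * \<delta> * (1 + (\<integral>u. q u \<partial>lborel))"
  proof (rule main)
    show "- f y - - f x \<le> L * norm (x - y)" for x y using L(2)[of y x] by (simp add: abs_le_iff)
  qed (use fm b in auto)
  then have 2: "- ((\<integral>x. f x \<partial>\<nu> t) - (\<integral>x. f x \<partial>\<nu> s)) \<le> L * \<delta> * (1 + (\<integral>u. q u \<partial>lborel))" by simp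
  from 1 2 show ?thesis by linarith
qed

lemma continuous_lipschitz_integral:
  fixes f :: "'a \<Rightarrow> real"
  assumes b: "\<And>x. \<bar>f x\<bar> \<le> C" and L: "L \<ge> 0" "\<And>x y. \<bar>f y - f x\<bar> \<le> L * norm (x - y)"
  shows "continuous_on UNIV (\<lambda>t. \<integral>x. f x \<partial>\<nu> t)"
proof (rule continuous_onI)
  fix s e :: real assume e: "0 < e"
  define K where "K = L * (1 + (\<integral>u. q u \<partial>lborel)) + 1"
  have "0 \<le> (\<integral>u. q u \<partial>lborel)" using q_nonneg by (intro integral_nonneg_AE) auto
  then have K: "K > 0" using L(1) unfolding K_def by (intro add_nonneg_pos mult_nonneg_nonneg) auto
  define \<delta> where "\<delta> = e / K"
  have \<delta>: "\<delta> > 0" using e K by (simp add: \<delta>_def)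
  have le: "L * \<delta> * (1 + (\<integral>u. q u \<partial>lborel)) \<le> e"
  proof -
    have "L * \<delta> * (1 + (\<integral>u. q u \<partial>lborel)) = \<delta> * (K - 1)" by (simp add: K_def algebra_simps)
    also have "\<dots> \<le> \<delta> * K" using \<delta> by simp
    finally show ?thesis using K by (simp add: \<delta>_def)
  qed
  have "dist (\<integral>x. f x \<partial>\<nu> t) (\<integral>x. f x \<partial>\<nu> s) \<le> e" if "dist t s < \<delta>\<^sup>2" for t
  proof (cases "s \<le> t")
    case True
    then show ?thesis using that lipschitz_integral_diff[OF True \<delta> _ b L] le by (force simp: dist_real_def)
  next
    case False
    then have "t \<le> s" "s - t \<le> \<delta>\<^sup>2" using that by (auto simp: dist_real_def)
    from lipschitz_integral_diff[OF this(1) \<delta> this(2) b L] le show ?thesis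
      by (simp add: dist_real_def abs_minus_commute)
  qed
  then show "\<exists>d>0. \<forall>x'\<in>UNIV. dist x' s < d \<longrightarrow> dist (\<integral>x. f x \<partial>\<nu> x') (\<integral>x. f x \<partial>\<nu> s) \<le> e"
    using \<delta> by (intro exI[of _ "\<delta>\<^sup>2"]) auto
qed

text \<open>Open sets are a generator stable under intersection, and the indicator of an open set is the limit of
  the Lipschitz functions \<open>min 1 (n dist(x, - U))\<close>, whose integrals depend continuously on time.\<close>
lemma measurable_kernel: "\<nu> \<in> borel \<rightarrow>\<^sub>M prob_algebra borel"
proof (rule measurable_prob_algebra_generated)
  show "sets borel = sigma_sets UNIV {S::'a set. open S}" by (rule sets_borel)
  show "Int_stable {S::'a set. open S}" by (auto simp: Int_stable_def)
  show "{S::'a set. open S} \<subseteq> Pow UNIV" by simp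
  show "prob_space (\<nu> t)" "sets (\<nu> t) = sets borel" for t by (rule prob sets_\<nu>)+
  fix U :: "'a set" assume "U \<in> {S. open S}"
  then have U: "open U" by simp
  show "(\<lambda>t. emeasure (\<nu> t) U) \<in> borel_measurable borel"
  proof (cases "U = UNIV")
    case True
    then have "emeasure (\<nu> t) U = 1" for t
      using prob_space.emeasure_space_1[OF prob, of t] by (simp add: space_\<nu>)
    then show ?thesis by simp
  next
    case False
    define f where "f n x = min 1 (real n * infdist x (- U))" for n x
    have fm: "f n \<in> borel_measurable borel" for n
      unfolding f_def by (intro borel_measurable_continuous_onI continuous_intros)
    have cont: "continuous_on UNIV (\<lambda>t. \<integral>x. f n x \<partial>\<nu> t)" for n
    proof (rule continuous_lipschitz_integral[where C=1 and L="real n"])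
      show "\<bar>f n x\<bar> \<le> 1" for x by (simp add: f_def infdist_nonneg)
      fix x y
      have "\<bar>f n y - f n x\<bar> \<le> \<bar>real n * infdist y (- U) - real n * infdist x (- U)\<bar>"
        unfolding f_def by linarith
      also have "\<dots> = real n * \<bar>infdist y (- U) - infdist x (- U)\<bar>"
        by (simp add: right_diff_distrib[symmetric] abs_mult)
      also have "\<dots> \<le> real n * norm (x - y)"
        using infdist_triangle_abs[of y "- U" x]
        by (intro mult_left_mono) (auto simp: dist_norm norm_minus_commute)
      finally show "\<bar>f n y - f n x\<bar> \<le> real n * norm (x - y)" .
    qed simp
    have lim: "(\<lambda>n. f n x) \<longlonglongrightarrow> indicator U x" for x
    proof (cases "x \<in> U")
      case True
      then have "infdist x (- U) > 0"
        using U False by (intro infdist_pos_not_in_closed) auto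
      then obtain N where N: "1 \<le> real N * infdist x (- U)"
        using ex_less_of_nat_mult[of "infdist x (- U)" 1] by (auto intro: less_imp_le)
      have "f n x = 1" if "n \<ge> N" for n
      proof -
        have "real N * infdist x (- U) \<le> real n * infdist x (- U)"
          using that by (intro mult_right_mono infdist_nonneg) auto
        then show ?thesis using N by (simp add: f_def)
      qed
      then have "eventually (\<lambda>n. f n x = indicator U x) sequentially"
        using True by (intro eventually_sequentiallyI[of N]) simp
      then show ?thesis by (rule tendsto_eventually)
    qed (simp add: f_def)
    have "(\<lambda>t. measure (\<nu> t) U) \<in> borel_measurable borel"
    proof (rule borel_measurable_LIMSEQ_real)
      show "(\<lambda>t. \<integral>x. f n x \<partial>\<nu> t) \<in> borel_measurable borel" for n
        by (rule borel_measurable_continuous_onI) (rule cont)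
      fix t :: real
      interpret prob_space "\<nu> t" by (rule prob)
      have "(\<lambda>n. \<integral>x. f n x \<partial>\<nu> t) \<longlonglongrightarrow> (\<integral>x. indicator U x \<partial>\<nu> t)"
      proof (rule integral_dominated_convergence[where w="\<lambda>_. 1"])
        show "AE x in \<nu> t. norm (f n x) \<le> 1" for n
          by (simp add: f_def infdist_nonneg)
      qed (use fm lim U in \<open>auto simp: measurable_\<nu>\<close>)
      then show "(\<lambda>n. \<integral>x. f n x \<partial>\<nu> t) \<longlonglongrightarrow> measure (\<nu> t) U"
        using U by (simp add: space_\<nu> sets_\<nu>)
    qed
    then have "(\<lambda>t. ennreal (measure (\<nu> t) U)) \<in> borel_measurable borel" by measurable
    moreover have "emeasure (\<nu> t) U = ennreal (measure (\<nu> t) U)" for t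
    proof -
      interpret prob_space "\<nu> t" by (rule prob)
      show ?thesis by (rule emeasure_eq_measure)
    qed
    ultimately show ?thesis by simp
  qed
qed


definition spacetime_measure :: "(real \<times> 'a) measure" where
  "spacetime_measure = lborel \<bind> (\<lambda>t. distr (\<nu> t) borel (Pair t))"

lemma measurable_Pair_borel: "Pair t \<in> measurable (\<nu> s) (borel :: (real \<times> 'a) measure)"
  unfolding measurable_\<nu> by (intro borel_measurable_continuous_onI continuous_intros)

text \<open>The shift \<open>h\<close> is needed for the measurability in \<open>t\<close> of \<open>\<integral> \<phi>(t, x) d\<nu>\<^sub>t\<^sub>+\<^sub>h\<close>.\<close>
lemma measurable_shifted_kernel:
  "(\<lambda>t. distr (\<nu> (t + h)) borel (Pair t)) \<in> lborel \<rightarrow>\<^sub>M subprob_algebra (borel :: (real \<times> 'a) measure)"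
proof (rule measurable_distr2[where M=borel])
  have "(\<lambda>t. \<nu> (t + h)) \<in> borel \<rightarrow>\<^sub>M subprob_algebra borel"
    by (rule measurable_compose[OF _ measurable_prob_algebraD[OF measurable_kernel]]) simp
  then show "(\<lambda>t. \<nu> (t + h)) \<in> lborel \<rightarrow>\<^sub>M subprob_algebra borel"
    by (simp cong: measurable_cong_sets)
  have "case_prod Pair \<in> (borel \<Otimes>\<^sub>M borel) \<rightarrow>\<^sub>M (borel :: (real \<times> 'a) measure)"
    unfolding borel_prod by simp
  then show "case_prod Pair \<in> (lborel \<Otimes>\<^sub>M borel) \<rightarrow>\<^sub>M (borel :: (real \<times> 'a) measure)"
    by (simp cong: measurable_cong_sets sets_pair_measure_cong)
qed

lemma measurable_spacetime_kernel:
  "(\<lambda>t. distr (\<nu> t) borel (Pair t)) \<in> lborel \<rightarrow>\<^sub>M subprob_algebra (borel :: (real \<times> 'a) measure)"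
  using measurable_shifted_kernel[of 0] unfolding add_0_right .

lemma sets_spacetime_measure: "sets spacetime_measure = sets borel"
  unfolding spacetime_measure_def
  by (rule sets_bind[OF _ _]) (use measurable_spacetime_kernel in \<open>auto simp: space_borel\<close>)

lemma measurable_spacetime_measure: "measurable spacetime_measure N = measurable borel N"
  by (rule measurable_cong_sets) (simp_all add: sets_spacetime_measure)

lemma nn_integral_spacetime_measure:
  assumes "f \<in> borel_measurable borel"
  shows "(\<integral>\<^sup>+z. f z \<partial>spacetime_measure) = (\<integral>\<^sup>+t. \<integral>\<^sup>+x. f (t, x) \<partial>\<nu> t \<partial>lborel)"
  unfolding spacetime_measure_def nn_integral_bind[OF assms measurable_spacetime_kernel]
  using assms by (simp add: nn_integral_distr measurable_Pair_borel)

lemma integral_spacetime_measure: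
  fixes f :: "real \<times> 'a \<Rightarrow> real"
  assumes f: "f \<in> borel_measurable borel" and i: "integrable spacetime_measure f"
  shows "integrable lborel (\<lambda>t. \<integral>x. f (t, x) \<partial>\<nu> t)"
    and "(\<integral>z. f z \<partial>spacetime_measure) = (\<integral>t. \<integral>x. f (t, x) \<partial>\<nu> t \<partial>lborel)"
  using integrable_integral_kernel[OF measurable_spacetime_kernel f i[unfolded spacetime_measure_def]]
    integral_bind_kernel[OF measurable_spacetime_kernel f i[unfolded spacetime_measure_def]] f
  by (simp_all add: integral_distr measurable_Pair_borel spacetime_measure_def)

lemma integrable_bounded_strip:
  fixes f :: "real \<times> 'a \<Rightarrow> real"
  assumes f: "f \<in> borel_measurable borel" "\<And>z. \<bar>f z\<bar> \<le> C" and z: "\<And>z. fst z \<notin> {0..T} \<Longrightarrow> f z = 0"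
  shows "integrable spacetime_measure f"
proof -
  have "(\<integral>\<^sup>+z. ennreal (norm (f z)) \<partial>spacetime_measure)
      = (\<integral>\<^sup>+t. \<integral>\<^sup>+x. ennreal (norm (f (t, x))) \<partial>\<nu> t \<partial>lborel)"
    using f by (intro nn_integral_spacetime_measure) measurable
  also have "\<dots> \<le> (\<integral>\<^sup>+t. ennreal C * indicator {0..T} t \<partial>lborel)"
  proof (rule nn_integral_mono)
    fix t
    interpret prob_space "\<nu> t" by (rule prob)
    have "(\<integral>\<^sup>+x. ennreal (norm (f (t, x))) \<partial>\<nu> t) \<le> (\<integral>\<^sup>+x. ennreal C * indicator {0..T} t \<partial>\<nu> t)"
      using f(2) z[of "(t, _)"] by (intro nn_integral_mono) (auto simp: indicator_def intro!: ennreal_leI)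
    then show "(\<integral>\<^sup>+x. ennreal (norm (f (t, x))) \<partial>\<nu> t) \<le> ennreal C * indicator {0..T} t"
      by (simp add: emeasure_space_1)
  qed
  also have "\<dots> < \<infinity>"
    by (subst nn_integral_cmult_indicator) (auto simp: ennreal_mult_less_top emeasure_lborel_Icc_eq)
  finally show ?thesis
    using f(1) by (simp add: integrable_iff_bounded measurable_spacetime_measure)
qed


lemma window_integral:
  assumes "h \<ge> 0"
  shows "integrable lborel (\<lambda>t. LINT u:{t..t + h}|lborel. q u)"
    and "(\<integral>t. (LINT u:{t..t + h}|lborel. q u) \<partial>lborel) = h * (\<integral>u. q u \<partial>lborel)"
proof -
  have [measurable]: "q \<in> borel_measurable borel" using q_int by simp
  let ?W = "\<lambda>t. LINT u:{t..t + h}|lborel. q u"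
  have W: "ennreal (?W t) = (\<integral>\<^sup>+u. ennreal (q u) * indicator {t..t + h} u \<partial>lborel)" for t
  proof -
    have "ennreal (?W t) = (\<integral>\<^sup>+u. ennreal (indicator {t..t + h} u *\<^sub>R q u) \<partial>lborel)"
      unfolding set_lebesgue_integral_def
      using window_integrable[of t "t + h"] q_nonneg
      by (intro nn_integral_eq_integral[symmetric]) (auto simp: set_integrable_def)
    also have "\<dots> = (\<integral>\<^sup>+u. ennreal (q u) * indicator {t..t + h} u \<partial>lborel)"
      by (intro nn_integral_cong) (auto simp: indicator_def)
    finally show ?thesis .
  qed
  have tot: "(\<integral>\<^sup>+t. ennreal (?W t) \<partial>lborel) = ennreal (h * (\<integral>u. q u \<partial>lborel))"
    unfolding W using nn_integral_window[of "\<lambda>u. ennreal (q u)" 0 h] assms q_int q_nonneg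
    by (simp add: nn_integral_eq_integral ennreal_mult)
  have m: "?W \<in> borel_measurable lborel"
  proof -
    have ind: "indicator {t..t + h} u = (if t \<le> u \<and> u \<le> t + h then 1 else 0::real)" for t u
      by (auto simp: indicator_def)
    show ?thesis unfolding set_lebesgue_integral_def ind by measurable
  qed
  show "integrable lborel ?W"
    using m window_nonneg by (subst integrable_iff_bounded) (simp add: tot)
  then have "ennreal (\<integral>t. ?W t \<partial>lborel) = ennreal (h * (\<integral>u. q u \<partial>lborel))"
    unfolding tot[symmetric] using window_nonneg by (intro nn_integral_eq_integral[symmetric]) auto
  moreover have "0 \<le> (\<integral>u. q u \<partial>lborel)" using q_nonneg by (intro integral_nonneg_AE) auto
  ultimately show "(\<integral>t. ?W t \<partial>lborel) = h * (\<integral>u. q u \<partial>lborel)"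
    using assms window_nonneg by (subst (asm) ennreal_inj) (auto intro!: integral_nonneg_AE)
qed

lemma test_function_integrable:
  assumes "\<phi> \<in> test_functions ({0<..<T} \<times> UNIV)"
  shows "integrable spacetime_measure \<phi>"
proof -
  obtain C where "\<And>z. \<bar>\<phi> z\<bar> \<le> C" using test_function_bounded[OF assms] by blast
  then show ?thesis
    using test_function_zero_outside[OF assms]
    by (intro integrable_bounded_strip[where C=C and T=T] borel_measurable_test_function[OF assms]) auto
qed

lemma space_gradient_square_integrable:
  assumes "\<phi> \<in> test_functions ({0<..<T} \<times> UNIV)"
  shows "integrable spacetime_measure (\<lambda>z. (norm (space_gradient \<phi> z))\<^sup>2)"
proof -
  obtain C where C: "\<And>z. norm (space_gradient \<phi> z) \<le> C" using space_gradient_bounded[OF assms] by blast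
  show ?thesis
  proof (rule integrable_bounded_strip[where C="C\<^sup>2" and T=T])
    show "(\<lambda>z. (norm (space_gradient \<phi> z))\<^sup>2) \<in> borel_measurable borel"
      using borel_measurable_space_gradient[OF assms] by measurable
    show "\<bar>(norm (space_gradient \<phi> z))\<^sup>2\<bar> \<le> C\<^sup>2" for z using C[of z] by (simp add: power_mono)
    show "(norm (space_gradient \<phi> z))\<^sup>2 = 0" if "fst z \<notin> {0..T}" for z
      using that space_gradient_zero_outside[OF assms, of z] by (cases z) auto
  qed
qed

text \<open>Write \<open>F(t, s) = \<integral> \<phi>(t, x) d\<nu>\<^sub>s\<close>. Translating time gives
  \<open>\<integral> (F(t, t + h) - F(t, t)) dt = \<integral> (F(t - h, t) - F(t, t)) dt\<close>. The right-hand side is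
  \<open>-h \<integral>\<integral> \<partial>\<^sub>t\<phi> d\<nu>\<^sub>t dt + O(h\<^sup>2)\<close> by Taylor expansion in time. On the left, Taylor expansion in space along
  a coupling and Young's inequality \<open>a r \<le> h a\<^sup>2 / 2 + r\<^sup>2 / (2 h)\<close> bound the integrand by
  \<open>h / 2 \<integral> |\<nabla>\<phi>|\<^sup>2 d\<nu>\<^sub>t\<close> plus \<open>(1 / 2 + C h) \<integral>\<^sub>t\<^sup>t\<^sup>+\<^sup>h q\<close>. Divide by \<open>h\<close> and let \<open>h\<close> tend to \<open>0\<close>.\<close>
lemma time_derivative_bound:
  assumes \<phi>: "\<phi> \<in> test_functions ({0<..<T} \<times> UNIV)" and T: "T > 0"
  shows "- (\<integral>z. time_derivative \<phi> z \<partial>spacetime_measure)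
           \<le> (\<integral>z. (norm (space_gradient \<phi> z))\<^sup>2 \<partial>spacetime_measure) / 2 + (\<integral>u. q u \<partial>lborel) / 2"
proof (rule field_le_epsilon)
  fix e :: real assume e: "0 < e"
  define Q where "Q = (\<integral>u. q u \<partial>lborel)"
  have Q: "Q \<ge> 0" unfolding Q_def using q_nonneg by (intro integral_nonneg_AE) auto
  define \<tau> where "\<tau> = (\<integral>z. time_derivative \<phi> z \<partial>spacetime_measure)"
  define n2 where "n2 = (\<integral>z. (norm (space_gradient \<phi> z))\<^sup>2 \<partial>spacetime_measure)"
  obtain C where C: "C \<ge> 0"
    "\<And>z w. \<bar>\<phi> (z + w) - \<phi> z - frechet_derivative \<phi> (at z) w\<bar> \<le> C * (norm w)\<^sup>2"
    using test_function_taylor[OF \<phi>] by blast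
  obtain B where B: "\<And>z. \<bar>\<phi> z\<bar> \<le> B" using test_function_bounded[OF \<phi>] by blast
  obtain B' where B': "\<And>z. norm (space_gradient \<phi> z) \<le> B'" using space_gradient_bounded[OF \<phi>] by blast
  obtain B'' where B'': "\<And>z. \<bar>time_derivative \<phi> z\<bar> \<le> B''"
    using test_function_bounded[OF time_derivative_test_function[OF \<phi>]] by blast
  note \<phi>m = borel_measurable_test_function[OF \<phi>]
  note \<phi>'m = borel_measurable_test_function[OF time_derivative_test_function[OF \<phi>]]
  note gm = borel_measurable_space_gradient[OF \<phi>]
  have slice: "(\<lambda>x. f (t, x)) \<in> borel_measurable borel" if "f \<in> borel_measurable borel"
    for t and f :: "real \<times> 'a \<Rightarrow> real"
    by (rule measurable_compose[OF _ that]) (intro borel_measurable_continuous_onI continuous_intros)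
  \<comment> \<open>The Taylor remainders and the term \<open>C h Q\<close> add up to at most \<open>h C (T + 1 + Q) \<le> e\<close>.\<close>
  define h where "h = min 1 (e / (C * (T + 1 + Q) + 1))"
  have h: "0 < h" "h \<le> 1" "h * (C * (T + 1 + Q)) \<le> e"
  proof -
    have pos: "C * (T + 1 + Q) \<ge> 0" using C(1) Q T by simp
    then show "0 < h" "h \<le> 1" using e by (auto simp: h_def)
    have "h * (C * (T + 1 + Q)) \<le> e / (C * (T + 1 + Q) + 1) * (C * (T + 1 + Q) + 1)"
      using pos e by (intro mult_mono) (auto simp: h_def)
    then show "h * (C * (T + 1 + Q)) \<le> e" using pos by simp
  qed
  define F where "F t s = (\<integral>x. \<phi> (t, x) \<partial>\<nu> s)" for t s
  have F0: "F t s = 0" if "t \<notin> {0..T}" for t s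
  proof -
    have "\<phi> (t, x) = 0" for x using that by (intro test_function_zero_outside[OF \<phi>]) auto
    then show ?thesis by (simp add: F_def)
  qed
  have FB: "\<bar>F t s\<bar> \<le> B" for t s
  proof -
    interpret prob_space "\<nu> s" by (rule prob)
    have "\<bar>F t s\<bar> \<le> (\<integral>x. \<bar>\<phi> (t, x)\<bar> \<partial>\<nu> s)" unfolding F_def by (rule integral_abs_bound)
    also have "\<dots> \<le> (\<integral>x. B \<partial>\<nu> s)"
      using B order_trans[OF abs_ge_zero B[of "(0, 0)"]] slice[OF \<phi>m]
      by (intro integral_mono integrable_bounded_\<nu>[where C=B]) auto
    finally show ?thesis by (simp add: prob_space)
  qed
  have Fint: "integrable lborel (\<lambda>t. F t (t + k))" for k
  proof (rule Bochner_Integration.integrable_bound)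
    show "integrable lborel (\<lambda>t. indicator {0..T} t *\<^sub>R B)"
      by (rule integrable_indicator) (auto simp: emeasure_lborel_Icc_eq)
    have "(\<lambda>t. \<integral>z. \<phi> z \<partial>distr (\<nu> (t + k)) borel (Pair t)) \<in> borel_measurable lborel"
      by (rule measurable_compose[OF measurable_shifted_kernel integral_measurable_subprob_algebra[OF \<phi>m]])
    then show "(\<lambda>t. F t (t + k)) \<in> borel_measurable lborel"
      unfolding F_def by (subst (asm) integral_distr[OF measurable_Pair_borel \<phi>m]) simp
    show "AE t in lborel. norm (F t (t + k)) \<le> norm (indicator {0..T} t *\<^sub>R B)"
      using FB F0 by (intro AE_I2) (auto simp: indicator_def intro: order_trans[OF FB abs_ge_self])
  qed
  note Fint0 = Fint[of 0, unfolded add_0_right]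
  have shift: "(\<integral>t. F t (t + h) \<partial>lborel) = (\<integral>t. F (t - h) t \<partial>lborel)"
    using lborel_integral_real_affine[of 1 "\<lambda>t. F t (t + h)" "- h"] by simp
  have shift_int: "integrable lborel (\<lambda>t. F (t - h) t)"
    using lborel_integrable_real_affine[OF Fint[of h], of 1 "- h"] by simp
  \<comment> \<open>First order in space, along the couplings.\<close>
  have upper: "(\<integral>t. F t (t + h) - F t t \<partial>lborel) \<le> h / 2 * n2 + (1 / 2 + C * h) * (h * Q)"
  proof -
    let ?W = "\<lambda>t. LINT u:{t..t + h}|lborel. q u"
    let ?N = "\<lambda>t. \<integral>x. (norm (space_gradient \<phi> (t, x)))\<^sup>2 \<partial>\<nu> t"
    have gm2: "(\<lambda>z. (norm (space_gradient \<phi> z))\<^sup>2) \<in> borel_measurable borel" using gm by measurable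
    note Nint = integral_spacetime_measure[OF gm2 space_gradient_square_integrable[OF \<phi>]]
    have "(\<integral>t. F t (t + h) - F t t \<partial>lborel) \<le> (\<integral>t. h / 2 * ?N t + (1 / 2 + C * h) * ?W t \<partial>lborel)"
    proof (rule integral_mono)
      show "integrable lborel (\<lambda>t. F t (t + h) - F t t)" using Fint Fint0 by simp
      show "integrable lborel (\<lambda>t. h / 2 * ?N t + (1 / 2 + C * h) * ?W t)"
        using Nint(1) window_integral(1)[of h] h(1) by simp
      fix t
      have "F t (t + h) - F t t \<le> (\<integral>x. h / 2 * (norm (space_gradient \<phi> (t, x)))\<^sup>2 \<partial>\<nu> t)
          + (1 / (2 * h) + C) * ((t + h - t) * ?W t)"
        unfolding F_def
      proof (rule transport_estimate)
        show "(\<lambda>x. \<phi> (t, x)) \<in> borel_measurable borel" by (rule slice[OF \<phi>m])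
        show "\<bar>\<phi> (t, x)\<bar> \<le> B" for x by (rule B)
        show "(\<lambda>x. h / 2 * (norm (space_gradient \<phi> (t, x)))\<^sup>2) \<in> borel_measurable borel"
          using slice[OF gm2] by measurable
        show "\<bar>h / 2 * (norm (space_gradient \<phi> (t, x)))\<^sup>2\<bar> \<le> h / 2 * B'\<^sup>2" for x
          using B'[of "(t, x)"] h(1) by (simp add: power_mono)
        show "0 \<le> 1 / (2 * h) + C" "t \<le> t + h" using h(1) C(1) by auto
        fix x y :: 'a
        have eq: "(t, x) + (0, y - x) = (t, y)" by (simp add: algebra_simps)
        have "\<phi> (t, y) - \<phi> (t, x) \<le> frechet_derivative \<phi> (at (t, x)) (0, y - x) + C * (norm (0::real, y - x))\<^sup>2"
          using C(2)[of "(t, x)" "(0, y - x)", unfolded eq] by linarith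
        also have "frechet_derivative \<phi> (at (t, x)) (0, y - x) = space_gradient \<phi> (t, x) \<bullet> (y - x)"
          by (simp add: frechet_derivative_spacetime[OF \<phi>])
        also have "norm (0::real, y - x) = norm (x - y)" by (simp add: norm_minus_commute)
        also have "space_gradient \<phi> (t, x) \<bullet> (y - x)
            \<le> h / 2 * (norm (space_gradient \<phi> (t, x)))\<^sup>2 + 1 / (2 * h) * (norm (x - y))\<^sup>2"
        proof -
          define a b where "a = norm (space_gradient \<phi> (t, x))" and "b = norm (x - y)"
          have "space_gradient \<phi> (t, x) \<bullet> (y - x) \<le> a * b"
            unfolding a_def b_def norm_minus_commute[of x y] by (rule norm_cauchy_schwarz)
          moreover have "0 \<le> (h * a - b)\<^sup>2 / (2 * h)" using h(1) by simp
          then have "a * b \<le> h / 2 * a\<^sup>2 + 1 / (2 * h) * b\<^sup>2"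
            using h(1) by (simp add: power2_eq_square field_simps)
          ultimately show ?thesis by (simp add: a_def b_def)
        qed
        finally show "\<phi> (t, y) - \<phi> (t, x) \<le> h / 2 * (norm (space_gradient \<phi> (t, x)))\<^sup>2
            + (1 / (2 * h) + C) * (norm (x - y))\<^sup>2"
          by (simp add: distrib_right)
      qed
      also have "\<dots> = h / 2 * ?N t + (1 / 2 + C * h) * ?W t"
        using h(1) by (simp add: field_simps)
      finally show "F t (t + h) - F t t \<le> h / 2 * ?N t + (1 / 2 + C * h) * ?W t" .
    qed
    also have "\<dots> = h / 2 * n2 + (1 / 2 + C * h) * (h * Q)"
      using Nint window_integral[of h] h(1) by (simp add: n2_def Q_def)
    finally show ?thesis .
  qed
  \<comment> \<open>First order in time; for \<open>h \<le> 1\<close> the remainder is supported in \<open>[0, T + 1]\<close>.\<close>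
  have lower: "- h * \<tau> - C * h\<^sup>2 * (T + 1) \<le> (\<integral>t. F (t - h) t - F t t \<partial>lborel)"
  proof -
    note \<tau>int = integral_spacetime_measure[OF \<phi>'m test_function_integrable[OF time_derivative_test_function[OF \<phi>]]]
    let ?I = "\<lambda>t. indicator {0..T + 1} t :: real"
    have Iint: "integrable lborel (\<lambda>t. ?I t)" by (rule integrable_real_indicator) (auto simp: emeasure_lborel_Icc_eq)
    have "- h * \<tau> - C * h\<^sup>2 * (T + 1)
        = (\<integral>t. - h * (\<integral>x. time_derivative \<phi> (t, x) \<partial>\<nu> t) - C * h\<^sup>2 * ?I t \<partial>lborel)"
      using \<tau>int Iint T by (simp add: \<tau>_def)
    also have "\<dots> \<le> (\<integral>t. F (t - h) t - F t t \<partial>lborel)"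
    proof (rule integral_mono)
      show "integrable lborel (\<lambda>t. - h * (\<integral>x. time_derivative \<phi> (t, x) \<partial>\<nu> t) - C * h\<^sup>2 * ?I t)"
        using \<tau>int(1) Iint by simp
      show "integrable lborel (\<lambda>t. F (t - h) t - F t t)" using shift_int Fint0 by simp
      fix t
      interpret prob_space "\<nu> t" by (rule prob)
      have i: "integrable (\<nu> t) (\<lambda>x. \<phi> (s, x))" "integrable (\<nu> t) (\<lambda>x. time_derivative \<phi> (s, x))" for s
        using B B'' by (auto intro!: integrable_bounded_\<nu> slice[OF \<phi>m] slice[OF \<phi>'m])
      have "- h * (\<integral>x. time_derivative \<phi> (t, x) \<partial>\<nu> t) - C * h\<^sup>2 * ?I t
          = (\<integral>x. - h * time_derivative \<phi> (t, x) - C * h\<^sup>2 * ?I t \<partial>\<nu> t)"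
        using i prob_space by simp
      also have "\<dots> \<le> (\<integral>x. \<phi> (t - h, x) - \<phi> (t, x) \<partial>\<nu> t)"
      proof (rule integral_mono)
        fix x :: 'a
        have eq: "(t, x) + (- h, 0) = (t - h, x)" by simp
        have D: "frechet_derivative \<phi> (at (t, x)) (- h, 0) = - h * time_derivative \<phi> (t, x)"
          by (simp add: frechet_derivative_spacetime[OF \<phi>])
        have "\<bar>\<phi> (t - h, x) - \<phi> (t, x) - (- h * time_derivative \<phi> (t, x))\<bar> \<le> C * h\<^sup>2"
          using C(2)[of "(t, x)" "(- h, 0)", unfolded eq D] h(1) by simp
        moreover have "\<phi> (t - h, x) = 0 \<and> \<phi> (t, x) = 0 \<and> time_derivative \<phi> (t, x) = 0" if "t \<notin> {0..T + 1}"
          using that h test_function_zero_outside[OF \<phi>]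
            test_function_zero_outside[OF time_derivative_test_function[OF \<phi>]] by auto
        ultimately show "- h * time_derivative \<phi> (t, x) - C * h\<^sup>2 * ?I t \<le> \<phi> (t - h, x) - \<phi> (t, x)"
          by (cases "t \<in> {0..T + 1}") auto
      qed (use i in auto)
      also have "\<dots> = F (t - h) t - F t t" using i by (simp add: F_def)
      finally show "- h * (\<integral>x. time_derivative \<phi> (t, x) \<partial>\<nu> t) - C * h\<^sup>2 * ?I t \<le> F (t - h) t - F t t" .
    qed
    finally show ?thesis .
  qed
  have "(\<integral>t. F (t - h) t - F t t \<partial>lborel) = (\<integral>t. F t (t + h) - F t t \<partial>lborel)"
    using Fint Fint0 shift shift_int by simp
  with upper lower have "- h * \<tau> - C * h\<^sup>2 * (T + 1) \<le> h / 2 * n2 + (1 / 2 + C * h) * (h * Q)" by simp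
  then have "h * (- \<tau>) \<le> h * (n2 / 2 + Q / 2 + h * (C * (T + 1 + Q)))"
    by (simp add: power2_eq_square algebra_simps)
  then have "- \<tau> \<le> n2 / 2 + Q / 2 + h * (C * (T + 1 + Q))"
    using h(1) by (subst (asm) mult_le_cancel_left_pos) auto
  with h(3) show "- (\<integral>z. time_derivative \<phi> z \<partial>spacetime_measure)
      \<le> (\<integral>z. (norm (space_gradient \<phi> z))\<^sup>2 \<partial>spacetime_measure) / 2 + (\<integral>u. q u \<partial>lborel) / 2 + e"
    by (simp add: \<tau>_def n2_def Q_def)
qed

text \<open>Apply the representation theorem to the graph of \<open>\<nabla>\<phi> \<mapsto> -\<integral>\<integral> \<partial>\<^sub>t\<phi> d\<nu>\<^sub>t dt\<close>.\<close>
proposition velocity_field: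
  assumes T: "T > 0"
  obtains \<alpha> :: "real \<times> 'a \<Rightarrow> 'a" where "\<alpha> \<in> borel_measurable borel"
    "\<And>a b. (\<integral>\<^sup>+t\<in>{a..b}. (\<integral>\<^sup>+x. ennreal (norm (\<alpha> (t, x))) \<partial>\<nu> t) \<partial>lborel) < \<infinity>"
    "\<And>\<phi>. \<phi> \<in> test_functions ({0<..<T} \<times> UNIV) \<Longrightarrow>
      (LINT t:{0..T}|lborel. (\<integral>x. frechet_derivative \<phi> (at (t, x)) (1, \<alpha> (t, x)) \<partial>\<nu> t)) = 0"
proof -
  let ?S = "test_functions ({0<..<T} \<times> UNIV) :: (real \<times> 'a \<Rightarrow> real) set"
  define L where "L \<phi> = - (\<integral>z. time_derivative \<phi> z \<partial>spacetime_measure)" for \<phi>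
  define R where "R = (\<lambda>\<phi>. (space_gradient \<phi>, L \<phi>)) ` ?S"
  have tdi: "integrable spacetime_measure (time_derivative \<phi>)" if "\<phi> \<in> ?S" for \<phi>
    by (rule test_function_integrable[OF time_derivative_test_function[OF that]])
  obtain \<alpha> where \<alpha>: "\<alpha> \<in> borel_measurable spacetime_measure"
    "integrable spacetime_measure (\<lambda>z. (norm (\<alpha> z))\<^sup>2)"
    "\<And>u l. (u, l) \<in> R \<Longrightarrow> (\<integral>z. u z \<bullet> \<alpha> z \<partial>spacetime_measure) = l"
  proof (rule L2_representation[of R spacetime_measure "(\<integral>u. q u \<partial>lborel) / 2"])
    have "((\<lambda>_. 0), 0) = (space_gradient (\<lambda>_::real \<times> 'a. 0), L (\<lambda>_. 0))"
      by (simp add: L_def time_derivative_def space_gradient_def[abs_def] frechet_derivative_const)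
    then show "((\<lambda>_. 0), 0) \<in> R" unfolding R_def using test_function_zero by (rule image_eqI)
    show "((\<lambda>x. u x + a *\<^sub>R v x), l + a * k) \<in> R" if "(u, l) \<in> R" "(v, k) \<in> R" for u l v k a
    proof -
      from that(1) obtain \<phi> where 1: "\<phi> \<in> ?S" "u = space_gradient \<phi>" "l = L \<phi>"
        unfolding R_def by (elim imageE) simp
      from that(2) obtain \<psi> where 2: "\<psi> \<in> ?S" "v = space_gradient \<psi>" "k = L \<psi>"
        unfolding R_def by (elim imageE) simp
      have "((\<lambda>x. u x + a *\<^sub>R v x), l + a * k)
          = (space_gradient (\<lambda>z. \<phi> z + a * \<psi> z), L (\<lambda>z. \<phi> z + a * \<psi> z))"
        using tdi[OF 1(1)] tdi[OF 2(1)] 1(1) 2(1) unfolding 1(2,3) 2(2,3)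
        by (auto simp: space_gradient_add_cmult time_derivative_add_cmult L_def)
      then show ?thesis unfolding R_def
        by (rule image_eqI[where x="\<lambda>z. \<phi> z + a * \<psi> z"]) (rule test_function_add_cmult[OF 1(1) 2(1)])
    qed
    show "u \<in> borel_measurable spacetime_measure" if "(u, l) \<in> R" for u l
      using that borel_measurable_space_gradient by (auto simp: R_def measurable_spacetime_measure)
    show "integrable spacetime_measure (\<lambda>z. (norm (u z))\<^sup>2)" if "(u, l) \<in> R" for u l
      using that space_gradient_square_integrable by (auto simp: R_def)
    show "l \<le> (\<integral>z. (norm (u z))\<^sup>2 \<partial>spacetime_measure) / 2 + (\<integral>u. q u \<partial>lborel) / 2" if "(u, l) \<in> R" for u l
      using that time_derivative_bound[OF _ T] by (auto simp: R_def L_def)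
  qed blast
  have \<alpha>m: "\<alpha> \<in> borel_measurable borel" using \<alpha>(1) by (simp add: measurable_spacetime_measure)
  note [measurable] = \<alpha>m
  show ?thesis
  proof (rule that[of \<alpha>])
    show "\<alpha> \<in> borel_measurable borel" by fact
    fix a b :: real
    define S where "S = ({a..b} \<times> UNIV :: (real \<times> 'a) set)"
    have [measurable]: "S \<in> sets borel"
      unfolding S_def by (intro borel_closed closed_Times) auto
    have "(\<integral>\<^sup>+t\<in>{a..b}. (\<integral>\<^sup>+x. ennreal (norm (\<alpha> (t, x))) \<partial>\<nu> t) \<partial>lborel)
        = (\<integral>\<^sup>+t. \<integral>\<^sup>+x. ennreal (norm (\<alpha> (t, x))) * indicator S (t, x) \<partial>\<nu> t \<partial>lborel)"
      by (intro nn_integral_cong) (auto simp: S_def indicator_def)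
    also have "\<dots> = (\<integral>\<^sup>+z. ennreal (norm (\<alpha> z)) * indicator S z \<partial>spacetime_measure)"
      by (rule nn_integral_spacetime_measure[symmetric]) measurable
    also have "\<dots> \<le> (\<integral>\<^sup>+z. indicator S z + ennreal ((norm (\<alpha> z))\<^sup>2) \<partial>spacetime_measure)"
    proof (rule nn_integral_mono)
      fix z
      have "norm (\<alpha> z) \<le> 1 + (norm (\<alpha> z))\<^sup>2"
        using sum_squares_bound[of 1 "norm (\<alpha> z)"] norm_ge_zero[of "\<alpha> z"]
        unfolding power_one mult_1_right by linarith
      then have "ennreal (norm (\<alpha> z)) \<le> 1 + ennreal ((norm (\<alpha> z))\<^sup>2)"
        by (simp add: ennreal_leI flip: ennreal_1 ennreal_plus)
      then show "ennreal (norm (\<alpha> z)) * indicator S z \<le> indicator S z + ennreal ((norm (\<alpha> z))\<^sup>2)"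
        by (cases "z \<in> S") auto
    qed
    also have "\<dots> = (\<integral>\<^sup>+z. indicator S z \<partial>spacetime_measure) + (\<integral>\<^sup>+z. ennreal ((norm (\<alpha> z))\<^sup>2) \<partial>spacetime_measure)"
      by (intro nn_integral_add) (simp_all add: measurable_spacetime_measure)
    also have "\<dots> < \<infinity>"
    proof -
      have "(\<integral>\<^sup>+z. indicator S z \<partial>spacetime_measure) = (\<integral>\<^sup>+t. \<integral>\<^sup>+x. indicator S (t, x) \<partial>\<nu> t \<partial>lborel)"
        by (rule nn_integral_spacetime_measure) measurable
      also have "\<dots> = (\<integral>\<^sup>+t. indicator {a..b} t \<partial>lborel)"
      proof (rule nn_integral_cong)
        fix t
        interpret prob_space "\<nu> t" by (rule prob)
        have "(\<integral>\<^sup>+x. indicator S (t, x) \<partial>\<nu> t) = (\<integral>\<^sup>+x. indicator {a..b} t \<partial>\<nu> t)"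
          by (intro nn_integral_cong) (auto simp: S_def indicator_def)
        then show "(\<integral>\<^sup>+x. indicator S (t, x) \<partial>\<nu> t) = indicator {a..b} t"
          by (simp add: emeasure_space_1)
      qed
      also have "\<dots> < \<infinity>" by (simp add: emeasure_lborel_Icc_eq)
      finally show ?thesis
        using \<alpha>(2) integrable_square_iff_nn_integral[OF \<alpha>(1)] by (simp add: ennreal_add_less_top)
    qed
    finally show "(\<integral>\<^sup>+t\<in>{a..b}. (\<integral>\<^sup>+x. ennreal (norm (\<alpha> (t, x))) \<partial>\<nu> t) \<partial>lborel) < \<infinity>" .
  next
    fix \<phi> assume \<phi>: "\<phi> \<in> ?S"
    define D where "D z = time_derivative \<phi> z + space_gradient \<phi> z \<bullet> \<alpha> z" for z
    note [measurable] = borel_measurable_space_gradient[OF \<phi>]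
      borel_measurable_test_function[OF time_derivative_test_function[OF \<phi>]]
    have D: "frechet_derivative \<phi> (at z) (1, \<alpha> z) = D z" for z
      by (simp add: D_def frechet_derivative_spacetime[OF \<phi>])
    have gi: "integrable spacetime_measure (\<lambda>z. space_gradient \<phi> z \<bullet> \<alpha> z)"
      using \<alpha>(1,2) space_gradient_square_integrable[OF \<phi>] borel_measurable_space_gradient[OF \<phi>]
      by (intro square_integrable_inner) (auto simp: measurable_spacetime_measure)
    have Dm: "D \<in> borel_measurable borel" unfolding D_def[abs_def] by measurable
    have Di: "integrable spacetime_measure D"
      unfolding D_def[abs_def] by (intro Bochner_Integration.integrable_add gi tdi \<phi>)
    have "(\<integral>z. space_gradient \<phi> z \<bullet> \<alpha> z \<partial>spacetime_measure) = L \<phi>"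
      using \<phi> by (intro \<alpha>(3)) (auto simp: R_def)
    then have "(\<integral>z. D z \<partial>spacetime_measure) = 0"
      unfolding D_def using gi tdi[OF \<phi>] by (simp add: L_def)
    then have "(\<integral>t. \<integral>x. D (t, x) \<partial>\<nu> t \<partial>lborel) = 0"
      using integral_spacetime_measure(2)[OF Dm Di] by simp
    moreover have "indicator {0..T} t *\<^sub>R (\<integral>x. D (t, x) \<partial>\<nu> t) = (\<integral>x. D (t, x) \<partial>\<nu> t)" for t
    proof (cases "t \<in> {0..T}")
      case False
      then have "D (t, x) = 0" for x
        using space_gradient_zero_outside[OF \<phi>, of "(t, x)"]
          test_function_zero_outside[OF time_derivative_test_function[OF \<phi>], of "(t, x)"]
        by (auto simp: D_def)
      then show ?thesis by simp
    qed simp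
    ultimately show "(LINT t:{0..T}|lborel. (\<integral>x. frechet_derivative \<phi> (at (t, x)) (1, \<alpha> (t, x)) \<partial>\<nu> t)) = 0"
      unfolding D set_lebesgue_integral_def by (simp only:)
  qed
qed

end

section \<open>Couplings and the Wasserstein distance\<close>

lemma P2_D:
  assumes "\<mu> \<in> P2 E"
  shows "prob_space \<mu>" "sets \<mu> = sets (restrict_space borel E)" "integrable \<mu> (\<lambda>x. (norm x)\<^sup>2)"
    "(\<lambda>x. x) \<in> borel_measurable \<mu>"
proof -
  show s: "sets \<mu> = sets (restrict_space borel E)" and "integrable \<mu> (\<lambda>x. (norm x)\<^sup>2)"
    using assms by (auto simp: P2_def)
  show "prob_space \<mu>" using assms by (intro prob_spaceI) (simp add: P2_def)
  show "(\<lambda>x. x) \<in> borel_measurable \<mu>"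
    unfolding measurable_cong_sets[OF s refl] by (rule measurable_restrict_space1) simp
qed

lemma coupling_measurable:
  fixes \<mu> \<nu> :: "'a::euclidean_space measure"
  assumes \<mu>: "\<mu> \<in> P2 E" and \<nu>: "\<nu> \<in> P2 E" and \<gamma>: "\<gamma> \<in> couplings \<mu> \<nu>"
  shows "fst \<in> measurable \<gamma> \<mu>" "snd \<in> measurable \<gamma> \<nu>"
    "fst \<in> borel_measurable \<gamma>" "snd \<in> borel_measurable \<gamma>"
proof -
  have s: "sets \<gamma> = sets (\<mu> \<Otimes>\<^sub>M \<nu>)" using \<gamma> by (simp add: couplings_def)
  show f: "fst \<in> measurable \<gamma> \<mu>" "snd \<in> measurable \<gamma> \<nu>"
    unfolding measurable_cong_sets[OF s refl] by (rule measurable_fst measurable_snd)+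
  show "fst \<in> borel_measurable \<gamma>" "snd \<in> borel_measurable \<gamma>"
    using measurable_compose[OF f(1) P2_D(4)[OF \<mu>]] measurable_compose[OF f(2) P2_D(4)[OF \<nu>]] by simp_all
qed

text \<open>The product coupling has finite cost. Thus \<open>enn2real\<close> in the definition of \<open>W2\<close> loses no
  information, and couplings of cost close to \<open>W2\<^sup>2\<close> exist.\<close>
lemma transport_cost_finite:
  fixes \<mu> \<nu> :: "'a::euclidean_space measure"
  assumes \<mu>: "\<mu> \<in> P2 E" and \<nu>: "\<nu> \<in> P2 E"
  shows "(INF \<gamma>\<in>couplings \<mu> \<nu>. \<integral>\<^sup>+z. ennreal ((norm (fst z - snd z))\<^sup>2) \<partial>\<gamma>) < \<infinity>"
proof -
  let ?P = "\<mu> \<Otimes>\<^sub>M \<nu>"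
  interpret M: prob_space \<mu> by (rule P2_D[OF \<mu>])
  interpret N: prob_space \<nu> by (rule P2_D[OF \<nu>])
  interpret pair_prob_space \<mu> \<nu> ..
  have d1: "distr ?P \<mu> fst = \<mu>" by (rule N.distr_pair_fst)
  have d2: "distr ?P \<nu> snd = \<nu>"
  proof -
    interpret Q: pair_sigma_finite \<nu> \<mu> ..
    have "distr ?P \<nu> snd = distr (distr (\<nu> \<Otimes>\<^sub>M \<mu>) ?P (\<lambda>(x, y). (y, x))) \<nu> snd"
      using distr_pair_swap by simp
    also have "\<dots> = distr (\<nu> \<Otimes>\<^sub>M \<mu>) \<nu> fst"
      by (subst distr_distr) (auto simp: comp_def split_beta cong: distr_cong)
    also have "\<dots> = \<nu>" by (rule M.distr_pair_fst)
    finally show ?thesis .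
  qed
  have P: "?P \<in> couplings \<mu> \<nu>" using d1 d2 by (simp add: couplings_def)
  note m[measurable] = coupling_measurable[OF \<mu> \<nu> P]
  have "(\<integral>\<^sup>+z. ennreal ((norm (fst z - snd z))\<^sup>2) \<partial>?P)
      \<le> (\<integral>\<^sup>+z. 2 * ennreal ((norm (fst z))\<^sup>2) + 2 * ennreal ((norm (snd z))\<^sup>2) \<partial>?P)"
  proof (rule nn_integral_mono)
    fix z :: "'a \<times> 'a"
    have "(norm (fst z - snd z))\<^sup>2 \<le> (norm (fst z) + norm (snd z))\<^sup>2"
      by (intro power_mono norm_triangle_ineq4) simp
    also have "\<dots> \<le> 2 * (norm (fst z))\<^sup>2 + 2 * (norm (snd z))\<^sup>2"
      using sum_squares_bound[of "norm (fst z)" "norm (snd z)"] by (simp add: power2_sum)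
    finally have "ennreal ((norm (fst z - snd z))\<^sup>2) \<le> ennreal (2 * (norm (fst z))\<^sup>2 + 2 * (norm (snd z))\<^sup>2)"
      by (rule ennreal_leI)
    then show "ennreal ((norm (fst z - snd z))\<^sup>2) \<le> 2 * ennreal ((norm (fst z))\<^sup>2) + 2 * ennreal ((norm (snd z))\<^sup>2)"
      by (simp add: ennreal_mult)
  qed
  also have "\<dots> = 2 * (\<integral>\<^sup>+z. ennreal ((norm (fst z))\<^sup>2) \<partial>?P) + 2 * (\<integral>\<^sup>+z. ennreal ((norm (snd z))\<^sup>2) \<partial>?P)"
    by (subst nn_integral_add) (auto simp: nn_integral_cmult)
  also have "(\<integral>\<^sup>+z. ennreal ((norm (fst z))\<^sup>2) \<partial>?P) = (\<integral>\<^sup>+x. ennreal ((norm x)\<^sup>2) \<partial>distr ?P \<mu> fst)"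
    using P2_D(4)[OF \<mu>] by (subst nn_integral_distr) auto
  also have "(\<integral>\<^sup>+z. ennreal ((norm (snd z))\<^sup>2) \<partial>?P) = (\<integral>\<^sup>+x. ennreal ((norm x)\<^sup>2) \<partial>distr ?P \<nu> snd)"
    using P2_D(4)[OF \<nu>] by (subst nn_integral_distr) auto
  also have "2 * (\<integral>\<^sup>+x. ennreal ((norm x)\<^sup>2) \<partial>distr ?P \<mu> fst) + 2 * (\<integral>\<^sup>+x. ennreal ((norm x)\<^sup>2) \<partial>distr ?P \<nu> snd) < \<infinity>"
    unfolding d1 d2 using P2_D(3)[OF \<mu>] P2_D(3)[OF \<nu>]
    by (simp add: nn_integral_eq_integral ennreal_mult_less_top)
  finally show ?thesis by (rule order.strict_trans1[OF INF_lower[OF P]])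
qed

lemma W2_nonneg: "0 \<le> W2 \<mu> \<nu>"
  by (simp add: W2_def)

lemma W2_sym:
  fixes \<mu> \<nu> :: "'a::euclidean_space measure"
  assumes \<mu>: "\<mu> \<in> P2 E" and \<nu>: "\<nu> \<in> P2 E"
  shows "W2 \<mu> \<nu> = W2 \<nu> \<mu>"
proof -
  have le: "(INF \<gamma>\<in>couplings \<nu> \<mu>. \<integral>\<^sup>+z. ennreal ((norm (fst z - snd z))\<^sup>2) \<partial>\<gamma>)
      \<le> (INF \<gamma>\<in>couplings \<mu> \<nu>. \<integral>\<^sup>+z. ennreal ((norm (fst z - snd z))\<^sup>2) \<partial>\<gamma>)"
    if \<mu>: "\<mu> \<in> P2 E" and \<nu>: "\<nu> \<in> P2 E" for \<mu> \<nu> :: "'a measure"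
  proof (rule INF_greatest)
    fix \<gamma> assume \<gamma>: "\<gamma> \<in> couplings \<mu> \<nu>"
    note m[measurable] = coupling_measurable[OF \<mu> \<nu> \<gamma>]
    let ?s = "\<lambda>z. (snd z, fst z)"
    have s: "?s \<in> measurable \<gamma> (\<nu> \<Otimes>\<^sub>M \<mu>)" by measurable
    let ?\<gamma>' = "distr \<gamma> (\<nu> \<Otimes>\<^sub>M \<mu>) ?s"
    have \<gamma>': "?\<gamma>' \<in> couplings \<nu> \<mu>"
      using \<gamma> by (auto simp: couplings_def distr_distr[OF measurable_fst s] distr_distr[OF measurable_snd s] comp_def)
    note m'[measurable] = coupling_measurable[OF \<nu> \<mu> \<gamma>']
    have "(INF \<gamma>\<in>couplings \<nu> \<mu>. \<integral>\<^sup>+z. ennreal ((norm (fst z - snd z))\<^sup>2) \<partial>\<gamma>)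
        \<le> (\<integral>\<^sup>+z. ennreal ((norm (fst z - snd z))\<^sup>2) \<partial>?\<gamma>')"
      by (rule INF_lower[OF \<gamma>'])
    also have "\<dots> = (\<integral>\<^sup>+z. ennreal ((norm (fst z - snd z))\<^sup>2) \<partial>\<gamma>)"
    proof -
      have "(\<lambda>z. ennreal ((norm (fst z - snd z))\<^sup>2)) \<in> borel_measurable ?\<gamma>'" by measurable
      then show ?thesis
        by (subst nn_integral_distr[OF s]) (simp_all add: norm_minus_commute)
    qed
    finally show "(INF \<gamma>\<in>couplings \<nu> \<mu>. \<integral>\<^sup>+z. ennreal ((norm (fst z - snd z))\<^sup>2) \<partial>\<gamma>)
        \<le> (\<integral>\<^sup>+z. ennreal ((norm (fst z - snd z))\<^sup>2) \<partial>\<gamma>)" .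
  qed
  show ?thesis unfolding W2_def using le[OF \<mu> \<nu>] le[OF \<nu> \<mu>] by (simp add: order_antisym)
qed

text \<open>The measures are pushed forward from \<open>E\<close> to the whole space, so that all couplings live on the same
  Borel sigma-algebra whatever the set \<open>E\<close> is.\<close>
lemma almost_optimal_borel_coupling:
  fixes \<mu> \<nu> :: "'a::euclidean_space measure"
  assumes \<mu>: "\<mu> \<in> P2 E" and \<nu>: "\<nu> \<in> P2 E" and e: "0 < e"
  obtains \<gamma> where "sets \<gamma> = sets (borel :: ('a \<times> 'a) measure)"
    "distr \<gamma> borel fst = distr \<mu> borel (\<lambda>x. x)" "distr \<gamma> borel snd = distr \<nu> borel (\<lambda>x. x)"
    "integrable \<gamma> (\<lambda>z. (norm (fst z - snd z))\<^sup>2)"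
    "(\<integral>z. (norm (fst z - snd z))\<^sup>2 \<partial>\<gamma>) \<le> (W2 \<mu> \<nu>)\<^sup>2 + e"
proof -
  let ?I = "INF \<gamma>\<in>couplings \<mu> \<nu>. \<integral>\<^sup>+z. ennreal ((norm (fst z - snd z))\<^sup>2) \<partial>\<gamma>"
  have "?I = ennreal ((W2 \<mu> \<nu>)\<^sup>2)"
    using transport_cost_finite[OF \<mu> \<nu>] by (simp add: W2_def)
  also have "\<dots> < ennreal ((W2 \<mu> \<nu>)\<^sup>2 + e)" using e by (simp add: ennreal_less_iff)
  finally obtain \<gamma> where \<gamma>: "\<gamma> \<in> couplings \<mu> \<nu>"
    "(\<integral>\<^sup>+z. ennreal ((norm (fst z - snd z))\<^sup>2) \<partial>\<gamma>) < ennreal ((W2 \<mu> \<nu>)\<^sup>2 + e)"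
    unfolding INF_less_iff by blast
  note m = coupling_measurable[OF \<mu> \<nu> \<gamma>(1)]
  have id: "(\<lambda>z. z) \<in> borel_measurable \<gamma>"
    using borel_measurable_Pair[OF m(3,4)] by simp
  let ?\<gamma>' = "distr \<gamma> borel (\<lambda>z. z)"
  have pf: "fst \<in> borel_measurable (borel :: ('a \<times> 'a) measure)" "snd \<in> borel_measurable (borel :: ('a \<times> 'a) measure)"
    by (intro borel_measurable_continuous_onI continuous_intros)+
  have "distr ?\<gamma>' borel fst = distr (distr \<gamma> \<mu> fst) borel (\<lambda>x. x)"
    by (simp add: distr_distr[OF pf(1) id] distr_distr[OF P2_D(4)[OF \<mu>] m(1)] comp_def)
  moreover have "distr ?\<gamma>' borel snd = distr (distr \<gamma> \<nu> snd) borel (\<lambda>x. x)"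
    by (simp add: distr_distr[OF pf(2) id] distr_distr[OF P2_D(4)[OF \<nu>] m(2)] comp_def)
  moreover have cm: "(\<lambda>z::'a \<times> 'a. (norm (fst z - snd z))\<^sup>2) \<in> borel_measurable borel"
    using pf by measurable
  have nn: "(\<integral>\<^sup>+z. ennreal ((norm (fst z - snd z))\<^sup>2) \<partial>?\<gamma>') < ennreal ((W2 \<mu> \<nu>)\<^sup>2 + e)"
    using \<gamma>(2) cm by (subst nn_integral_distr[OF id]) auto
  then have int: "integrable ?\<gamma>' (\<lambda>z. (norm (fst z - snd z))\<^sup>2)"
    using cm by (subst integrable_iff_bounded) (auto intro: less_trans simp: ennreal_less_top)
  moreover have "(\<integral>z. (norm (fst z - snd z))\<^sup>2 \<partial>?\<gamma>') \<le> (W2 \<mu> \<nu>)\<^sup>2 + e"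
    using nn e unfolding nn_integral_eq_integral[OF int, simplified]
    by (subst (asm) ennreal_less_iff) auto
  ultimately show ?thesis using \<gamma>(1) that[of ?\<gamma>'] by (simp add: couplings_def)
qed

section \<open>Reachability along \<open>AC\<^sup>2\<close> curves\<close>

text \<open>The Cauchy-Schwarz inequality, from the nonnegativity of the variance of \<open>m\<close> on \<open>[s, t]\<close>.\<close>
lemma square_window_integral_le:
  fixes m :: "real \<Rightarrow> real"
  assumes "s \<le> t" "set_integrable lborel {s..t} m" "set_integrable lborel {s..t} (\<lambda>u. (m u)\<^sup>2)"
  shows "(LINT u:{s..t}|lborel. m u)\<^sup>2 \<le> (t - s) * (LINT u:{s..t}|lborel. (m u)\<^sup>2)"
proof (cases "s = t")
  case True
  have "(LINT u:{t..t}|lborel. m u) = 0"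
    unfolding set_lebesgue_integral_def
    by (intro integral_eq_zero_AE eventually_mono[OF AE_lborel_singleton[of t]]) auto
  then show ?thesis using True by simp
next
  case False
  then have st: "s < t" using assms(1) by simp
  define J where "J = (LINT u:{s..t}|lborel. m u)"
  define K where "K = (LINT u:{s..t}|lborel. (m u)\<^sup>2)"
  define c where "c = J / (t - s)"
  have one: "set_integrable lborel {s..t} (\<lambda>u. 1::real)"
    unfolding set_integrable_def by (simp add: emeasure_lborel_Icc_eq)
  have "0 \<le> (LINT u:{s..t}|lborel. (m u - c)\<^sup>2)"
    unfolding set_lebesgue_integral_def by (intro integral_nonneg_AE) auto
  also have "\<dots> = (LINT u:{s..t}|lborel. ((m u)\<^sup>2 - (2 * c) * m u) + c\<^sup>2 * 1)"
    by (intro arg_cong[where f="\<lambda>f. set_lebesgue_integral lborel {s..t} f"]) (auto simp: power2_diff)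
  also have "\<dots> = (K - 2 * c * J) + c\<^sup>2 * (LINT u:{s..t}|lborel. 1)"
  proof -
    have m1: "set_integrable lborel {s..t} (\<lambda>u. (2 * c) * m u)"
      and m2: "set_integrable lborel {s..t} (\<lambda>u. c\<^sup>2 * (1::real))"
      by (rule set_integrable_mult_right, rule assms(2) one)+
    show ?thesis
      unfolding set_integral_add(2)[OF set_integral_diff(1)[OF assms(3) m1] m2]
        set_integral_diff(2)[OF assms(3) m1] set_integral_mult_right K_def J_def ..
  qed
  also have "(LINT u:{s..t}|lborel. 1) = t - s"
    using st by (simp add: set_lebesgue_integral_def)
  finally have "0 \<le> (t - s) * (K - 2 * c * J + c\<^sup>2 * (t - s))" using st by simp
  also have "\<dots> = (t - s) * K - 2 * (c * (t - s)) * J + (c * (t - s))\<^sup>2"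
    by (simp add: power2_eq_square algebra_simps)
  also have "\<dots> = (t - s) * K - J\<^sup>2" using st by (simp add: c_def power2_eq_square)
  finally show ?thesis by (simp add: J_def K_def)
qed

lemma square_set_integrable_Icc:
  fixes m :: "real \<Rightarrow> real"
  assumes m: "set_borel_measurable lborel {a..b} m" and m2: "set_integrable lborel {a..b} (\<lambda>u. (m u)\<^sup>2)"
  shows "set_integrable lborel {a..b} m"
proof -
  have one: "set_integrable lborel {a..b} (\<lambda>u. 1::real)"
    unfolding set_integrable_def by (simp add: emeasure_lborel_Icc_eq)
  show ?thesis
    unfolding set_integrable_def
  proof (rule Bochner_Integration.integrable_bound)
    show "integrable lborel (\<lambda>u. indicator {a..b} u *\<^sub>R (1::real) + indicator {a..b} u *\<^sub>R (m u)\<^sup>2)"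
      using one m2 unfolding set_integrable_def by (rule Bochner_Integration.integrable_add)
    show "(\<lambda>u. indicator {a..b} u *\<^sub>R m u) \<in> borel_measurable lborel"
      using m by (simp add: set_borel_measurable_def)
    have "\<bar>x\<bar> \<le> 1 + x\<^sup>2" for x :: real
      using sum_squares_bound[of 1 "\<bar>x\<bar>"] abs_ge_zero[of x] unfolding power_one mult_1_right power2_abs by linarith
    then show "AE u in lborel. norm (indicator {a..b} u *\<^sub>R m u)
        \<le> norm (indicator {a..b} u *\<^sub>R (1::real) + indicator {a..b} u *\<^sub>R (m u)\<^sup>2)"
      by (intro AE_I2) (auto simp: indicator_def)
  qed
qed

lemma AC_curve_P2: "AC_curve p E I \<mu> \<Longrightarrow> t \<in> I \<Longrightarrow> \<mu> t \<in> P2 E"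
  by (simp add: AC_curve_def)

lemma AC2_curve_action:
  assumes "AC_curve 2 E {a..b} \<mu>"
  obtains q where "\<And>u. 0 \<le> q u" "integrable lborel q"
    "\<And>s t. s \<in> {a..b} \<Longrightarrow> t \<in> {a..b} \<Longrightarrow> s \<le> t \<Longrightarrow>
      (W2 (\<mu> s) (\<mu> t))\<^sup>2 \<le> (t - s) * (LINT u:{s..t}|lborel. q u)"
proof -
  obtain m where m: "set_borel_measurable lborel {a..b} m"
    "set_integrable lborel {a..b} (\<lambda>u. \<bar>m u\<bar> ^ 2)"
    "\<And>s t. s \<in> {a..b} \<Longrightarrow> t \<in> {a..b} \<Longrightarrow> s \<le> t \<Longrightarrow> W2 (\<mu> s) (\<mu> t) \<le> (LINT u:{s..t}|lborel. m u)"
    using assms unfolding AC_curve_def by blast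
  have m2: "set_integrable lborel {a..b} (\<lambda>u. (m u)\<^sup>2)" using m(2) by simp
  have m1: "set_integrable lborel {a..b} m" by (rule square_set_integrable_Icc[OF m(1) m2])
  define q where "q u = indicator {a..b} u *\<^sub>R (m u)\<^sup>2" for u
  show ?thesis
  proof (rule that[of q])
    show "0 \<le> q u" for u by (simp add: q_def)
    show "integrable lborel q" using m2 unfolding q_def[abs_def] set_integrable_def .
    fix s t assume st: "s \<in> {a..b}" "t \<in> {a..b}" "s \<le> t"
    then have sub: "{s..t} \<subseteq> {a..b}" by auto
    have "(W2 (\<mu> s) (\<mu> t))\<^sup>2 \<le> (LINT u:{s..t}|lborel. m u)\<^sup>2"
      using m(3)[OF st] W2_nonneg by (rule power_mono)
    also have "\<dots> \<le> (t - s) * (LINT u:{s..t}|lborel. (m u)\<^sup>2)"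
      using st(3) m1 m2 sub by (intro square_window_integral_le set_integrable_subset[of _ "{a..b}" _ "{s..t}"]) auto
    also have "(LINT u:{s..t}|lborel. (m u)\<^sup>2) = (LINT u:{s..t}|lborel. q u)"
      using sub by (intro set_lebesgue_integral_cong) (auto simp: q_def)
    finally show "(W2 (\<mu> s) (\<mu> t))\<^sup>2 \<le> (t - s) * (LINT u:{s..t}|lborel. q u)" .
  qed
qed

lemma AC2_curve_continuous:
  assumes "AC_curve 2 E {a..b} \<mu>"
  shows "continuous_curve E {a..b} \<mu>"
  unfolding continuous_curve_def
proof (intro ballI conjI)
  fix t assume t: "t \<in> {a..b}"
  show "\<mu> t \<in> P2 E" by (rule AC_curve_P2[OF assms t])
  obtain q where q: "\<And>u. 0 \<le> q u" "integrable lborel q"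
    "\<And>s t. s \<in> {a..b} \<Longrightarrow> t \<in> {a..b} \<Longrightarrow> s \<le> t \<Longrightarrow>
      (W2 (\<mu> s) (\<mu> t))\<^sup>2 \<le> (t - s) * (LINT u:{s..t}|lborel. q u)"
    using AC2_curve_action[OF assms] by blast
  define Q where "Q = (\<integral>u. q u \<partial>lborel)"
  have win: "(LINT u:{s..r}|lborel. q u) \<le> Q" for s r
    unfolding set_lebesgue_integral_def Q_def
    using q(2) integrable_mult_indicator[OF _ q(2), of "{s..r}"] q(1)
    by (intro integral_mono) (auto simp: indicator_def)
  have bound: "W2 (\<mu> s) (\<mu> t) \<le> sqrt (\<bar>t - s\<bar> * Q)" if s: "s \<in> {a..b}" for s
  proof (rule real_le_rsqrt, cases "s \<le> t")
    case True
    have "(W2 (\<mu> s) (\<mu> t))\<^sup>2 \<le> (t - s) * (LINT u:{s..t}|lborel. q u)" by (rule q(3)[OF s t True])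
    also have "\<dots> \<le> (t - s) * Q" using True win by (intro mult_left_mono) auto
    finally show "(W2 (\<mu> s) (\<mu> t))\<^sup>2 \<le> \<bar>t - s\<bar> * Q" using True by simp
  next
    case False
    then have "(W2 (\<mu> t) (\<mu> s))\<^sup>2 \<le> (s - t) * (LINT u:{t..s}|lborel. q u)" by (intro q(3) s t) simp
    also have "\<dots> \<le> (s - t) * Q" using False win by (intro mult_left_mono) auto
    finally show "(W2 (\<mu> s) (\<mu> t))\<^sup>2 \<le> \<bar>t - s\<bar> * Q"
      using False W2_sym[OF AC_curve_P2[OF assms s] AC_curve_P2[OF assms t]] by simp
  qed
  have "((\<lambda>s. sqrt (\<bar>t - s\<bar> * Q)) \<longlongrightarrow> sqrt (\<bar>t - t\<bar> * Q)) (at t within {a..b})"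
    by (intro tendsto_intros)
  then have lim: "((\<lambda>s. sqrt (\<bar>t - s\<bar> * Q)) \<longlongrightarrow> 0) (at t within {a..b})" by simp
  show "((\<lambda>s. W2 (\<mu> s) (\<mu> t)) \<longlongrightarrow> 0) (at t within {a..b})"
    by (rule real_tendsto_sandwich[OF _ _ tendsto_const lim])
      (auto simp: eventually_at_filter W2_nonneg bound)
qed

text \<open>The curve is extended to all times by freezing it outside \<open>[0, T]\<close>; this does not add to the action,
  so the velocity field of the extended curve can be used.\<close>
theorem AC2_curve_reachable:
  fixes \<mu> :: "real \<Rightarrow> 'a::euclidean_space measure"
  assumes AC: "AC_curve 2 E {0..T} \<mu>" and T: "T > 0"
  shows "\<mu> T \<in> reachable E T (\<mu> 0)"
proof -
  define cl where "cl t = max 0 (min T t)" for t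
  have cl: "cl t \<in> {0..T}" for t using T by (auto simp: cl_def)
  define \<nu> where "\<nu> t = distr (\<mu> (cl t)) borel (\<lambda>x. x)" for t
  note P = AC_curve_P2[OF AC cl]
  obtain q where q: "\<And>u. 0 \<le> q u" "integrable lborel q"
    "\<And>s t. s \<in> {0..T} \<Longrightarrow> t \<in> {0..T} \<Longrightarrow> s \<le> t \<Longrightarrow>
      (W2 (\<mu> s) (\<mu> t))\<^sup>2 \<le> (t - s) * (LINT u:{s..t}|lborel. q u)"
    using AC2_curve_action[OF AC] by blast
  have win0: "0 \<le> (LINT u:{s..r}|lborel. q u)" for s r
    unfolding set_lebesgue_integral_def using q(1) by (intro integral_nonneg_AE) auto
  interpret finite_action_curve \<nu> q
  proof (rule finite_action_curve.intro)
    show "prob_space (\<nu> t)" for t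
      unfolding \<nu>_def by (intro prob_space.prob_space_distr P2_D[OF P])
    show "sets (\<nu> t) = sets borel" for t by (simp add: \<nu>_def)
    show "0 \<le> q t" for t by (rule q(1))
    show "integrable lborel q" by (rule q(2))
    fix s t e :: real assume st: "s \<le> t" and e: "0 < e"
    obtain \<gamma> where \<gamma>: "sets \<gamma> = sets (borel :: ('a \<times> 'a) measure)"
      "distr \<gamma> borel fst = \<nu> s" "distr \<gamma> borel snd = \<nu> t" "integrable \<gamma> (\<lambda>z. (norm (fst z - snd z))\<^sup>2)"
      "(\<integral>z. (norm (fst z - snd z))\<^sup>2 \<partial>\<gamma>) \<le> (W2 (\<mu> (cl s)) (\<mu> (cl t)))\<^sup>2 + e"
      unfolding \<nu>_def using almost_optimal_borel_coupling[OF P P e] by blast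
    have "(W2 (\<mu> (cl s)) (\<mu> (cl t)))\<^sup>2 \<le> (cl t - cl s) * (LINT u:{cl s..cl t}|lborel. q u)"
      using st by (intro q(3) cl) (auto simp: cl_def)
    also have "\<dots> \<le> (t - s) * (LINT u:{s..t}|lborel. q u)"
    proof (cases "cl s = cl t")
      case True
      then show ?thesis using st win0 by simp
    next
      case False
      then have "s \<le> cl s" "cl t \<le> t" "cl s \<le> cl t" using st T by (auto simp: cl_def)
      moreover have "(LINT u:{cl s..cl t}|lborel. q u) \<le> (LINT u:{s..t}|lborel. q u)"
        unfolding set_lebesgue_integral_def
        using calculation q(1) integrable_mult_indicator[OF _ q(2), of "{cl s..cl t}"]
          integrable_mult_indicator[OF _ q(2), of "{s..t}"]
        by (intro integral_mono) (auto simp: indicator_def)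
      ultimately show ?thesis using win0 by (intro mult_mono) auto
    qed
    finally show "\<exists>\<gamma>. sets \<gamma> = sets (borel :: ('a \<times> 'a) measure) \<and> distr \<gamma> borel fst = \<nu> s \<and>
        distr \<gamma> borel snd = \<nu> t \<and> integrable \<gamma> (\<lambda>z. (norm (fst z - snd z))\<^sup>2) \<and>
        (\<integral>z. (norm (fst z - snd z))\<^sup>2 \<partial>\<gamma>) \<le> (t - s) * (LINT u:{s..t}|lborel. q u) + e"
      using \<gamma> by (intro exI[of _ \<gamma>]) auto
  qed
  obtain \<alpha> :: "real \<times> 'a \<Rightarrow> 'a" where \<alpha>: "\<alpha> \<in> borel_measurable borel"
    "\<And>a b. (\<integral>\<^sup>+t\<in>{a..b}. (\<integral>\<^sup>+x. ennreal (norm (\<alpha> (t, x))) \<partial>\<nu> t) \<partial>lborel) < \<infinity>"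
    "\<And>\<phi>. \<phi> \<in> test_functions ({0<..<T} \<times> UNIV) \<Longrightarrow>
      (LINT t:{0..T}|lborel. (\<integral>x. frechet_derivative \<phi> (at (t, x)) (1, \<alpha> (t, x)) \<partial>\<nu> t)) = 0"
    using velocity_field[OF T] by blast
  have slice: "(\<lambda>x. f (t, x)) \<in> borel_measurable borel" if "f \<in> borel_measurable borel"
    for t and f :: "real \<times> 'a \<Rightarrow> 'b::topological_space"
    by (rule measurable_compose[OF _ that]) (intro borel_measurable_continuous_onI continuous_intros)
  have \<nu>: "\<nu> t = distr (\<mu> t) borel (\<lambda>x. x)" if "t \<in> {0..T}" for t
    using that by (simp add: \<nu>_def cl_def)
  have id: "(\<lambda>x. x) \<in> borel_measurable (\<mu> t)" if "t \<in> {0..T}" for t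
    by (rule P2_D(4)[OF AC_curve_P2[OF AC that]])
  have "continuity_equation E {0..T} \<mu> (\<lambda>t x. \<alpha> (t, x))"
    unfolding continuity_equation_def
  proof (intro conjI allI impI ballI)
    show "continuous_curve E {0..T} \<mu>" by (rule AC2_curve_continuous[OF AC])
    show "(\<lambda>(t, x). \<alpha> (t, x)) \<in> borel_measurable (restrict_space borel ({0..T} \<times> E))"
      using \<alpha>(1) by (intro measurable_restrict_space1) simp
  next
    fix a b :: real assume ab: "{a..b} \<subseteq> {0..T}"
    have "(\<integral>\<^sup>+t\<in>{a..b}. (\<integral>\<^sup>+x. ennreal (norm (\<alpha> (t, x))) \<partial>\<mu> t) \<partial>lborel)
        = (\<integral>\<^sup>+t\<in>{a..b}. (\<integral>\<^sup>+x. ennreal (norm (\<alpha> (t, x))) \<partial>\<nu> t) \<partial>lborel)"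
    proof (rule nn_integral_cong)
      fix t
      show "(\<integral>\<^sup>+x. ennreal (norm (\<alpha> (t, x))) \<partial>\<mu> t) * indicator {a..b} t
          = (\<integral>\<^sup>+x. ennreal (norm (\<alpha> (t, x))) \<partial>\<nu> t) * indicator {a..b} t"
      proof (cases "t \<in> {a..b}")
        case True
        then have t: "t \<in> {0..T}" using ab by auto
        show ?thesis unfolding \<nu>[OF t] using slice[OF \<alpha>(1)]
          by (subst nn_integral_distr[OF id[OF t]]) auto
      qed simp
    qed
    then show "(\<integral>\<^sup>+t\<in>{a..b}. (\<integral>\<^sup>+x. ennreal (norm (\<alpha> (t, x))) \<partial>\<mu> t) \<partial>lborel) < \<infinity>"
      using \<alpha>(2) by simp
  next
    fix \<phi> :: "real \<times> 'a \<Rightarrow> real" assume "\<phi> \<in> test_functions (interior {0..T} \<times> UNIV)"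
    then have \<phi>: "\<phi> \<in> test_functions ({0<..<T} \<times> UNIV)" by simp
    have m: "(\<lambda>z. frechet_derivative \<phi> (at z) (1, \<alpha> z)) \<in> borel_measurable borel"
    proof -
      note [measurable] = \<alpha>(1) borel_measurable_space_gradient[OF \<phi>]
        borel_measurable_test_function[OF time_derivative_test_function[OF \<phi>]]
      show ?thesis unfolding frechet_derivative_spacetime[OF \<phi>] by measurable
    qed
    have "(LINT t:{0..T}|lborel. (\<integral>x. frechet_derivative \<phi> (at (t, x)) (1, \<alpha> (t, x)) \<partial>\<mu> t))
        = (LINT t:{0..T}|lborel. (\<integral>x. frechet_derivative \<phi> (at (t, x)) (1, \<alpha> (t, x)) \<partial>\<nu> t))"
      using slice[OF m] by (intro set_lebesgue_integral_cong) (auto simp: \<nu> integral_distr[OF id])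
    then show "(LINT t:{0..T}|lborel. (\<integral>x. frechet_derivative \<phi> (at (t, x)) (1, \<alpha> (t, x)) \<partial>\<mu> t)) = 0"
      using \<alpha>(3)[OF \<phi>] by simp
  qed
  moreover have "\<mu> T \<in> P2 E" using T by (intro AC_curve_P2[OF AC]) simp
  ultimately show ?thesis unfolding reachable_def by blast
qed

section \<open>Integrating the dissipation\<close>

text \<open>After a translation the integral of the increments telescopes: only the pieces over \<open>(T, T + h]\<close>
  and \<open>[0, h)\<close> remain, where monotonicity bounds \<open>w\<close> by \<open>w (T + h)\<close> and \<open>w 0\<close>.\<close>
lemma mono_increment_integral:
  fixes w :: "real \<Rightarrow> real"
  assumes w: "mono w" and h: "0 \<le> h" and T: "0 \<le> T"
  shows "set_integrable lborel {0..T} (\<lambda>t. w (t + h) - w t)"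
    and "(LINT t:{0..T}|lborel. w (t + h) - w t) \<le> h * (w (T + h) - w 0)"
proof -
  have [measurable]: "w \<in> borel_measurable borel" by (rule borel_measurable_mono[OF w])
  have int: "integrable lborel (\<lambda>t. indicator {a..b} t *\<^sub>R w (t + k))" for a b k
  proof (rule Bochner_Integration.integrable_bound)
    define B where "B = max \<bar>w (a + k)\<bar> \<bar>w (b + k)\<bar>"
    show "integrable lborel (\<lambda>t. indicator {a..b} t *\<^sub>R B)"
      by (rule integrable_indicator) (auto simp: emeasure_lborel_Icc_eq)
    have "\<bar>w (t + k)\<bar> \<le> B" if "t \<in> {a..b}" for t
    proof -
      have "w (a + k) \<le> w (t + k)" "w (t + k) \<le> w (b + k)" using that by (auto intro: monoD[OF w])
      then show ?thesis by (auto simp: B_def)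
    qed
    then show "AE t in lborel. norm (indicator {a..b} t *\<^sub>R w (t + k)) \<le> norm (indicator {a..b} t *\<^sub>R B)"
      by (intro AE_I2) (auto simp: indicator_def intro: order_trans[OF _ abs_ge_self])
  qed measurable
  have int0: "integrable lborel (\<lambda>t. indicator {a..b} t *\<^sub>R w t)" for a b
    using int[of a b 0] by simp
  show "set_integrable lborel {0..T} (\<lambda>t. w (t + h) - w t)"
    unfolding set_integrable_def scaleR_diff_right
    by (intro Bochner_Integration.integrable_diff int int0)
  have shift: "(\<integral>t. indicator {0..T} t *\<^sub>R w (t + h) \<partial>lborel) = (\<integral>t. indicator {h..T + h} t *\<^sub>R w t \<partial>lborel)"
  proof -
    have "(\<integral>t. indicator {0..T} t *\<^sub>R w (t + h) \<partial>lborel) = (\<integral>t. indicator {0..T} (t - h) *\<^sub>R w t \<partial>lborel)"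
      using lborel_integral_real_affine[of 1 "\<lambda>t. indicator {0..T} t *\<^sub>R w (t + h)" "- h"] by simp
    also have "\<dots> = (\<integral>t. indicator {h..T + h} t *\<^sub>R w t \<partial>lborel)"
      by (intro Bochner_Integration.integral_cong) (auto simp: indicator_def)
    finally show ?thesis .
  qed
  have i1: "integrable lborel (\<lambda>t. indicator {T<..T + h} t *\<^sub>R w (T + h))"
    by (rule integrable_indicator) (use h in auto)
  have i2: "integrable lborel (\<lambda>t. indicator {0..<h} t *\<^sub>R w 0)"
    by (rule integrable_indicator) (use h in auto)
  have "(LINT t:{0..T}|lborel. w (t + h) - w t)
      = (\<integral>t. indicator {h..T + h} t *\<^sub>R w t - indicator {0..T} t *\<^sub>R w t \<partial>lborel)"
    unfolding set_lebesgue_integral_def scaleR_diff_right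
    using int int0 shift by simp
  also have "\<dots> \<le> (\<integral>t. indicator {T<..T + h} t *\<^sub>R w (T + h) - indicator {0..<h} t *\<^sub>R w 0 \<partial>lborel)"
  proof (rule integral_mono)
    fix t
    have "w t \<le> w (T + h)" if "t \<le> T + h" using that by (rule monoD[OF w])
    moreover have "w 0 \<le> w t" if "0 \<le> t" using that by (rule monoD[OF w])
    ultimately show "indicator {h..T + h} t *\<^sub>R w t - indicator {0..T} t *\<^sub>R w t
        \<le> indicator {T<..T + h} t *\<^sub>R w (T + h) - indicator {0..<h} t *\<^sub>R w 0"
      using h T by (auto simp: indicator_def split: if_splits)
  qed (use int0 i1 i2 in auto)
  also have "\<dots> = h * (w (T + h) - w 0)"
    using i1 i2 h by (simp add: algebra_simps)
  finally show "(LINT t:{0..T}|lborel. w (t + h) - w t) \<le> h * (w (T + h) - w 0)" .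
qed

lemma small_window_integral_tendsto_0:
  fixes g :: "real \<Rightarrow> real"
  assumes "integrable lborel g"
  shows "(\<lambda>n. LINT u:{T..T + 1 / real (Suc n)}|lborel. g u) \<longlonglongrightarrow> 0"
proof -
  have [measurable]: "g \<in> borel_measurable borel" using assms by simp
  have "(\<lambda>n. \<integral>u. indicator {T..T + 1 / real (Suc n)} u *\<^sub>R g u \<partial>lborel) \<longlonglongrightarrow> (\<integral>u. 0 \<partial>(lborel :: real measure))"
  proof (rule integral_dominated_convergence[where w="\<lambda>u. \<bar>g u\<bar>"])
    show "AE u in lborel. (\<lambda>n. indicator {T..T + 1 / real (Suc n)} u *\<^sub>R g u) \<longlonglongrightarrow> 0"
      using AE_lborel_singleton[of T]
    proof eventually_elim
      case (elim u)
      have "eventually (\<lambda>n. indicator {T..T + 1 / real (Suc n)} u *\<^sub>R g u = 0) sequentially"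
      proof (cases "u < T")
        case False
        then have "u - T > 0" using elim by simp
        then have "eventually (\<lambda>n. 1 / real (Suc n) < u - T) sequentially"
          by (rule order_tendstoD(2)[OF LIMSEQ_Suc[OF lim_1_over_n]])
        then show ?thesis by eventually_elim (auto simp: indicator_def)
      qed simp
      then show ?case by (rule tendsto_eventually)
    qed
  qed (use assms in \<open>auto simp: indicator_def\<close>)
  then show ?thesis by (simp add: set_lebesgue_integral_def)
qed

lemma set_integral_split:
  fixes g :: "real \<Rightarrow> real"
  assumes "integrable lborel g" "a \<le> b" "b \<le> c"
  shows "(LINT u:{a..c}|lborel. g u) = (LINT u:{a..b}|lborel. g u) + (LINT u:{b..c}|lborel. g u)"
proof -
  have i: "integrable lborel (\<lambda>u. indicator S u *\<^sub>R g u)" if "S \<in> sets lborel" for S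
    by (rule integrable_mult_indicator[OF that assms(1)])
  have "(LINT u:{a..c}|lborel. g u)
      = (\<integral>u. indicator {a..b} u *\<^sub>R g u + indicator {b..c} u *\<^sub>R g u \<partial>lborel)"
    unfolding set_lebesgue_integral_def
  proof (rule integral_cong_AE)
    show "AE u in lborel. indicator {a..c} u *\<^sub>R g u = indicator {a..b} u *\<^sub>R g u + indicator {b..c} u *\<^sub>R g u"
      using AE_lborel_singleton[of b] by eventually_elim (use assms(2,3) in \<open>auto simp: indicator_def\<close>)
  qed (use assms(1) in measurable)
  also have "\<dots> = (LINT u:{a..b}|lborel. g u) + (LINT u:{b..c}|lborel. g u)"
    unfolding set_lebesgue_integral_def using i by simp
  finally show ?thesis .
qed

text \<open>Let \<open>A\<close> be the indefinite integral of \<open>g\<close>. The function \<open>w = A - u\<close> is nondecreasing, and since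
  \<open>|u (t + h) - u t| \<le> A (t + h) - A t\<close> its difference quotients are at least \<open>-2 (u (t + h) - u t) / h\<close>,
  which tends to \<open>2 g t\<close> almost everywhere. So Fatou's lemma gives
  \<open>2 A T \<le> w T - w 0 = A T + u 0 - u T\<close>.\<close>
proposition dissipation_integral_le:
  fixes u g :: "real \<Rightarrow> real"
  assumes T: "0 \<le> T" "T < b"
    and g: "integrable lborel g" "\<And>t. 0 \<le> g t"
    and u: "\<And>s t. 0 \<le> s \<Longrightarrow> s \<le> t \<Longrightarrow> t \<le> b \<Longrightarrow> \<bar>u t - u s\<bar> \<le> (LINT r:{s..t}|lborel. g r)"
    and u': "AE t in lborel. 0 < t \<and> t < b \<longrightarrow> (u has_real_derivative - g t) (at t)"
  shows "(LINT r:{0..T}|lborel. g r) \<le> u 0 - u T"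
proof -
  define A where "A t = (LINT r:{0..t}|lborel. g r)" for t
  have A: "A t - A s = (LINT r:{s..t}|lborel. g r)" if "0 \<le> s" "s \<le> t" for s t
    unfolding A_def using set_integral_split[OF g(1) that] by simp
  \<comment> \<open>Freezing \<open>A - u\<close> outside \<open>[0, b]\<close> makes it monotone on the whole line.\<close>
  define cl where "cl t = max 0 (min b t)" for t
  define w where "w t = A (cl t) - u (cl t)" for t
  have w_eq: "w t = A t - u t" if "0 \<le> t" "t \<le> b" for t using that by (simp add: w_def cl_def)
  have cl: "0 \<le> cl t" "cl t \<le> b" for t using T by (auto simp: cl_def)
  have mono: "mono w"
  proof (rule monoI)
    fix s t :: real assume st: "s \<le> t"
    then have "cl s \<le> cl t" by (auto simp: cl_def)
    then have "\<bar>u (cl t) - u (cl s)\<bar> \<le> A (cl t) - A (cl s)"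
      using A[of "cl s" "cl t"] u[of "cl s" "cl t"] cl by simp
    then show "w s \<le> w t" unfolding w_def by linarith
  qed
  define h where "h n = 1 / real (Suc n)" for n
  have h0: "h n > 0" for n by (simp add: h_def)
  have hlim: "h \<longlonglongrightarrow> 0" unfolding h_def[abs_def] by (rule LIMSEQ_Suc[OF lim_1_over_n])
  define D where "D n t = (w (t + h n) - w t) / h n" for n t
  have wm[measurable]: "w \<in> borel_measurable borel" by (rule borel_measurable_mono[OF mono])
  have D0: "0 \<le> D n t" for n t
    unfolding D_def using h0[of n] monoD[OF mono, of t "t + h n"] by simp
  have Dint: "(\<integral>\<^sup>+t\<in>{0..T}. ennreal (D n t) \<partial>lborel) \<le> ennreal (w (T + h n) - w 0)" for n
  proof -
    note m = mono_increment_integral[OF mono less_imp_le[OF h0[of n]] T(1)]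
    have i: "set_integrable lborel {0..T} (D n)"
      unfolding D_def[abs_def] by (rule set_integrable_divide) (use m(1) in simp)
    have "(\<integral>\<^sup>+t\<in>{0..T}. ennreal (D n t) \<partial>lborel) = (\<integral>\<^sup>+t. ennreal (indicator {0..T} t *\<^sub>R D n t) \<partial>lborel)"
      by (intro nn_integral_cong) (auto simp: indicator_def)
    also have "\<dots> = ennreal (LINT t:{0..T}|lborel. D n t)"
      unfolding set_lebesgue_integral_def using i D0
      by (intro nn_integral_eq_integral) (auto simp: set_integrable_def)
    also have "(LINT t:{0..T}|lborel. D n t) = (LINT t:{0..T}|lborel. w (t + h n) - w t) / h n"
      unfolding D_def by simp
    also have "\<dots> \<le> w (T + h n) - w 0"
      using m(2) h0[of n] by (simp add: field_simps)
    finally show ?thesis by (simp add: ennreal_leI)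
  qed
  have lower: "AE t in lborel. t \<in> {0..T} \<longrightarrow> ennreal (2 * g t) \<le> liminf (\<lambda>n. ennreal (D n t))"
    using u' AE_lborel_singleton[of 0]
  proof (eventually_elim, intro impI)
    fix t assume t: "t \<noteq> 0" "t \<in> {0..T}" and "0 < t \<and> t < b \<longrightarrow> (u has_real_derivative - g t) (at t)"
    then have der: "(u has_real_derivative - g t) (at t)" using T by auto
    have "(\<lambda>n. (u (t + h n) - u t) / h n) \<longlonglongrightarrow> - g t"
    proof (rule filterlim_compose[OF der[unfolded DERIV_def]])
      show "filterlim h (at 0) sequentially"
        unfolding filterlim_at using hlim h0 by (auto simp: less_imp_neq[THEN not_sym])
    qed
    then have lim: "(\<lambda>n. ennreal (- 2 * ((u (t + h n) - u t) / h n))) \<longlonglongrightarrow> ennreal (- 2 * (- g t))"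
      by (intro tendsto_ennrealI tendsto_mult tendsto_const)
    have "eventually (\<lambda>n. h n < b - t) sequentially"
      using t T by (intro order_tendstoD(2)[OF hlim]) auto
    then have ev: "eventually (\<lambda>n. ennreal (- 2 * ((u (t + h n) - u t) / h n)) \<le> ennreal (D n t)) sequentially"
    proof eventually_elim
      case (elim n)
      have "\<bar>u (t + h n) - u t\<bar> \<le> A (t + h n) - A t"
        using elim t h0[of n] A[of t "t + h n"] u[of t "t + h n"] by simp
      then have "- 2 * (u (t + h n) - u t) \<le> w (t + h n) - w t"
        using elim t h0[of n] by (simp add: w_eq)
      then have "- 2 * (u (t + h n) - u t) / h n \<le> D n t"
        unfolding D_def using h0[of n] by (intro divide_right_mono) auto
      then show ?case by (intro ennreal_leI) simp
    qed
    have "ennreal (2 * g t) = liminf (\<lambda>n. ennreal (- 2 * ((u (t + h n) - u t) / h n)))"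
      using lim_imp_Liminf[OF _ lim] by simp
    also have "\<dots> \<le> liminf (\<lambda>n. ennreal (D n t))" by (rule Liminf_mono[OF ev])
    finally show "ennreal (2 * g t) \<le> liminf (\<lambda>n. ennreal (D n t))" .
  qed
  have gm[measurable]: "g \<in> borel_measurable borel" using g(1) by simp
  have gi: "integrable lborel (\<lambda>t. indicator {0..T} t *\<^sub>R g t)"
    by (intro integrable_mult_indicator g(1)) simp
  have A0: "0 \<le> A t" for t
    unfolding A_def set_lebesgue_integral_def using g(2) by (intro integral_nonneg_AE) auto
  have "ennreal (2 * A T) = (\<integral>\<^sup>+t. ennreal (2 * (indicator {0..T} t *\<^sub>R g t)) \<partial>lborel)"
    unfolding A_def set_lebesgue_integral_def
    using gi g(2) by (subst nn_integral_eq_integral) auto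
  also have "\<dots> \<le> (\<integral>\<^sup>+t. liminf (\<lambda>n. ennreal (D n t) * indicator {0..T} t) \<partial>lborel)"
    by (rule nn_integral_mono_AE, use lower in eventually_elim) (auto simp: indicator_def Liminf_const)
  also have "\<dots> \<le> liminf (\<lambda>n. \<integral>\<^sup>+t\<in>{0..T}. ennreal (D n t) \<partial>lborel)"
    unfolding D_def by (rule nn_integral_liminf) measurable
  also have "\<dots> \<le> liminf (\<lambda>n. ennreal (w (T + h n) - w 0))"
    by (intro Liminf_mono always_eventually allI Dint)
  also have "\<dots> = ennreal (w T - w 0)"
  proof (rule lim_imp_Liminf[OF _ tendsto_ennrealI])
    have ev: "eventually (\<lambda>n. \<bar>w (T + h n) - w T\<bar> \<le> 2 * (LINT r:{T..T + h n}|lborel. g r)) sequentially"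
    proof -
      have "eventually (\<lambda>n. h n < b - T) sequentially"
        using T by (intro order_tendstoD(2)[OF hlim]) auto
      then show ?thesis
      proof eventually_elim
        case (elim n)
        have e: "A (T + h n) - A T = (LINT r:{T..T + h n}|lborel. g r)"
          using T h0[of n] by (intro A) auto
        have "\<bar>u (T + h n) - u T\<bar> \<le> (LINT r:{T..T + h n}|lborel. g r)"
          using elim T h0[of n] by (intro u) auto
        moreover have "0 \<le> (LINT r:{T..T + h n}|lborel. g r)"
          unfolding set_lebesgue_integral_def using g(2) by (intro integral_nonneg_AE) auto
        ultimately show ?case
          using e elim T h0[of n] by (simp add: w_eq)
      qed
    qed
    have "(\<lambda>n. 2 * (LINT r:{T..T + h n}|lborel. g r)) \<longlonglongrightarrow> 0"
      using tendsto_mult_right_zero[OF small_window_integral_tendsto_0[OF g(1), of T], of 2] by (simp add: h_def)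
    then have "(\<lambda>n. w (T + h n) - w T) \<longlonglongrightarrow> 0"
      by (rule Lim_null_comparison[rotated]) (use ev in simp)
    then show "(\<lambda>n. w (T + h n) - w 0) \<longlonglongrightarrow> w T - w 0"
      by (intro tendsto_diff tendsto_const) (simp add: LIM_zero_iff)
  qed simp
  finally have "2 * A T \<le> w T - w 0"
    using monoD[OF mono, of 0 T] T A0[of T] by (subst (asm) ennreal_le_iff) auto
  moreover have "w T - w 0 = A T - u T + u 0"
  proof -
    have "A 0 = 0" unfolding A_def set_lebesgue_integral_def
      by (intro integral_eq_zero_AE eventually_mono[OF AE_lborel_singleton[of 0]]) auto
    then show ?thesis using T by (simp add: w_eq)
  qed
  ultimately show ?thesis by (simp add: A_def)
qed

text \<open>Where the metric derivative exists, it is the limit along \<open>t - 1 / n\<close>, and its square is at most the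
  lower limit of averages of \<open>q\<close> over \<open>[t - 1 / n, t]\<close>; Fatou's lemma applies. Where the limit does not
  exist, \<open>Lim\<close> is a fixed real number \<open>c\<close> that does not depend on \<open>t\<close>, and a constant is square
  integrable on a bounded interval.\<close>
lemma metric_derivative_square_integrable:
  assumes AC: "AC_curve 2 E {0..b} \<mu>"
  shows "(\<integral>\<^sup>+t\<in>{0<..<b}. ennreal ((metric_derivative {0..} \<mu> t)\<^sup>2) \<partial>lborel) < \<infinity>"
proof -
  obtain q where q: "\<And>u. 0 \<le> q u" "integrable lborel q"
    "\<And>s t. s \<in> {0..b} \<Longrightarrow> t \<in> {0..b} \<Longrightarrow> s \<le> t \<Longrightarrow>
      (W2 (\<mu> s) (\<mu> t))\<^sup>2 \<le> (t - s) * (LINT u:{s..t}|lborel. q u)"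
    using AC2_curve_action[OF AC] by blast
  have [measurable]: "q \<in> borel_measurable borel" using q(2) by simp
  \<comment> \<open>The value of \<open>Lim\<close> when there is no limit.\<close>
  define c where "c = (THE l::real. False)"
  define h where "h n = 1 / real (Suc n)" for n
  have h0: "h n > 0" for n by (simp add: h_def)
  have hlim: "h \<longlonglongrightarrow> 0" unfolding h_def[abs_def] by (rule LIMSEQ_Suc[OF lim_1_over_n])
  define W where "W n t = (\<integral>\<^sup>+u. ennreal (q u) * indicator {t + - h n..t + 0} u \<partial>lborel)" for n t
  have ind: "(indicator {t + - h n..t + 0} u :: ennreal) = (if t + - h n \<le> u \<and> u \<le> t + 0 then 1 else 0)" for t u n
    by (auto simp: indicator_def)
  have [measurable]: "W n \<in> borel_measurable borel" for n
    unfolding W_def[abs_def] ind by measurable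
  have W: "W n t = ennreal (LINT u:{t - h n..t}|lborel. q u)" for n t
  proof -
    have "W n t = (\<integral>\<^sup>+u. ennreal (indicator {t - h n..t} u *\<^sub>R q u) \<partial>lborel)"
      unfolding W_def by (intro nn_integral_cong) (auto simp: indicator_def)
    then show ?thesis
      unfolding set_lebesgue_integral_def
      using q(1) integrable_mult_indicator[OF _ q(2), of "{t - h n..t}"]
      by (simp add: nn_integral_eq_integral)
  qed
  have pointwise: "ennreal ((metric_derivative {0..} \<mu> t)\<^sup>2)
      \<le> liminf (\<lambda>n. ennreal (1 / h n) * W n t) + ennreal (c\<^sup>2)" if t: "t \<in> {0<..<b}" for t
  proof (cases "\<exists>l. ((\<lambda>s. W2 (\<mu> s) (\<mu> t) / \<bar>s - t\<bar>) \<longlongrightarrow> l) (at t within {0..})")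
    case False
    then have "metric_derivative {0..} \<mu> t = c"
      by (simp add: metric_derivative_def t2_space_class.Lim_def c_def)
    then show ?thesis by simp
  next
    case True
    then obtain l where l: "((\<lambda>s. W2 (\<mu> s) (\<mu> t) / \<bar>s - t\<bar>) \<longlongrightarrow> l) (at t within {0..})" by blast
    have at: "at t within {0..} = at t" using t by (intro at_within_interior) simp
    have md: "metric_derivative {0..} \<mu> t = l"
      unfolding metric_derivative_def by (intro tendsto_Lim l) (simp add: at)
    have "(\<lambda>n. W2 (\<mu> (t - h n)) (\<mu> t) / \<bar>(t - h n) - t\<bar>) \<longlonglongrightarrow> l"
    proof (rule filterlim_compose[OF l[unfolded at]])
      have "(\<lambda>n. t - h n) \<longlonglongrightarrow> t" using tendsto_diff[OF tendsto_const hlim, of t] by simp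
      then show "filterlim (\<lambda>n. t - h n) (at t) sequentially"
        unfolding filterlim_at using h0 by (auto simp: less_imp_neq[THEN not_sym])
    qed
    then have "(\<lambda>n. ennreal ((W2 (\<mu> (t - h n)) (\<mu> t) / \<bar>(t - h n) - t\<bar>)\<^sup>2)) \<longlonglongrightarrow> ennreal (l\<^sup>2)"
      by (intro tendsto_ennrealI tendsto_power)
    then have "ennreal (l\<^sup>2) = liminf (\<lambda>n. ennreal ((W2 (\<mu> (t - h n)) (\<mu> t) / \<bar>(t - h n) - t\<bar>)\<^sup>2))"
      by (intro lim_imp_Liminf[symmetric]) simp_all
    also have "\<dots> \<le> liminf (\<lambda>n. ennreal (1 / h n) * W n t)"
    proof (rule Liminf_mono)
      have "eventually (\<lambda>n. h n < t) sequentially"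
        using t by (intro order_tendstoD(2)[OF hlim]) auto
      then show "eventually (\<lambda>n. ennreal ((W2 (\<mu> (t - h n)) (\<mu> t) / \<bar>(t - h n) - t\<bar>)\<^sup>2)
          \<le> ennreal (1 / h n) * W n t) sequentially"
      proof eventually_elim
        case (elim n)
        have "(W2 (\<mu> (t - h n)) (\<mu> t))\<^sup>2 \<le> (t - (t - h n)) * (LINT u:{t - h n..t}|lborel. q u)"
          using elim t h0[of n] by (intro q(3)) auto
        then have "(W2 (\<mu> (t - h n)) (\<mu> t) / h n)\<^sup>2 \<le> 1 / h n * (LINT u:{t - h n..t}|lborel. q u)"
          using h0[of n] by (simp add: power_divide power2_eq_square field_simps)
        then have "ennreal ((W2 (\<mu> (t - h n)) (\<mu> t) / h n)\<^sup>2) \<le> ennreal (1 / h n * (LINT u:{t - h n..t}|lborel. q u))"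
          by (rule ennreal_leI)
        also have "\<dots> = ennreal (1 / h n) * W n t"
          unfolding W using h0[of n] by (intro ennreal_mult') simp
        finally show ?case using h0[of n] by simp
      qed
    qed
    finally show ?thesis unfolding md by (rule order_trans) simp
  qed
  have "(\<integral>\<^sup>+t\<in>{0<..<b}. ennreal ((metric_derivative {0..} \<mu> t)\<^sup>2) \<partial>lborel)
      \<le> (\<integral>\<^sup>+t. liminf (\<lambda>n. ennreal (1 / h n) * W n t) + ennreal (c\<^sup>2) * indicator {0<..<b} t \<partial>lborel)"
    using pointwise by (intro nn_integral_mono) (auto simp: indicator_def)
  also have "\<dots> = (\<integral>\<^sup>+t. liminf (\<lambda>n. ennreal (1 / h n) * W n t) \<partial>lborel) + ennreal (c\<^sup>2) * emeasure lborel {0<..<b}"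
    by (subst nn_integral_add) (auto simp: nn_integral_cmult_indicator)
  also have "(\<integral>\<^sup>+t. liminf (\<lambda>n. ennreal (1 / h n) * W n t) \<partial>lborel)
      \<le> liminf (\<lambda>n. \<integral>\<^sup>+t. ennreal (1 / h n) * W n t \<partial>lborel)"
    by (rule nn_integral_liminf) measurable
  also have "(\<lambda>n. \<integral>\<^sup>+t. ennreal (1 / h n) * W n t \<partial>lborel) = (\<lambda>n. \<integral>\<^sup>+u. ennreal (q u) \<partial>lborel)"
  proof
    fix n
    have "(\<integral>\<^sup>+t. ennreal (1 / h n) * W n t \<partial>lborel) = ennreal (1 / h n) * (\<integral>\<^sup>+t. W n t \<partial>lborel)"
      by (rule nn_integral_cmult) simp
    also have "(\<integral>\<^sup>+t. W n t \<partial>lborel) = ennreal (0 - (- h n)) * (\<integral>\<^sup>+u. ennreal (q u) \<partial>lborel)"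
      unfolding W_def using h0[of n] by (intro nn_integral_window) auto
    also have "ennreal (1 / h n) * (ennreal (0 - (- h n)) * (\<integral>\<^sup>+u. ennreal (q u) \<partial>lborel)) = (\<integral>\<^sup>+u. ennreal (q u) \<partial>lborel)"
      using h0[of n] by (simp add: mult.assoc[symmetric] ennreal_mult[symmetric])
    finally show "(\<integral>\<^sup>+t. ennreal (1 / h n) * W n t \<partial>lborel) = (\<integral>\<^sup>+u. ennreal (q u) \<partial>lborel)" .
  qed
  also have "liminf (\<lambda>n::nat. \<integral>\<^sup>+u. ennreal (q u) \<partial>lborel) + ennreal (c\<^sup>2) * emeasure lborel {0<..<b} < \<infinity>"
  proof -
    have "(\<integral>\<^sup>+u. ennreal (q u) \<partial>lborel) < \<infinity>" using q by (simp add: nn_integral_eq_integral)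
    moreover have "emeasure lborel {0<..<b} < \<infinity>" by (cases "0 \<le> b") auto
    ultimately show ?thesis
      by (simp add: Liminf_const ennreal_add_less_top ennreal_mult_less_top)
  qed
  finally show ?thesis by (simp add: add_right_mono)
qed

section \<open>Energy and the value function\<close>

lemma AC2_curve_imp_AC1:
  assumes "AC_curve 2 E {a..b} \<mu>"
  shows "AC_curve 1 E {a..b} \<mu>"
proof -
  obtain m where m: "set_borel_measurable lborel {a..b} m"
    "set_integrable lborel {a..b} (\<lambda>u. \<bar>m u\<bar> ^ 2)"
    "\<And>s t. s \<in> {a..b} \<Longrightarrow> t \<in> {a..b} \<Longrightarrow> s \<le> t \<Longrightarrow> W2 (\<mu> s) (\<mu> t) \<le> (LINT u:{s..t}|lborel. m u)"
    using assms unfolding AC_curve_def by blast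
  have "set_integrable lborel {a..b} (\<lambda>u. (m u)\<^sup>2)" using m(2) by simp
  then have "set_integrable lborel {a..b} m" by (rule square_set_integrable_Icc[OF m(1)])
  then have "set_integrable lborel {a..b} (\<lambda>u. \<bar>m u\<bar> ^ 1)"
    by (simp add: set_integrable_abs)
  then show ?thesis
    using m(1,3) AC_curve_P2[OF assms] unfolding AC_curve_def by (intro conjI exI[of _ m]) auto
qed

lemma strong_upper_gradientD:
  assumes "strong_upper_gradient E \<phi> g" "AC_curve 2 E {a..b} \<eta>"
  shows "(\<lambda>t. g (\<eta> t)) \<in> borel_measurable (restrict_space borel {a..b})"
    and "\<And>s t. s \<in> {a..b} \<Longrightarrow> t \<in> {a..b} \<Longrightarrow> s \<le> t \<Longrightarrow> ennreal \<bar>\<phi> (\<eta> t) - \<phi> (\<eta> s)\<bar>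
       \<le> (\<integral>\<^sup>+r\<in>{s..t}. (g (\<eta> r) * ennreal (metric_derivative {a..b} \<eta> r)) \<partial>lborel)"
proof -
  have "is_interval {a..b} \<and> AC_curve 1 E {a..b} \<eta>"
    using AC2_curve_imp_AC1[OF assms(2)] by (simp add: is_interval_cc)
  note ug = assms(1)[unfolded strong_upper_gradient_def, rule_format, OF this]
  show "(\<lambda>t. g (\<eta> t)) \<in> borel_measurable (restrict_space borel {a..b})" by (rule conjunct1[OF ug])
  show "ennreal \<bar>\<phi> (\<eta> t) - \<phi> (\<eta> s)\<bar>
      \<le> (\<integral>\<^sup>+r\<in>{s..t}. (g (\<eta> r) * ennreal (metric_derivative {a..b} \<eta> r)) \<partial>lborel)"
    if "s \<in> {a..b}" "t \<in> {a..b}" "s \<le> t" for s t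
    using bspec[OF bspec[OF conjunct2[OF ug] that(1)] that(2)] that(3) by (rule mp)
qed

text \<open>If \<open>ell \<ge> c\<close>, the negative part of the discounted cost is at most \<open>\<bar>c\<bar> \<integral>\<^sub>0\<^sup>\<infinity> e\<^sup>-\<^sup>t dt = \<bar>c\<bar>\<close>.\<close>
lemma value_function_finite:
  assumes bdd: "bdd_below (ell ` P2 E)" and le: "v0 E ell \<nu> \<le> ereal (ell \<nu>)"
  shows "v0 E ell \<nu> = ereal (v0_real E ell \<nu>)"
proof -
  obtain c where c: "\<And>\<mu>. \<mu> \<in> P2 E \<Longrightarrow> c \<le> ell \<mu>" using bdd by (auto simp: bdd_below_def)
  have lower: "ereal (- \<bar>c\<bar>) \<le> cost ell \<mu> \<alpha>" if "(\<mu>, \<alpha>) \<in> admissible E \<nu>" for \<mu> \<alpha>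
  proof -
    define f where "f t = exp (- t) * (1 / 2 * (\<integral>x. (norm (\<alpha> t x))\<^sup>2 \<partial>\<mu> t) + ell (\<mu> t))" for t
    have P: "\<mu> t \<in> P2 E" if "t \<in> {0..}" for t
      using \<open>(\<mu>, \<alpha>) \<in> admissible E \<nu>\<close> that
      by (auto simp: admissible_def continuity_equation_def continuous_curve_def)
    have "(\<integral>\<^sup>+t\<in>{0..}. ennreal (- f t) \<partial>lborel) \<le> (\<integral>\<^sup>+t\<in>{0..}. ennreal (\<bar>c\<bar> * exp (- t)) \<partial>lborel)"
    proof (rule nn_integral_mono)
      fix t :: real
      show "ennreal (- f t) * indicator {0..} t \<le> ennreal (\<bar>c\<bar> * exp (- t)) * indicator {0..} t"
      proof (cases "t \<in> {0..}")
        case True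
        have "0 \<le> (\<integral>x. (norm (\<alpha> t x))\<^sup>2 \<partial>\<mu> t)" by (intro integral_nonneg_AE) auto
        then have "- (1 / 2 * (\<integral>x. (norm (\<alpha> t x))\<^sup>2 \<partial>\<mu> t) + ell (\<mu> t)) \<le> \<bar>c\<bar>"
          using c[OF P[OF True]] by linarith
        then have "exp (- t) * - (1 / 2 * (\<integral>x. (norm (\<alpha> t x))\<^sup>2 \<partial>\<mu> t) + ell (\<mu> t)) \<le> exp (- t) * \<bar>c\<bar>"
          by (rule mult_left_mono) simp
        then have "- f t \<le> \<bar>c\<bar> * exp (- t)"
          unfolding f_def mult_minus_right by (simp only: mult.commute)
        then show ?thesis using True by (simp add: ennreal_leI)
      qed simp
    qed
    also have "\<dots> = ennreal (\<bar>c\<bar> * 1)"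
    proof -
      have "((\<lambda>t. - exp (- t)) \<longlongrightarrow> 0) (at_top :: real filter)"
        using tendsto_minus[OF filterlim_compose[OF exp_at_bot filterlim_uminus_at_bot_at_top]] by simp
      from tendsto_mult_right_zero[OF this, of "\<bar>c\<bar>"]
      have "((\<lambda>t. \<bar>c\<bar> * - exp (- t)) \<longlongrightarrow> 0) at_top" .
      then have "(\<integral>\<^sup>+t\<in>{0..}. ennreal (\<bar>c\<bar> * exp (- t)) \<partial>lborel) = ennreal (0 - \<bar>c\<bar> * - exp (- 0))"
        by (intro nn_integral_FTC_atLeast) (auto intro!: derivative_eq_intros)
      then show ?thesis by simp
    qed
    finally have neg: "(\<integral>\<^sup>+t\<in>{0..}. ennreal (- f t) \<partial>lborel) \<le> ennreal \<bar>c\<bar>" by simp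
    have "ereal (- \<bar>c\<bar>) = 0 - enn2ereal (ennreal \<bar>c\<bar>)" by simp
    also have "\<dots> \<le> enn2ereal (\<integral>\<^sup>+t\<in>{0..}. ennreal (f t) \<partial>lborel) - enn2ereal (\<integral>\<^sup>+t\<in>{0..}. ennreal (- f t) \<partial>lborel)"
      using neg by (intro ereal_minus_mono) (auto simp: less_eq_ennreal.rep_eq)
    also have "\<dots> = cost ell \<mu> \<alpha>" by (simp add: cost_def extended_integral_def f_def)
    finally show ?thesis .
  qed
  have "ereal (- \<bar>c\<bar>) \<le> v0 E ell \<nu>"
    unfolding v0_def using lower by (intro INF_greatest) auto
  with le show ?thesis by (cases "v0 E ell \<nu>") auto
qed

text \<open>Young's inequality \<open>a b \<le> a\<^sup>2 / 2 + b\<^sup>2 / 2\<close> under the integral of the upper gradient property.\<close>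
lemma upper_gradient_energy_bound:
  assumes ug: "strong_upper_gradient E \<phi> (\<lambda>\<nu>. ennreal (g \<nu>))" and T: "0 \<le> T"
  shows "ennreal \<bar>\<phi> \<nu> - \<phi> \<mu>\<bar> \<le> energy E g T \<mu> \<nu>"
  unfolding energy_def
proof (rule INF_greatest, clarify)
  fix \<eta> assume AC: "AC_curve 2 E {0..T} \<eta>"
  have "ennreal \<bar>\<phi> (\<eta> T) - \<phi> (\<eta> 0)\<bar>
      \<le> (\<integral>\<^sup>+r\<in>{0..T}. (ennreal (g (\<eta> r)) * ennreal (metric_derivative {0..T} \<eta> r)) \<partial>lborel)"
    using T by (intro strong_upper_gradientD(2)[OF ug AC]) auto
  also have "\<dots> \<le> (\<integral>\<^sup>+t\<in>{0..T}. ennreal (1 / 2 * (metric_derivative {0..T} \<eta> t)\<^sup>2 + 1 / 2 * (g (\<eta> t))\<^sup>2) \<partial>lborel)"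
  proof (intro nn_integral_mono mult_right_mono)
    fix t
    let ?a = "g (\<eta> t)" and ?b = "metric_derivative {0..T} \<eta> t"
    show "ennreal ?a * ennreal ?b \<le> ennreal (1 / 2 * ?b\<^sup>2 + 1 / 2 * ?a\<^sup>2)"
    proof (cases "0 \<le> ?a \<and> 0 \<le> ?b")
      case True
      then have "ennreal ?a * ennreal ?b = ennreal (?a * ?b)" by (simp add: ennreal_mult)
      also have "\<dots> \<le> ennreal (1 / 2 * ?b\<^sup>2 + 1 / 2 * ?a\<^sup>2)"
        using sum_squares_bound[of ?a ?b] by (intro ennreal_leI) simp
      finally show ?thesis .
    qed (auto simp: ennreal_neg)
  qed simp
  finally show "ennreal \<bar>\<phi> (\<eta> T) - \<phi> (\<eta> 0)\<bar>
      \<le> (\<integral>\<^sup>+t\<in>{0..T}. ennreal (1 / 2 * (metric_derivative {0..T} \<eta> t)\<^sup>2 + 1 / 2 * (g (\<eta> t))\<^sup>2) \<partial>lborel)" .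
qed

lemma metric_derivative_interior:
  assumes "t \<in> interior I" "t \<in> interior J"
  shows "metric_derivative I \<mu> t = metric_derivative J \<mu> t"
  unfolding metric_derivative_def at_within_interior[OF assms(1)] at_within_interior[OF assms(2)] ..

text \<open>The interval \<open>[0, T]\<close> is enlarged to \<open>[0, T + 1]\<close> because the difference quotients in
  \<open>dissipation_integral_le\<close> look beyond \<open>T\<close>. The upper gradient property supplies, besides the increment
  bound, the measurability of \<open>G\<close> along the curve. All metric derivatives, relative to \<open>[0, T]\<close>,
  \<open>[0, T + 1]\<close> or the half-line, agree at interior times.\<close>
proposition maximal_slope_energy_le:
  assumes ug: "strong_upper_gradient E \<phi> (\<lambda>\<nu>. ennreal (g \<nu>))"
    and g0: "\<And>\<nu>. \<nu> \<in> P2 E \<Longrightarrow> 0 \<le> g \<nu>"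
    and ms: "maximal_slope_curve E \<phi> (\<lambda>\<nu>. ennreal (g \<nu>)) \<eta>"
    and T: "0 < T"
  shows "energy E g T (\<eta> 0) (\<eta> T) \<le> ennreal (\<phi> (\<eta> 0) - \<phi> (\<eta> T))"
proof -
  define b where "b = T + 1"
  have loc: "AC_curve 2 E {0..r} \<eta>" for r
    using ms by (auto simp: maximal_slope_curve_def AC2_loc_curve_def)
  note AC = loc[of b]
  have P: "\<eta> t \<in> P2 E" if "0 \<le> t" for t
    using AC_curve_P2[OF loc[of t], of t] that by simp
  have sl: "AE t in lborel. t > 0 \<longrightarrow>
      ((\<lambda>s. \<phi> (\<eta> s)) has_real_derivative - (metric_derivative {0..} \<eta> t)\<^sup>2) (at t) \<and>
      (metric_derivative {0..} \<eta> t)\<^sup>2 = (g (\<eta> t))\<^sup>2"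
  proof -
    have "AE t in lborel. t > 0 \<longrightarrow>
        ((\<lambda>s. \<phi> (\<eta> s)) has_real_derivative - (metric_derivative {0..} \<eta> t)\<^sup>2) (at t) \<and>
        ennreal ((metric_derivative {0..} \<eta> t)\<^sup>2) = (ennreal (g (\<eta> t)))\<^sup>2"
      using ms by (simp add: maximal_slope_curve_def)
    then show ?thesis
    proof eventually_elim
      case (elim t)
      show ?case
      proof
        assume t: "t > 0"
        then have "(ennreal (g (\<eta> t)))\<^sup>2 = ennreal ((g (\<eta> t))\<^sup>2)"
          using g0[OF P, of t] by (simp add: ennreal_power)
        then have "(metric_derivative {0..} \<eta> t)\<^sup>2 = (g (\<eta> t))\<^sup>2"
          using mp[OF elim t] by (metis ennreal_inj zero_le_power2)
        with mp[OF elim t] show "((\<lambda>s. \<phi> (\<eta> s)) has_real_derivative - (metric_derivative {0..} \<eta> t)\<^sup>2) (at t) \<and>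
            (metric_derivative {0..} \<eta> t)\<^sup>2 = (g (\<eta> t))\<^sup>2"
          by blast
      qed
    qed
  qed
  define G2 where "G2 t = indicator {0<..<b} t * (g (\<eta> t))\<^sup>2" for t
  have ug_b: "(\<lambda>t. ennreal (g (\<eta> t))) \<in> borel_measurable (restrict_space borel {0..b})"
    "\<And>s t. s \<in> {0..b} \<Longrightarrow> t \<in> {0..b} \<Longrightarrow> s \<le> t \<Longrightarrow> ennreal \<bar>\<phi> (\<eta> t) - \<phi> (\<eta> s)\<bar>
       \<le> (\<integral>\<^sup>+r\<in>{s..t}. (ennreal (g (\<eta> r)) * ennreal (metric_derivative {0..b} \<eta> r)) \<partial>lborel)"
    by (rule strong_upper_gradientD[OF ug AC]; assumption)+
  have G2m: "G2 \<in> borel_measurable borel"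
  proof -
    have "(\<lambda>t. enn2real (ennreal (g (\<eta> t)))) \<in> borel_measurable (restrict_space borel {0..b})"
      using ug_b(1) by measurable
    then have "(\<lambda>t. indicator {0..b} t *\<^sub>R enn2real (ennreal (g (\<eta> t)))) \<in> borel_measurable borel"
      by (subst (asm) borel_measurable_restrict_space_iff) auto
    then have "(\<lambda>t. indicator {0<..<b} t * (indicator {0..b} t *\<^sub>R enn2real (ennreal (g (\<eta> t))))\<^sup>2) \<in> borel_measurable borel"
      by measurable
    moreover have "indicator {0<..<b} t * (indicator {0..b} t *\<^sub>R enn2real (ennreal (g (\<eta> t))))\<^sup>2 = G2 t" for t
      using g0[OF P, of t] by (auto simp: G2_def indicator_def)
    ultimately show ?thesis by (simp cong: measurable_cong)
  qed
  have G20: "0 \<le> G2 t" for t by (simp add: G2_def)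
  have G2i: "integrable lborel G2"
  proof -
    have "(\<integral>\<^sup>+t. ennreal (G2 t) \<partial>lborel) = (\<integral>\<^sup>+t\<in>{0<..<b}. ennreal ((metric_derivative {0..} \<eta> t)\<^sup>2) \<partial>lborel)"
      by (rule nn_integral_cong_AE, use sl in eventually_elim) (auto simp: G2_def indicator_def)
    also have "\<dots> < \<infinity>" by (rule metric_derivative_square_integrable[OF AC])
    finally show ?thesis using G2m G20 by (subst integrable_iff_bounded) simp
  qed
  have window: "(\<integral>\<^sup>+r. ennreal (G2 r) * indicator {s..t} r \<partial>lborel) = ennreal (LINT r:{s..t}|lborel. G2 r)" for s t
  proof -
    have "(\<integral>\<^sup>+r. ennreal (G2 r) * indicator {s..t} r \<partial>lborel) = (\<integral>\<^sup>+r. ennreal (indicator {s..t} r *\<^sub>R G2 r) \<partial>lborel)"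
      by (intro nn_integral_cong) (auto simp: indicator_def)
    then show ?thesis
      unfolding set_lebesgue_integral_def
      using G20 integrable_mult_indicator[OF _ G2i, of "{s..t}"] by (simp add: nn_integral_eq_integral)
  qed
  have ae_b: "AE t in lborel. t \<noteq> 0 \<and> t \<noteq> b \<and> t \<noteq> T"
    using AE_lborel_singleton[of 0] AE_lborel_singleton[of b] AE_lborel_singleton[of T]
    by eventually_elim simp
  have "(LINT r:{0..T}|lborel. G2 r) \<le> \<phi> (\<eta> 0) - \<phi> (\<eta> T)"
  proof (rule dissipation_integral_le[where u="\<lambda>t. \<phi> (\<eta> t)" and b=b])
    show "0 \<le> T" "T < b" using T by (auto simp: b_def)
    show "AE t in lborel. 0 < t \<and> t < b \<longrightarrow> ((\<lambda>t. \<phi> (\<eta> t)) has_real_derivative - G2 t) (at t)"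
      using sl by eventually_elim (auto simp: G2_def)
    fix s t assume st: "0 \<le> s" "s \<le> t" "t \<le> b"
    have "ennreal \<bar>\<phi> (\<eta> t) - \<phi> (\<eta> s)\<bar>
       \<le> (\<integral>\<^sup>+r\<in>{s..t}. (ennreal (g (\<eta> r)) * ennreal (metric_derivative {0..b} \<eta> r)) \<partial>lborel)"
      using st by (intro ug_b(2)) auto
    also have "\<dots> \<le> (\<integral>\<^sup>+r. ennreal (G2 r) * indicator {s..t} r \<partial>lborel)"
    proof (rule nn_integral_mono_AE, use sl ae_b in eventually_elim)
      case (elim r)
      show ?case
      proof (cases "r \<in> {s..t}")
        case True
        then have r: "0 < r" "r < b" using st elim by auto
        have md: "metric_derivative {0..b} \<eta> r = metric_derivative {0..} \<eta> r"
          using r by (intro metric_derivative_interior) auto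
        have sq: "(metric_derivative {0..} \<eta> r)\<^sup>2 = (g (\<eta> r))\<^sup>2" using elim r by simp
        have g: "0 \<le> g (\<eta> r)" using r by (intro g0 P) simp
        have "metric_derivative {0..} \<eta> r \<le> g (\<eta> r)"
          using sq g by (metis power2_le_imp_le order_refl)
        then have "ennreal (g (\<eta> r)) * ennreal (metric_derivative {0..b} \<eta> r) \<le> ennreal (g (\<eta> r)) * ennreal (g (\<eta> r))"
          unfolding md by (intro mult_left_mono ennreal_leI) auto
        also have "\<dots> = ennreal (G2 r)"
          using g r by (simp add: G2_def power2_eq_square ennreal_mult)
        finally show ?thesis using True by simp
      qed simp
    qed
    finally have "ennreal \<bar>\<phi> (\<eta> t) - \<phi> (\<eta> s)\<bar> \<le> ennreal (LINT r:{s..t}|lborel. G2 r)"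
      unfolding window .
    moreover have "0 \<le> (LINT r:{s..t}|lborel. G2 r)"
      unfolding set_lebesgue_integral_def using G20 by (intro integral_nonneg_AE) auto
    ultimately show "\<bar>\<phi> (\<eta> t) - \<phi> (\<eta> s)\<bar> \<le> (LINT r:{s..t}|lborel. G2 r)"
      by (simp add: ennreal_le_iff)
  qed (use G2i G20 in auto)
  moreover have "energy E g T (\<eta> 0) (\<eta> T) \<le> ennreal (LINT r:{0..T}|lborel. G2 r)"
  proof -
    have "energy E g T (\<eta> 0) (\<eta> T)
        \<le> (\<integral>\<^sup>+t\<in>{0..T}. ennreal (1 / 2 * (metric_derivative {0..T} \<eta> t)\<^sup>2 + 1 / 2 * (g (\<eta> t))\<^sup>2) \<partial>lborel)"
      unfolding energy_def using loc[of T] by (intro INF_lower) simp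
    also have "\<dots> = (\<integral>\<^sup>+r. ennreal (G2 r) * indicator {0..T} r \<partial>lborel)"
    proof (rule nn_integral_cong_AE, use sl ae_b in eventually_elim)
      case (elim r)
      show ?case
      proof (cases "r \<in> {0..T}")
        case True
        then have r: "0 < r" "r < T" using elim by auto
        have md: "metric_derivative {0..T} \<eta> r = metric_derivative {0..} \<eta> r"
          using r by (intro metric_derivative_interior) auto
        show ?thesis using elim r by (simp add: md G2_def b_def)
      qed simp
    qed
    finally show ?thesis unfolding window .
  qed
  ultimately show ?thesis by (meson ennreal_leI order_trans)
qed

theorem proposition3p7:
  fixes E :: "'a::euclidean_space set"
    and ell :: "'a measure \<Rightarrow> real"
    and \<mu> :: "'a measure"
    and \<eta> :: "real \<Rightarrow> 'a measure"
  assumes l_continuous: "P2_continuous E ell"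
    and l_bounded_below: "bdd_below (ell ` P2 E)"
    and G_well_defined: "\<forall>\<nu>\<in>P2 E. v0 E ell \<nu> \<le> ereal (ell \<nu>)"
    and G_upper_gradient:
      "strong_upper_gradient E (v0_real E ell) (\<lambda>\<nu>. ennreal (G E ell \<nu>))"
    and mu: "\<mu> \<in> P2 E"
    and eta_maximal_slope:
      "maximal_slope_curve E (v0_real E ell) (\<lambda>\<nu>. ennreal (G E ell \<nu>)) \<eta>"
    and eta_start: "\<eta> 0 = \<mu>"
  shows "\<forall>T>0.
     v0 E ell \<mu> = (INF \<nu>\<in>reachable E T \<mu>. enn2ereal (energy E (G E ell) T \<mu> \<nu>) + v0 E ell \<nu>) \<and>
     \<eta> T \<in> reachable E T \<mu> \<and>
     enn2ereal (energy E (G E ell) T \<mu> (\<eta> T)) + v0 E ell (\<eta> T) =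
       (INF \<nu>\<in>reachable E T \<mu>. enn2ereal (energy E (G E ell) T \<mu> \<nu>) + v0 E ell \<nu>)"
proof (intro allI impI)
  fix T :: real assume T: "T > 0"
  define v where "v \<nu> = v0_real E ell \<nu>" for \<nu>
  let ?g = "G E ell"
  let ?F = "\<lambda>\<nu>. enn2ereal (energy E ?g T \<mu> \<nu>) + v0 E ell \<nu>"
  have fin: "v0 E ell \<nu> = ereal (v \<nu>)" if "\<nu> \<in> P2 E" for \<nu>
    unfolding v_def using that G_well_defined by (intro value_function_finite l_bounded_below) simp
  have G0: "0 \<le> ?g \<nu>" if "\<nu> \<in> P2 E" for \<nu>
  proof -
    have "ereal (v \<nu>) \<le> ereal (ell \<nu>)"
      using bspec[OF G_well_defined that] fin[OF that] by (simp only:)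
    then show ?thesis by (simp add: G_def v_def)
  qed
  have AC: "AC_curve 2 E {0..T} \<eta>"
    using eta_maximal_slope by (auto simp: maximal_slope_curve_def AC2_loc_curve_def)
  have reach: "\<eta> T \<in> reachable E T \<mu>"
    using AC2_curve_reachable[OF AC T] eta_start by simp
  have lower: "v0 E ell \<mu> \<le> ?F \<nu>" if "\<nu> \<in> P2 E" for \<nu>
  proof -
    have "ennreal \<bar>v \<nu> - v \<mu>\<bar> \<le> energy E ?g T \<mu> \<nu>"
      unfolding v_def by (rule upper_gradient_energy_bound[OF G_upper_gradient less_imp_le[OF T]])
    then have "ereal \<bar>v \<nu> - v \<mu>\<bar> \<le> enn2ereal (energy E ?g T \<mu> \<nu>)"
      by (simp add: less_eq_ennreal.rep_eq)
    then have "ereal \<bar>v \<nu> - v \<mu>\<bar> + ereal (v \<nu>) \<le> ?F \<nu>"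
      unfolding fin[OF that] by (rule add_right_mono)
    moreover have "ereal (v \<mu>) \<le> ereal \<bar>v \<nu> - v \<mu>\<bar> + ereal (v \<nu>)" by simp
    ultimately show ?thesis unfolding fin[OF mu] by (rule order_trans[rotated])
  qed
  have \<eta>T: "\<eta> T \<in> P2 E" using reach by (simp add: reachable_def)
  have upper: "?F (\<eta> T) \<le> v0 E ell \<mu>"
  proof -
    have le: "energy E ?g T \<mu> (\<eta> T) \<le> ennreal (v \<mu> - v (\<eta> T))"
      using maximal_slope_energy_le[OF G_upper_gradient G0 eta_maximal_slope T]
      unfolding eta_start v_def .
    have "ennreal \<bar>v (\<eta> T) - v \<mu>\<bar> \<le> ennreal (v \<mu> - v (\<eta> T))"
      using upper_gradient_energy_bound[OF G_upper_gradient less_imp_le[OF T], of "\<eta> T" \<mu>] le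
      unfolding v_def by (rule order_trans)
    then have nonneg: "0 \<le> v \<mu> - v (\<eta> T)"
      by (cases "v \<mu> - v (\<eta> T) < 0") (auto simp: ennreal_neg)
    have "enn2ereal (energy E ?g T \<mu> (\<eta> T)) \<le> ereal (v \<mu> - v (\<eta> T))"
      using le nonneg by (simp add: less_eq_ennreal.rep_eq)
    then have "?F (\<eta> T) \<le> ereal (v \<mu> - v (\<eta> T)) + ereal (v (\<eta> T))"
      unfolding fin[OF \<eta>T] by (rule add_right_mono)
    then show ?thesis unfolding fin[OF mu] by simp
  qed
  have le_INF: "v0 E ell \<mu> \<le> (INF \<nu>\<in>reachable E T \<mu>. ?F \<nu>)"
    by (rule INF_greatest, rule lower) (simp add: reachable_def)
  have INF_le: "(INF \<nu>\<in>reachable E T \<mu>. ?F \<nu>) \<le> ?F (\<eta> T)" by (rule INF_lower[OF reach])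
  show "v0 E ell \<mu> = (INF \<nu>\<in>reachable E T \<mu>. ?F \<nu>) \<and> \<eta> T \<in> reachable E T \<mu> \<and>
      ?F (\<eta> T) = (INF \<nu>\<in>reachable E T \<mu>. ?F \<nu>)"
    using le_INF INF_le upper reach by (auto intro: order_antisym order_trans)
qed

end
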